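(* Let $K$ be a field. The group $\mathrm{Cr}_\infty(K)$ is $\mathfrak{X}^{\mathrm{sep}}$-boundedly acyclic.
   Context: **Cremona groups.** $\mathrm{Cr}_n(K)=\mathrm{Aut}(K(x_1,\dots,x_n)|K)$ is the group of automorphisms over $K$ of the field of rational functions in $n$ variables. There are natural inclusions $\mathrm{Cr}_n(K)\hookrightarrow\mathrm{Cr}_{n+1}(K)$, extending an automorphism by fixing $x_{n+1}$, and $\mathrm{Cr}_\infty(K)=\bigcup_{n\in\mathbb{N}}\mathrm{Cr}_n(K)$ is the direct limit. **Bounded cohomology.** All groups are discrete. A Banach $\Gamma$-module is a real Banach space $E$ with an action of $\Gamma$ by linear isometries. $C^k_b(\Gamma;E)$ is the space of bounded functions $\Gamma^{k+1}\to E$, with the action $(\gamma\cdot f)(\gamma_0,\dots,\gamma_k)=\gamma f(\gamma^{-1}\gamma_0,\dots,\gamma^{-1}\gamma_k)$ and the simplicial coboundary; $H^\bullet_b(\Gamma;E)$ is the cohomology of the complex $C^\bullet_b(\Gamma;E)^\Gamma$ of invariants. $E$ is dual if it is isometrically $\Gamma$-isomorphic to the dual of some Banach $\Gamma$-module (with the contragredient action); separable means norm-separable. A group $\Gamma$ is $\mathfrak{X}^{\mathrm{sep}}$-boundedly acyclic if $H^n_b(\Gamma;E)=0$ for all $n\ge1$ and every separable dual Banach $\Gamma$-module $E$. *)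

theory Defs
  imports
    "HOL-Analysis.Analysis"
    "HOL-Library.Poly_Mapping"
    "HOL-Computational_Algebra.Fraction_Field"
    "HOL-Algebra.Bij"
    "HOL-Algebra.Group_Action"
    "HOL-Algebra.Elementary_Groups"
begin

section \<open>Cremona groups\<close>

text \<open>
  A monomial is a finitely supported exponent function on the variables \<open>x\<^sub>0, x\<^sub>1, \<dots>\<close>;
  a polynomial is a finitely supported coefficient function on monomials, multiplied by
  convolution. The type \<open>'k ratfun\<close> is thus the field \<open>K(x\<^sub>0, x\<^sub>1, \<dots>)\<close>. Variables are
  numbered from \<open>0\<close>, so that the field in \<open>n\<close> variables involves \<open>x\<^sub>0, \<dots>, x\<^sub>n\<^sub>-\<^sub>1\<close>.
\<close>

type_synonym 'k mpoly = "(nat \<Rightarrow>\<^sub>0 nat) \<Rightarrow>\<^sub>0 'k"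
type_synonym 'k ratfun = "'k mpoly fract"

definition poly_vars :: "'k::zero mpoly \<Rightarrow> nat set" where
  "poly_vars p = (\<Union>m\<in>Poly_Mapping.keys p. Poly_Mapping.keys m)"

definition ratfun_const :: "'k::field \<Rightarrow> 'k ratfun" where
  "ratfun_const c = Fract (Poly_Mapping.single 0 c) 1"

definition ratfun_var :: "nat \<Rightarrow> 'k::field ratfun" where
  "ratfun_var i = Fract (Poly_Mapping.single (Poly_Mapping.single i 1) 1) 1"

definition ratfun_field :: "nat \<Rightarrow> 'k::field ratfun set" where
  "ratfun_field n =
     {Fract p q | p q. poly_vars p \<subseteq> {..<n} \<and> poly_vars q \<subseteq> {..<n} \<and> q \<noteq> 0}"

text \<open>
  The group \<open>Aut(L|K)\<close> for a subfield \<open>L\<close> of \<open>K(x\<^sub>0, x\<^sub>1, \<dots>)\<close> containing \<open>K\<close>. As in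
  \<^const>\<open>BijGroup\<close>, automorphisms are extensional functions on \<open>L\<close>, and the product is
  composition.
\<close>

definition aut_group :: "'k::field ratfun set \<Rightarrow> ('k ratfun \<Rightarrow> 'k ratfun) monoid" where
  "aut_group L = (BijGroup L)\<lparr>carrier :=
     {\<sigma> \<in> Bij L. (\<forall>a\<in>L. \<forall>b\<in>L. \<sigma> (a + b) = \<sigma> a + \<sigma> b \<and> \<sigma> (a * b) = \<sigma> a * \<sigma> b) \<and>
                 (\<forall>c. \<sigma> (ratfun_const c) = ratfun_const c)}\<rparr>"

definition cremona_group :: "nat \<Rightarrow> ('k::field ratfun \<Rightarrow> 'k ratfun) monoid" where
  "cremona_group n = aut_group (ratfun_field n)"

text \<open>
  The direct limit of the groups \<open>Cr\<^sub>n(K)\<close> is realised as an increasing union of subgroups of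
  \<open>Aut(K(x\<^sub>0, x\<^sub>1, \<dots>)|K)\<close>: the set \<open>cremona_stable n\<close> is the copy of \<open>Cr\<^sub>n(K)\<close> consisting of
  the extensions of its elements that fix \<open>x\<^sub>i\<close> for all \<open>i \<ge> n\<close>.
\<close>

definition cremona_stable :: "nat \<Rightarrow> ('k::field ratfun \<Rightarrow> 'k ratfun) set" where
  "cremona_stable n =
     {\<tau> \<in> carrier (aut_group UNIV).
        restrict \<tau> (ratfun_field n) \<in> carrier (cremona_group n) \<and>
        (\<forall>i\<ge>n. \<tau> (ratfun_var i) = ratfun_var i)}"

definition cremona_group_infinity :: "('k::field ratfun \<Rightarrow> 'k ratfun) monoid" where
  "cremona_group_infinity = (aut_group UNIV)\<lparr>carrier := (\<Union>n. cremona_stable n)\<rparr>"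


section \<open>Banach modules\<close>

locale banach_module = group_action G UNIV \<rho>
  for G :: "('g, 'm) monoid_scheme" (structure) and \<rho> :: "'g \<Rightarrow> 'e::banach \<Rightarrow> 'e" +
  assumes linear_action: "g \<in> carrier G \<Longrightarrow> linear (\<rho> g)"
    and isometric_action: "g \<in> carrier G \<Longrightarrow> norm (\<rho> g v) = norm v"

definition contragredient ::
  "('g, 'm) monoid_scheme \<Rightarrow> ('g \<Rightarrow> 'f::banach \<Rightarrow> 'f) \<Rightarrow> 'g \<Rightarrow> ('f \<Rightarrow>\<^sub>L real) \<Rightarrow> ('f \<Rightarrow>\<^sub>L real)" where
  "contragredient G \<pi> g \<phi> = Blinfun (\<lambda>v. blinfun_apply \<phi> (\<pi> (inv\<^bsub>G\<^esub> g) v))"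

text \<open>
  The module \<open>(E, \<rho>)\<close> is isometrically isomorphic, equivariantly, to the dual of \<open>(F, \<pi>)\<close>.
\<close>

definition is_dual_of ::
  "('g, 'm) monoid_scheme \<Rightarrow> ('g \<Rightarrow> 'e::banach \<Rightarrow> 'e) \<Rightarrow> ('g \<Rightarrow> 'f::banach \<Rightarrow> 'f) \<Rightarrow> bool" where
  "is_dual_of G \<rho> \<pi> \<longleftrightarrow>
     (\<exists>\<Phi> :: 'e \<Rightarrow> ('f \<Rightarrow>\<^sub>L real). linear \<Phi> \<and> bij \<Phi> \<and> (\<forall>v. norm (\<Phi> v) = norm v) \<and>
        (\<forall>g\<in>carrier G. \<forall>v. \<Phi> (\<rho> g v) = contragredient G \<pi> g (\<Phi> v)))"


section \<open>Bounded cohomology\<close>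

text \<open>A tuple in \<open>\<Gamma>\<^sup>k\<^sup>+\<^sup>1\<close> is a list of length \<open>k + 1\<close>; cochains are extensional functions.\<close>

definition tuples :: "('g, 'm) monoid_scheme \<Rightarrow> nat \<Rightarrow> 'g list set" where
  "tuples G k = {xs. set xs \<subseteq> carrier G \<and> length xs = Suc k}"

definition bounded_cochains ::
  "('g, 'm) monoid_scheme \<Rightarrow> nat \<Rightarrow> ('g list \<Rightarrow> 'e::banach) set" where
  "bounded_cochains G k = {f \<in> extensional (tuples G k). bounded (f ` tuples G k)}"

definition cochain_action ::
  "('g, 'm) monoid_scheme \<Rightarrow> ('g \<Rightarrow> 'e::banach \<Rightarrow> 'e) \<Rightarrow> nat \<Rightarrow>
     'g \<Rightarrow> ('g list \<Rightarrow> 'e) \<Rightarrow> ('g list \<Rightarrow> 'e)" where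
  "cochain_action G \<rho> k g f = (\<lambda>xs\<in>tuples G k. \<rho> g (f (map (\<lambda>x. inv\<^bsub>G\<^esub> g \<otimes>\<^bsub>G\<^esub> x) xs)))"

definition invariant_cochains ::
  "('g, 'm) monoid_scheme \<Rightarrow> ('g \<Rightarrow> 'e::banach \<Rightarrow> 'e) \<Rightarrow> nat \<Rightarrow> ('g list \<Rightarrow> 'e) set" where
  "invariant_cochains G \<rho> k =
     {f \<in> bounded_cochains G k. \<forall>g\<in>carrier G. cochain_action G \<rho> k g f = f}"

definition cochain_group ::
  "('g, 'm) monoid_scheme \<Rightarrow> ('g \<Rightarrow> 'e::banach \<Rightarrow> 'e) \<Rightarrow> nat \<Rightarrow> ('g list \<Rightarrow> 'e) monoid" where
  "cochain_group G \<rho> k =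
     \<lparr>carrier = invariant_cochains G \<rho> k,
      mult = \<lambda>f h. \<lambda>xs\<in>tuples G k. f xs + h xs,
      one = \<lambda>xs\<in>tuples G k. 0\<rparr>"

definition coboundary ::
  "('g, 'm) monoid_scheme \<Rightarrow> nat \<Rightarrow> ('g list \<Rightarrow> 'e::banach) \<Rightarrow> ('g list \<Rightarrow> 'e)" where
  "coboundary G k f =
     (\<lambda>xs\<in>tuples G (Suc k). \<Sum>i\<le>Suc k. (-1) ^ i *\<^sub>R f (take i xs @ drop (Suc i) xs))"

definition cocycles ::
  "('g, 'm) monoid_scheme \<Rightarrow> ('g \<Rightarrow> 'e::banach \<Rightarrow> 'e) \<Rightarrow> nat \<Rightarrow> ('g list \<Rightarrow> 'e) set" where
  "cocycles G \<rho> k = kernel (cochain_group G \<rho> k) (cochain_group G \<rho> (Suc k)) (coboundary G k)"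

definition coboundaries ::
  "('g, 'm) monoid_scheme \<Rightarrow> ('g \<Rightarrow> 'e::banach \<Rightarrow> 'e) \<Rightarrow> nat \<Rightarrow> ('g list \<Rightarrow> 'e) set" where
  "coboundaries G \<rho> k =
     (case k of 0 \<Rightarrow> {\<one>\<^bsub>cochain_group G \<rho> 0\<^esub>} | Suc j \<Rightarrow> coboundary G j ` invariant_cochains G \<rho> j)"

text \<open>
  Only the additive group of \<open>H\<^sub>b\<^sup>k(\<Gamma>; E)\<close> is recorded, which suffices for its vanishing.
\<close>

definition bounded_cohomology ::
  "('g, 'm) monoid_scheme \<Rightarrow> ('g \<Rightarrow> 'e::banach \<Rightarrow> 'e) \<Rightarrow> nat \<Rightarrow> ('g list \<Rightarrow> 'e) set monoid" where
  "bounded_cohomology G \<rho> k =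
     (cochain_group G \<rho> k)\<lparr>carrier := cocycles G \<rho> k\<rparr> Mod coboundaries G \<rho> k"

text \<open>
  Bounded acyclicity quantifies over Banach modules on arbitrary Banach spaces \<open>E\<close> (with predual
  \<open>F\<close>). HOL cannot quantify over types inside a formula, so the underlying spaces enter as type
  arguments; the full notion is the statement for all types \<open>'e\<close> and \<open>'f\<close>. The existential
  quantifier over the predual in the hypothesis becomes a universal one in front.
\<close>

definition Xsep_boundedly_acyclic ::
  "('g, 'm) monoid_scheme \<Rightarrow> 'e::banach itself \<Rightarrow> 'f::banach itself \<Rightarrow> bool" where
  "Xsep_boundedly_acyclic G _ _ \<longleftrightarrow>
     (\<forall>n\<ge>1. \<forall>(\<rho> :: 'g \<Rightarrow> 'e \<Rightarrow> 'e) (\<pi> :: 'g \<Rightarrow> 'f \<Rightarrow> 'f).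
        banach_module G \<rho> \<longrightarrow> separable_space (euclidean :: 'e topology) \<longrightarrow>
        banach_module G \<pi> \<longrightarrow> is_dual_of G \<rho> \<pi> \<longrightarrow>
        trivial_group (bounded_cohomology G \<rho> n))"

end

theory Submission
  imports Defs "HOL-Probability.Product_PMF" "HOL-Combinatorics.Permutations"
begin

text \<open>
  Let \<open>F\<close> be a finite subset of \<open>\<Gamma> = Cr\<^sub>\<infinity>(K)\<close>, say in \<open>n\<close> variables. Permuting blocks of \<open>n\<close> variables
  produces commuting copies of \<open>F\<close>, one for each block, which are permuted by the finitary
  permutations of the blocks. Multiplying independent uniform letters from \<open>F\<close> in the first \<open>N\<close>
  blocks, and a uniform permutation of these blocks, gives a random element \<open>y\<close> of \<open>\<Gamma>\<close>.

  For a bounded cocycle \<open>c\<close> and independent copies \<open>y\<^sub>j\<close> of \<open>y\<close>, conditioned on the letter \<open>1\<close> in block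
  \<open>0\<close>, the prism operator shows that \<open>c\<close> is cohomologous, with uniform bounds, to the average of
  \<open>c(h\<^sub>0y\<^sub>0, \<dots>, h\<^sub>ky\<^sub>k)\<close>, that is, to the average of \<open>c\<close> at \<open>k + 1\<close> random elements conditioned on
  the letters \<open>h\<^sub>j\<close> in block \<open>0\<close>. In the weak-* limit \<open>N \<rightarrow> \<infinity>\<close> these conditional averages form a
  bounded exchangeable martingale with values in a separable dual space, and such a martingale
  does not depend on the letters at all. Hence the limit of the averages is constant on \<open>F\<close>, and
  a weak-* limit over all \<open>F\<close> of the resulting primitives settles the claim.
\<close>

section \<open>Generalised limits\<close>

text \<open>The prism over a tuple joins the point masses at the \<open>h\<^sub>j\<close> to the
  translates by \<open>h\<^sub>j\<close> of one law, that of \<open>y\<close> with letter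
  \<open>1\<close> in block \<open>0\<close>. It is therefore defined and equivariant on all of
  \<open>\<Gamma>\<close>; that the \<open>h\<^sub>j\<close> lie in \<open>F\<close> matters only
  for recognising these translates as conditional laws. The random permutation is there for
  exchangeability: without it, relabelling the blocks of a random word by a left translation would
  leave a permutation behind on the right. With it, relabelling blocks changes conditional averages
  only by isometries of \<open>E\<close>. For fixed \<open>N\<close> only \<open>N\<close>
  coordinates exist, too few to contradict separability; hence the limit in \<open>N\<close>
  precedes the martingale argument. What remains is a constant vector \<open>v\<close>. In odd
  degree it vanishes, because a cocycle vanishes on equal arguments; in even degree its limit is an
  invariant vector, and a constant cochain has it as coboundary.\<close>

lemma cluster_point_in_closed:
  assumes "inf (nhds x) F \<noteq> bot" "closed S" "eventually (\<lambda>y. y \<in> S) F"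
  shows "x \<in> S"
proof (rule ccontr)
  assume "x \<notin> S"
  then have "eventually (\<lambda>y. y \<in> - S) (nhds x)"
    using \<open>closed S\<close> by (intro eventually_nhds_in_open) auto
  then have "eventually (\<lambda>y. y \<in> - S \<and> y \<in> S) (inf (nhds x) F)"
    using assms(3) unfolding eventually_inf by blast
  then show False
    using assms(1) by (simp add: trivial_limit_def)
qed

text \<open>Compactness replaces an ultrafilter: the evaluations at the points \<open>i\<close> lie
  in a product of closed balls, one for each function, and \<open>L\<close> is a cluster point of
  them along \<open>F\<close>. Each required property defines a closed set of functionals, so it
  passes to the cluster point.\<close>

lemma generalized_limit:
  fixes F :: "'i filter"
  assumes "F \<noteq> bot"
  obtains L :: "('i \<Rightarrow> real) \<Rightarrow> real" where
    "\<And>f g. bounded (range f) \<Longrightarrow> bounded (range g) \<Longrightarrow> L (\<lambda>i. f i + g i) = L f + L g"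
    "\<And>c f. bounded (range f) \<Longrightarrow> L (\<lambda>i. c * f i) = c * L f"
    "\<And>f a. bounded (range f) \<Longrightarrow> eventually (\<lambda>i. f i \<le> a) F \<Longrightarrow> L f \<le> a"
proof -
  \<comment> \<open>Unbounded functions are evaluated to 0, so that every coordinate of
    \<open>ev\<close> stays in a ball.\<close>
  define ev :: "'i \<Rightarrow> ('i \<Rightarrow> real) \<Rightarrow> real"
    where "ev i f = (if bounded (range f) then f i else 0)" for i f
  have "\<exists>b. \<forall>i. ev i f \<in> cball 0 b" for f
  proof (cases "bounded (range f)")
    case True
    then show ?thesis by (auto simp: ev_def bounded_iff)
  next
    case False
    then show ?thesis by (intro exI [of _ 0]) (simp add: ev_def)
  qed
  then obtain b where b: "\<And>f i. ev i f \<in> cball 0 (b f)"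
    by metis
  let ?K = "PiE UNIV (\<lambda>f. cball (0::real) (b f))"
  have "compact ?K"
    unfolding compactin_euclidean_iff [symmetric] euclidean_product_topology [symmetric]
    by (subst compactin_PiE) simp
  moreover have "eventually (\<lambda>x. x \<in> ?K) (filtermap ev F)"
    using b by (auto simp: eventually_filtermap PiE_UNIV_domain)
  moreover have "filtermap ev F \<noteq> bot"
    using assms by (simp add: filtermap_bot_iff)
  ultimately obtain L where L: "inf (nhds L) (filtermap ev F) \<noteq> bot"
    unfolding compact_filter by blast
  have cont: "continuous_on UNIV (\<lambda>T::('i \<Rightarrow> real) \<Rightarrow> real. T f)" for f
    by (rule continuous_on_product_coordinates)
  show thesis
  proof
    fix f g :: "'i \<Rightarrow> real" assume fg: "bounded (range f)" "bounded (range g)"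
    then have "bounded (range (\<lambda>i. f i + g i))"
      by (rule bounded_plus_comp)
    then have "L \<in> {T. T (\<lambda>i. f i + g i) = T f + T g}"
      using fg
      by (intro cluster_point_in_closed [OF L] closed_Collect_eq continuous_intros cont)
         (auto simp: eventually_filtermap ev_def)
    then show "L (\<lambda>i. f i + g i) = L f + L g" by simp
  next
    fix c and f :: "'i \<Rightarrow> real" assume f: "bounded (range f)"
    then have "bounded (range (\<lambda>i. c * f i))"
      using bounded_scaling [OF f, of c] by (simp add: image_image)
    then have "L \<in> {T. T (\<lambda>i. c * f i) = c * T f}"
      using f
      by (intro cluster_point_in_closed [OF L] closed_Collect_eq continuous_intros cont)
         (auto simp: eventually_filtermap ev_def)
    then show "L (\<lambda>i. c * f i) = c * L f" by simp
  next
    fix a and f :: "'i \<Rightarrow> real" assume f: "bounded (range f)" "eventually (\<lambda>i. f i \<le> a) F"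
    then have "L \<in> {T. T f \<le> a}"
      by (intro cluster_point_in_closed [OF L] closed_Collect_le continuous_intros cont)
         (auto simp: eventually_filtermap ev_def)
    then show "L f \<le> a" by simp
  qed
qed

section \<open>Weak-* limits in dual Banach spaces\<close>

locale weak_limit_operator =
  fixes \<Phi> :: "'e::banach \<Rightarrow> ('f::banach \<Rightarrow>\<^sub>L real)" and F :: "'i filter" and W :: "('i \<Rightarrow> 'e) \<Rightarrow> 'e"
  assumes add: "bounded (range u) \<Longrightarrow> bounded (range v) \<Longrightarrow> W (\<lambda>i. u i + v i) = W u + W v"
    and scale: "bounded (range u) \<Longrightarrow> W (\<lambda>i. c *\<^sub>R u i) = c *\<^sub>R W u"
    and const: "W (\<lambda>i. x) = x"
    and norm_le: "bounded (range u) \<Longrightarrow> eventually (\<lambda>i. norm (u i) \<le> C) F \<Longrightarrow> norm (W u) \<le> C"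
    and halfspace: "bounded (range u) \<Longrightarrow> eventually (\<lambda>i. t \<le> blinfun_apply (\<Phi> (u i)) \<xi>) F \<Longrightarrow>
       t \<le> blinfun_apply (\<Phi> (W u)) \<xi>"
    and equivariant: "bounded (range u) \<Longrightarrow> bounded (range (\<lambda>i. T (u i))) \<Longrightarrow>
       (\<And>v \<xi>. blinfun_apply (\<Phi> (T v)) \<xi> = blinfun_apply (\<Phi> v) (T' \<xi>)) \<Longrightarrow> W (\<lambda>i. T (u i)) = T (W u)"
begin

lemma sum:
  assumes "finite I" "\<And>i. i \<in> I \<Longrightarrow> bounded (range (u i))"
  shows "W (\<lambda>n. \<Sum>i\<in>I. a i *\<^sub>R u i n) = (\<Sum>i\<in>I. a i *\<^sub>R W (u i))"
proof -
  have "W (\<lambda>n. \<Sum>i\<in>I. a i *\<^sub>R u i n) = (\<Sum>i\<in>I. a i *\<^sub>R W (u i)) \<and>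
      bounded (range (\<lambda>n. \<Sum>i\<in>I. a i *\<^sub>R u i n))"
    using assms
  proof (induction I rule: finite_induct)
    case (insert j I)
    have "bounded (range (\<lambda>n. a j *\<^sub>R u j n))"
      using bounded_scaling [of "range (u j)" "a j"] insert.prems by (simp add: image_image)
    then show ?case
      using insert by (simp add: add scale bounded_plus_comp)
  qed (simp add: const)
  then show ?thesis ..
qed

lemma diff:
  assumes "bounded (range u)" "bounded (range v)"
  shows "W (\<lambda>i. u i - v i) = W u - W v"
proof -
  have "bounded (range (\<lambda>i. - 1 *\<^sub>R v i))"
    using assms by (simp add: bounded_iff)
  then show ?thesis
    using add [OF assms(1), of "\<lambda>i. - 1 *\<^sub>R v i"] scale [OF assms(2), of "- 1"] by simp
qed

lemma cong:
  assumes "bounded (range u)" "bounded (range v)" "eventually (\<lambda>i. u i = v i) F"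
  shows "W u = W v"
proof -
  have "bounded (range (\<lambda>i. u i - v i))"
    using assms by (simp add: bounded_minus_comp)
  then have "norm (W (\<lambda>i. u i - v i)) \<le> 0"
    by (rule norm_le) (use assms(3) in \<open>auto elim!: eventually_mono\<close>)
  then show ?thesis
    using diff [OF assms(1,2)] by simp
qed

end

text \<open>Pairing \<open>u i\<close> with a vector of the predual and applying a scalar
  generalised limit gives a bounded functional on the predual, which is \<open>\<Phi>\<close> of
  some vector because \<open>\<Phi>\<close> is onto. The axioms are then checked after pairing. In
  particular \<open>W\<close> commutes with every map that has a pre-adjoint, as the operators of a
  contragredient action do.\<close>

lemma weak_limit_operator_exists:
  fixes \<Phi> :: "'e::banach \<Rightarrow> ('f::banach \<Rightarrow>\<^sub>L real)" and F :: "'i filter"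
  assumes lin: "linear \<Phi>" and bij: "bij \<Phi>" and iso: "\<And>v. norm (\<Phi> v) = norm v" and F: "F \<noteq> bot"
  obtains W where "weak_limit_operator \<Phi> F W"
proof -
  obtain L :: "('i \<Rightarrow> real) \<Rightarrow> real" where
    Ladd: "\<And>f g. bounded (range f) \<Longrightarrow> bounded (range g) \<Longrightarrow> L (\<lambda>i. f i + g i) = L f + L g"
    and Lmult: "\<And>c f. bounded (range f) \<Longrightarrow> L (\<lambda>i. c * f i) = c * L f"
    and Lle: "\<And>f a. bounded (range f) \<Longrightarrow> eventually (\<lambda>i. f i \<le> a) F \<Longrightarrow> L f \<le> a"
    using generalized_limit [OF F] by blast
  have Lge: "a \<le> L f" if "bounded (range f)" "eventually (\<lambda>i. a \<le> f i) F" for f a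
  proof -
    have "bounded (range (\<lambda>i. - 1 * f i))"
      using that(1) by (simp add: bounded_iff)
    then have "L (\<lambda>i. - 1 * f i) \<le> - a"
      using that by (intro Lle) (auto elim: eventually_mono)
    then show ?thesis
      by (subst (asm) Lmult) (use that in auto)
  qed
  have apply_le: "\<bar>blinfun_apply (\<Phi> v) \<xi>\<bar> \<le> norm v * norm \<xi>" for v \<xi>
    using norm_blinfun [of "\<Phi> v" \<xi>] by (simp add: iso)
  have bd: "bounded (range (\<lambda>i. blinfun_apply (\<Phi> (u i)) \<xi>))" if u: "bounded (range u)" for u :: "'i \<Rightarrow> 'e" and \<xi>
  proof -
    obtain C where "\<And>i. norm (u i) \<le> C"
      using u by (auto simp: bounded_iff)
    then have "\<bar>blinfun_apply (\<Phi> (u i)) \<xi>\<bar> \<le> C * norm \<xi>" for i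
      using apply_le [of "u i" \<xi>] by (meson mult_right_mono norm_ge_zero order_trans)
    then show ?thesis by (auto simp: bounded_iff)
  qed
  have L_bound: "\<bar>L (\<lambda>i. blinfun_apply (\<Phi> (u i)) \<xi>)\<bar> \<le> C * norm \<xi>"
    if u: "bounded (range u)" and C: "eventually (\<lambda>i. norm (u i) \<le> C) F" for u :: "'i \<Rightarrow> 'e" and C \<xi>
  proof -
    have ev: "eventually (\<lambda>i. \<bar>blinfun_apply (\<Phi> (u i)) \<xi>\<bar> \<le> C * norm \<xi>) F"
      using C by eventually_elim (meson apply_le mult_right_mono norm_ge_zero order_trans)
    then have "eventually (\<lambda>i. blinfun_apply (\<Phi> (u i)) \<xi> \<le> C * norm \<xi>) F"
      "eventually (\<lambda>i. - (C * norm \<xi>) \<le> blinfun_apply (\<Phi> (u i)) \<xi>) F"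
      by (auto elim: eventually_mono)
    then show ?thesis
      using Lle Lge bd [OF u] by (metis abs_le_iff minus_le_iff)
  qed
  define W where "W u = inv_into UNIV \<Phi> (Blinfun (\<lambda>\<xi>. L (\<lambda>i. blinfun_apply (\<Phi> (u i)) \<xi>)))" for u :: "'i \<Rightarrow> 'e"
  have W: "blinfun_apply (\<Phi> (W u)) \<xi> = L (\<lambda>i. blinfun_apply (\<Phi> (u i)) \<xi>)" if u: "bounded (range u)" for u \<xi>
  proof -
    obtain C where C: "\<And>i. norm (u i) \<le> C"
      using u by (auto simp: bounded_iff)
    have "bounded_linear (\<lambda>\<xi>. L (\<lambda>i. blinfun_apply (\<Phi> (u i)) \<xi>))"
    proof (rule bounded_linear_intro [where K = C])
      show "norm (L (\<lambda>i. blinfun_apply (\<Phi> (u i)) x)) \<le> norm x * C" for x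
        using L_bound [OF u, of C x] C by (simp add: mult.commute)
    qed (use Ladd Lmult bd [OF u] in \<open>simp_all add: blinfun.add_right blinfun.scaleR_right\<close>)
    then show ?thesis
      using bij by (simp add: W_def bij_is_surj surj_f_inv_f bounded_linear_Blinfun_apply)
  qed
  have eqI: "v = w" if "\<And>\<xi>. blinfun_apply (\<Phi> v) \<xi> = blinfun_apply (\<Phi> w) \<xi>" for v w
    using that bij by (metis bij_is_inj blinfun_eqI injD)
  show thesis
  proof (rule that, unfold_locales)
    show "W (\<lambda>i. v) = v" for v
    proof (rule eqI)
      fix \<xi>
      show "blinfun_apply (\<Phi> (W (\<lambda>i. v))) \<xi> = blinfun_apply (\<Phi> v) \<xi>"
        by (simp add: W) (intro antisym Lle Lge; simp)
    qed
    show "W (\<lambda>i. u i + v i) = W u + W v" if "bounded (range u)" "bounded (range v)" for u v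
      using that bounded_plus_comp [OF that] 
      by (intro eqI) (simp add: W Ladd bd linear_add [OF lin] blinfun.add_left)
    show "W (\<lambda>i. c *\<^sub>R u i) = c *\<^sub>R W u" if "bounded (range u)" for c u
    proof -
      have "bounded (range (\<lambda>i. c *\<^sub>R u i))"
        using bounded_scaling [OF that, of c] by (simp add: image_image)
      then show ?thesis
        using that by (intro eqI) (simp add: W Lmult bd linear_scale [OF lin] blinfun.scaleR_left)
    qed
    show "norm (W u) \<le> C" if "bounded (range u)" "eventually (\<lambda>i. norm (u i) \<le> C) F" for u C
    proof -
      have "0 \<le> C"
        using eventually_happens [OF that(2)] F by (meson norm_ge_zero order_trans)
      then have "norm (\<Phi> (W u)) \<le> C"
        using L_bound [OF that] by (intro norm_blinfun_bound) (simp_all add: W [OF that(1)])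
      then show ?thesis by (simp add: iso)
    qed
    show "t \<le> blinfun_apply (\<Phi> (W u)) \<xi>"
      if "bounded (range u)" "eventually (\<lambda>i. t \<le> blinfun_apply (\<Phi> (u i)) \<xi>) F" for u \<xi> t
      using Lge that bd by (simp add: W)
    show "W (\<lambda>i. T (u i)) = T (W u)"
      if "bounded (range u)" "bounded (range (\<lambda>i. T (u i)))"
        "\<And>v \<xi>. blinfun_apply (\<Phi> (T v)) \<xi> = blinfun_apply (\<Phi> v) (T' \<xi>)" for u T T'
      using that by (intro eqI) (simp add: W)
  qed
qed

section \<open>Exchangeable martingales\<close>

text \<open>The partial map \<open>p\<close> lists the revealed values of independent coordinates
  with law \<open>w\<close>, and \<open>g p\<close> is the conditional expectation given them.
  Revealing one coordinate splits the second moment into \<open>(g p)\<^sup>2\<close> and a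
  variance, and by Jensen it does not decrease the expected squared reaction to the others.
  Induction over \<open>I\<close> thus packs all reactions to the letter \<open>z\<close> under the
  bound \<open>C\<^sup>2\<close>.\<close>

lemma martingale_bessel:
  fixes g :: "(nat \<rightharpoonup> 'y) \<Rightarrow> real"
  assumes mart: "\<And>p i. finite (dom p) \<Longrightarrow> ran p \<subseteq> Y \<Longrightarrow> i \<notin> dom p \<Longrightarrow> g p = (\<Sum>z\<in>Y. w z * g (p(i \<mapsto> z)))"
    and bd: "\<And>p. finite (dom p) \<Longrightarrow> ran p \<subseteq> Y \<Longrightarrow> \<bar>g p\<bar> \<le> C"
    and Y: "finite Y" "\<And>z. z \<in> Y \<Longrightarrow> 0 \<le> w z" "sum w Y = 1"
    and I: "finite I" "I \<inter> dom p = {}" and p: "finite (dom p)" "ran p \<subseteq> Y" and z: "z \<in> Y"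
  shows "(g p)\<^sup>2 + (\<Sum>i\<in>I. w z * (g (p(i \<mapsto> z)) - g p)\<^sup>2) \<le> C\<^sup>2"
  using I p
proof (induction I arbitrary: p rule: finite_induct)
  case empty
  then show ?case
    using bd [of p] by (simp add: abs_le_square_iff [symmetric])
next
  case (insert i I)
  have jensen: "(\<Sum>v\<in>Y. w v * h v)\<^sup>2 \<le> (\<Sum>v\<in>Y. w v * (h v)\<^sup>2)" for h
  proof -
    define m where "m = (\<Sum>v\<in>Y. w v * h v)"
    have "0 \<le> (\<Sum>v\<in>Y. w v * (h v - m)\<^sup>2)"
      using Y by (intro sum_nonneg) auto
    also have "\<dots> = (\<Sum>v\<in>Y. w v * (h v)\<^sup>2 - 2 * m * (w v * h v) + m\<^sup>2 * w v)"
      by (intro sum.cong) (auto simp: power2_eq_square algebra_simps)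
    also have "\<dots> = (\<Sum>v\<in>Y. w v * (h v)\<^sup>2) - m\<^sup>2"
      by (simp add: sum.distrib sum_subtractf sum_distrib_left [symmetric] Y(3) m_def [symmetric] power2_eq_square)
    finally show ?thesis by (simp add: m_def)
  qed
  have dom: "i \<notin> dom p" "finite (dom p)" "ran p \<subseteq> Y" using insert.prems by auto
  have pv: "finite (dom (p(i \<mapsto> v)))" "ran (p(i \<mapsto> v)) \<subseteq> Y" "I \<inter> dom (p(i \<mapsto> v)) = {}" if "v \<in> Y" for v
    using that insert.prems insert.hyps by (auto simp: ran_def)
  have gp: "g p = (\<Sum>v\<in>Y. w v * g (p(i \<mapsto> v)))"
    by (rule mart) (use dom in auto)
  \<comment> \<open>Of the variance at coordinate \<open>i\<close>, only the summand of
    \<open>z\<close> is kept.\<close>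
  have "(g p)\<^sup>2 + w z * (g (p(i \<mapsto> z)) - g p)\<^sup>2 \<le> (g p)\<^sup>2 + (\<Sum>v\<in>Y. w v * (g (p(i \<mapsto> v)) - g p)\<^sup>2)"
    using Y z by (intro add_left_mono member_le_sum) auto
  also have "(\<Sum>v\<in>Y. w v * (g (p(i \<mapsto> v)) - g p)\<^sup>2)
      = (\<Sum>v\<in>Y. w v * (g (p(i \<mapsto> v)))\<^sup>2 - 2 * g p * (w v * g (p(i \<mapsto> v))) + (g p)\<^sup>2 * w v)"
    by (intro sum.cong) (auto simp: power2_eq_square algebra_simps)
  also have "\<dots> = (\<Sum>v\<in>Y. w v * (g (p(i \<mapsto> v)))\<^sup>2) - (g p)\<^sup>2"
    by (simp add: sum.distrib sum_subtractf sum_distrib_left [symmetric] Y(3) gp [symmetric] power2_eq_square)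
  finally have 1: "(g p)\<^sup>2 + w z * (g (p(i \<mapsto> z)) - g p)\<^sup>2 \<le> (\<Sum>v\<in>Y. w v * (g (p(i \<mapsto> v)))\<^sup>2)"
    by linarith
  \<comment> \<open>The increment at \<open>p\<close> is the \<open>w\<close>-average of the
    increments at \<open>p(i \<mapsto> v)\<close>, so Jensen applies.\<close>
  have 2: "(g (p(j \<mapsto> z)) - g p)\<^sup>2 \<le> (\<Sum>v\<in>Y. w v * (g (p(i \<mapsto> v, j \<mapsto> z)) - g (p(i \<mapsto> v)))\<^sup>2)" if j: "j \<in> I" for j
  proof -
    have ij: "i \<noteq> j" "j \<notin> dom p" using j insert by auto
    have "finite (dom (p(j \<mapsto> z)))" "ran (p(j \<mapsto> z)) \<subseteq> Y" "i \<notin> dom (p(j \<mapsto> z))"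
      using dom ij z by (auto simp: ran_def)
    then have "g (p(j \<mapsto> z)) = (\<Sum>v\<in>Y. w v * g (p(j \<mapsto> z, i \<mapsto> v)))"
      by (rule mart)
    also have "\<dots> = (\<Sum>v\<in>Y. w v * g (p(i \<mapsto> v, j \<mapsto> z)))"
      using ij by (simp add: fun_upd_twist)
    finally have "g (p(j \<mapsto> z)) - g p = (\<Sum>v\<in>Y. w v * (g (p(i \<mapsto> v, j \<mapsto> z)) - g (p(i \<mapsto> v))))"
      by (simp add: gp right_diff_distrib sum_subtractf)
    then show ?thesis
      using jensen [of "\<lambda>v. g (p(i \<mapsto> v, j \<mapsto> z)) - g (p(i \<mapsto> v))"] by simp
  qed
  have "(g p)\<^sup>2 + (\<Sum>j\<in>insert i I. w z * (g (p(j \<mapsto> z)) - g p)\<^sup>2)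
      = ((g p)\<^sup>2 + w z * (g (p(i \<mapsto> z)) - g p)\<^sup>2) + (\<Sum>j\<in>I. w z * (g (p(j \<mapsto> z)) - g p)\<^sup>2)"
    using insert.hyps by simp
  also have "\<dots> \<le> (\<Sum>v\<in>Y. w v * (g (p(i \<mapsto> v)))\<^sup>2)
      + (\<Sum>j\<in>I. w z * (\<Sum>v\<in>Y. w v * (g (p(i \<mapsto> v, j \<mapsto> z)) - g (p(i \<mapsto> v)))\<^sup>2))"
    using Y z 2 by (intro add_mono 1 sum_mono mult_left_mono) auto
  also have "\<dots> = (\<Sum>v\<in>Y. w v * ((g (p(i \<mapsto> v)))\<^sup>2
      + (\<Sum>j\<in>I. w z * (g (p(i \<mapsto> v, j \<mapsto> z)) - g (p(i \<mapsto> v)))\<^sup>2)))"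
    by (subst sum_distrib_left, subst sum.swap)
       (simp add: sum.distrib distrib_left sum_distrib_left mult.left_commute)
  also have "\<dots> \<le> (\<Sum>v\<in>Y. w v * C\<^sup>2)"
    using insert.IH [OF pv(3) pv(1) pv(2)] Y(2) by (intro sum_mono mult_left_mono)
  also have "\<dots> = C\<^sup>2"
    by (simp add: sum_distrib_right [symmetric] Y(3))
  finally show ?case .
qed

text \<open>By Bessel, the reactions to the individual coordinates are square summable.\<close>

lemma martingale_distant_coordinate:
  fixes G :: "((nat \<rightharpoonup> 'y) \<Rightarrow> real) set"
  assumes mart: "\<And>g p i. g \<in> G \<Longrightarrow> finite (dom p) \<Longrightarrow> ran p \<subseteq> Y \<Longrightarrow> i \<notin> dom p \<Longrightarrow>
      g p = (\<Sum>z\<in>Y. w z * g (p(i \<mapsto> z)))"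
    and bd: "\<And>g p. g \<in> G \<Longrightarrow> finite (dom p) \<Longrightarrow> ran p \<subseteq> Y \<Longrightarrow> \<bar>g p\<bar> \<le> C"
    and Y: "finite Y" "\<And>z. z \<in> Y \<Longrightarrow> 0 < w z" "sum w Y = 1"
    and G: "finite G" and P: "finite P" "\<And>p. p \<in> P \<Longrightarrow> finite (dom p) \<and> ran p \<subseteq> Y"
    and A: "finite A" and d: "0 < \<delta>"
  obtains i where "i \<notin> A" "\<And>p. p \<in> P \<Longrightarrow> i \<notin> dom p"
    "\<And>g p z. g \<in> G \<Longrightarrow> p \<in> P \<Longrightarrow> z \<in> Y \<Longrightarrow> \<bar>g (p(i \<mapsto> z)) - g p\<bar> < \<delta>"
proof -
  let ?D = "- (A \<union> (\<Union>p\<in>P. dom p)) :: nat set"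
  let ?T = "G \<times> P \<times> Y"
  have "finite (A \<union> (\<Union>p\<in>P. dom p))" using A P by auto
  then have inf: "infinite ?D"
    by (metis Compl_eq_Diff_UNIV Diff_infinite_finite infinite_UNIV_nat)
  define bad where "bad g p z = {i\<in>?D. \<delta> \<le> \<bar>g (p(i \<mapsto> z)) - g p\<bar>}"
    for g :: "(nat \<rightharpoonup> 'y) \<Rightarrow> real" and p z
  have fin: "finite (bad g p z)" if t: "g \<in> G" "p \<in> P" "z \<in> Y" for g p z
  proof (rule ccontr)
    assume inf: "infinite (bad g p z)"
    have c: "0 < w z * \<delta>\<^sup>2" using d Y t by simp
    \<comment> \<open>More than \<open>C\<^sup>2 / (w z * \<delta>\<^sup>2)\<close> bad coordinates
      would violate the Bessel bound.\<close>
    obtain n :: nat where n: "C\<^sup>2 < n * (w z * \<delta>\<^sup>2)"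
      using c ex_less_of_nat_mult by blast
    obtain I where I: "I \<subseteq> {i\<in>?D. \<delta> \<le> \<bar>g (p(i \<mapsto> z)) - g p\<bar>}" "finite I" "card I = n"
      using infinite_arbitrarily_large [OF inf] unfolding bad_def by metis
    have "n * (w z * \<delta>\<^sup>2) = (\<Sum>i\<in>I. w z * \<delta>\<^sup>2)"
      using I by simp
    also have "\<dots> \<le> (\<Sum>i\<in>I. w z * (g (p(i \<mapsto> z)) - g p)\<^sup>2)"
    proof (intro sum_mono mult_left_mono)
      fix i assume "i \<in> I"
      then have "\<delta> \<le> \<bar>g (p(i \<mapsto> z)) - g p\<bar>" using I by auto
      then show "\<delta>\<^sup>2 \<le> (g (p(i \<mapsto> z)) - g p)\<^sup>2"
        using d by (metis abs_of_pos abs_le_square_iff)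
    qed (use Y t in \<open>simp add: less_imp_le\<close>)
    also have "\<dots> \<le> (g p)\<^sup>2 + (\<Sum>i\<in>I. w z * (g (p(i \<mapsto> z)) - g p)\<^sup>2)"
      by simp
    also have "\<dots> \<le> C\<^sup>2"
    proof (rule martingale_bessel [where Y = Y and C = C])
      show "I \<inter> dom p = {}" using I(1) t(2) by blast
      show "g p = (\<Sum>z\<in>Y. w z * g (p(i \<mapsto> z)))" if "finite (dom p)" "ran p \<subseteq> Y" "i \<notin> dom p" for p i
        using mart t(1) that by blast
      show "\<bar>g p\<bar> \<le> C" if "finite (dom p)" "ran p \<subseteq> Y" for p
        using bd t(1) that by blast
    qed (use t P Y I(2) in \<open>auto simp: less_imp_le\<close>)
    finally show False using n by simp
  qed
  have "finite (\<Union>(g,p,z)\<in>?T. bad g p z)"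
    using G P(1) Y(1) by (intro finite_UN_I finite_cartesian_product) (auto simp: fin)
  then have "infinite (?D - (\<Union>(g,p,z)\<in>?T. bad g p z))"
    using inf by (rule Diff_infinite_finite)
  then have "?D - (\<Union>(g,p,z)\<in>?T. bad g p z) \<noteq> {}"
    by (rule infinite_imp_nonempty)
  then obtain i where "i \<in> ?D - (\<Union>(g,p,z)\<in>?T. bad g p z)"
    unfolding ex_in_conv [symmetric] ..
  then show thesis
    by (intro that [of i]) (force simp: bad_def not_le)+
qed

text \<open>
  Forgetting a conditioned coordinate is the weak limit of moving it to infinity, so it cannot
  increase the distance, by weak lower semicontinuity of the norm.
\<close>

lemma exchangeable_martingale_distance:
  fixes f :: "(nat \<rightharpoonup> 'y) \<Rightarrow> 'e::real_normed_vector" and \<Psi> :: "('e \<Rightarrow> real) set"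
  assumes mart: "\<And>p i. finite (dom p) \<Longrightarrow> ran p \<subseteq> Y \<Longrightarrow> i \<notin> dom p \<Longrightarrow>
      f p = (\<Sum>z\<in>Y. w z *\<^sub>R f (p(i \<mapsto> z)))"
    and bd: "\<And>p. finite (dom p) \<Longrightarrow> ran p \<subseteq> Y \<Longrightarrow> norm (f p) \<le> C"
    and exch: "\<And>p p' i j. finite (dom p) \<Longrightarrow> ran p \<subseteq> Y \<Longrightarrow> finite (dom p') \<Longrightarrow> ran p' \<subseteq> Y \<Longrightarrow>
      norm (f (p \<circ> Transposition.transpose i j) - f (p' \<circ> Transposition.transpose i j)) = norm (f p - f p')"
    and Y: "finite Y" "\<And>z. z \<in> Y \<Longrightarrow> 0 < w z" "sum w Y = 1"
    and lin: "\<And>\<psi>. \<psi> \<in> \<Psi> \<Longrightarrow> linear \<psi>" and le: "\<And>\<psi> v. \<psi> \<in> \<Psi> \<Longrightarrow> \<bar>\<psi> v\<bar> \<le> norm v"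
    and norming: "\<And>v e. 0 < e \<Longrightarrow> \<exists>\<psi>\<in>\<Psi>. norm v - e < \<psi> v"
    and y: "y \<in> Y" "y' \<in> Y" and p: "finite (dom p)" "ran p \<subseteq> Y" "i \<notin> dom p"
  shows "norm (f [0 \<mapsto> y] - f [0 \<mapsto> y']) \<le> norm (f (p(i \<mapsto> y)) - f (p(i \<mapsto> y')))"
proof -
  let ?\<epsilon> = "norm (f [0 \<mapsto> y] - f [0 \<mapsto> y'])"
  have "?\<epsilon> \<le> norm (f (p(i \<mapsto> y)) - f (p(i \<mapsto> y')))"
    if "finite D" "D = dom p" "ran p \<subseteq> Y" "i \<notin> dom p" for D p i
    using that
  proof (induction D arbitrary: p i rule: finite_induct)
    case empty
    then have "p = Map.empty" by auto
    \<comment> \<open>With nothing else revealed, exchanging the coordinates 0 and \<open>i\<close>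
      already gives equality.\<close>
    have t: "[0 \<mapsto> v] \<circ> Transposition.transpose 0 i = [i \<mapsto> v]" for v :: 'y
      by (auto simp: fun_eq_iff Transposition.transpose_def)
    have eq: "?\<epsilon> = norm (f ([0 \<mapsto> y] \<circ> Transposition.transpose 0 i) - f ([0 \<mapsto> y'] \<circ> Transposition.transpose 0 i))"
      using y by (intro exch [symmetric]) auto
    show ?case
      unfolding \<open>p = Map.empty\<close> using eq [unfolded t] by (rule eq_refl)
  next
    case (insert i\<^sub>0 D)
    then have "i\<^sub>0 \<in> dom p" by (metis insertI1)
    then obtain z where z: "p i\<^sub>0 = Some z" by blast
    have zY: "z \<in> Y" using z insert.prems by (auto simp: ran_def)
    \<comment> \<open>\<open>q\<close> forgets the coordinate \<open>i\<^sub>0\<close>. Below, its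
      letter \<open>z\<close> is put at a distant \<open>j\<close> instead; exchanging
      \<open>j\<close> with \<open>i\<^sub>0\<close> turns the result back into \<open>p\<close>
      without changing the norm of the difference.\<close>
    define q where "q = p(i\<^sub>0 := None)"
    have q: "dom q = D" "ran q \<subseteq> Y" "i\<^sub>0 \<notin> dom q" "p = q(i\<^sub>0 \<mapsto> z)" "i \<notin> dom q" "i \<noteq> i\<^sub>0"
      using insert.prems insert.hyps z by (auto simp: q_def ran_def fun_eq_iff)
    have fin: "finite (dom q)" using q insert.hyps by simp
    have qv: "finite (dom (q(i \<mapsto> v)))" "ran (q(i \<mapsto> v)) \<subseteq> Y" if "v \<in> Y" for v
      using that q fin by (auto simp: ran_def)
    have IH: "?\<epsilon> \<le> norm (f (q(i \<mapsto> y)) - f (q(i \<mapsto> y')))"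
      using q by (intro insert.IH) auto
    show ?case
    proof (rule field_le_epsilon)
      fix e :: real assume e: "0 < e"
      \<comment> \<open>There are three errors of size \<open>e / 3\<close>: one from the choice of
        the functional, and one for each of \<open>y\<close> and \<open>y'\<close> when
        \<open>z\<close> is placed at \<open>j\<close>.\<close>
      then obtain \<psi> where \<psi>: "\<psi> \<in> \<Psi>"
        "norm (f (q(i \<mapsto> y)) - f (q(i \<mapsto> y'))) - e / 3 < \<psi> (f (q(i \<mapsto> y)) - f (q(i \<mapsto> y')))"
        using norming [of "e/3"] by fastforce
      obtain j where j: "j \<notin> {i\<^sub>0, i}" "\<And>r. r \<in> {q(i \<mapsto> y), q(i \<mapsto> y')} \<Longrightarrow> j \<notin> dom r"
        "\<And>g r x. g \<in> {\<psi> \<circ> f} \<Longrightarrow> r \<in> {q(i \<mapsto> y), q(i \<mapsto> y')} \<Longrightarrow> x \<in> Y \<Longrightarrow> \<bar>g (r(j \<mapsto> x)) - g r\<bar> < e / 3"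
      proof (rule martingale_distant_coordinate [of "{\<psi> \<circ> f}" Y w C "{q(i \<mapsto> y), q(i \<mapsto> y')}" "{i\<^sub>0, i}" "e / 3"])
        fix g i and p :: "nat \<rightharpoonup> 'y" assume "g \<in> {\<psi> \<circ> f}" and p: "finite (dom p)" "ran p \<subseteq> Y" "i \<notin> dom p"
        then have "g p = \<psi> (\<Sum>z\<in>Y. w z *\<^sub>R f (p(i \<mapsto> z)))"
          using mart [OF p] by simp
        also have "\<dots> = (\<Sum>z\<in>Y. w z * g (p(i \<mapsto> z)))"
          using \<open>g \<in> _\<close> lin [OF \<psi>(1)] by (simp add: linear_sum linear_scale)
        finally show "g p = (\<Sum>z\<in>Y. w z * g (p(i \<mapsto> z)))" .
      next
        fix g and p :: "nat \<rightharpoonup> 'y" assume "g \<in> {\<psi> \<circ> f}" "finite (dom p)" "ran p \<subseteq> Y"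
        then show "\<bar>g p\<bar> \<le> C"
          using le [OF \<psi>(1), of "f p"] bd [of p] by simp
      next
        fix r assume "r \<in> {q(i \<mapsto> y), q(i \<mapsto> y')}"
        then show "finite (dom r) \<and> ran r \<subseteq> Y" using qv y by blast
      qed (use Y e in auto)
      have j2: "\<bar>\<psi> (f (q(i \<mapsto> v, j \<mapsto> z))) - \<psi> (f (q(i \<mapsto> v)))\<bar> < e / 3" if "v = y \<or> v = y'" for v
        using j(3) [of "\<psi> \<circ> f" "q(i \<mapsto> v)" z] that zY by auto
      have jq: "j \<notin> dom q" using j(2) [of "q(i \<mapsto> y)"] by simp
      have t: "q(i \<mapsto> v, j \<mapsto> z) \<circ> Transposition.transpose i\<^sub>0 j = p(i \<mapsto> v)" for v
        using j(1) jq q by (auto simp: fun_eq_iff Transposition.transpose_def domIff)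
      have qvz: "finite (dom (q(i \<mapsto> v, j \<mapsto> z)))" "ran (q(i \<mapsto> v, j \<mapsto> z)) \<subseteq> Y" if "v \<in> Y" for v
        using that q fin zY by (auto simp: ran_def)
      have "norm (f (q(i \<mapsto> y, j \<mapsto> z)) - f (q(i \<mapsto> y', j \<mapsto> z))) = norm (f (p(i \<mapsto> y)) - f (p(i \<mapsto> y')))"
        unfolding t [symmetric] using qvz y by (intro exch [symmetric]) auto
      moreover have "\<psi> (f (q(i \<mapsto> y, j \<mapsto> z)) - f (q(i \<mapsto> y', j \<mapsto> z))) \<le> norm (f (q(i \<mapsto> y, j \<mapsto> z)) - f (q(i \<mapsto> y', j \<mapsto> z)))"
        using le [OF \<psi>(1)] abs_le_D1 by blast
      ultimately show "?\<epsilon> \<le> norm (f (p(i \<mapsto> y)) - f (p(i \<mapsto> y'))) + e"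
        using IH \<psi>(2) j2 [of y] j2 [of y'] unfolding linear_diff [OF lin [OF \<psi>(1)]] abs_less_iff
        by simp
    qed
  qed
  then show ?thesis using p by blast
qed

text \<open>If the values at \<open>y\<close> and \<open>y'\<close> differed, then conditioning on ever more distant
  coordinates would produce a weak-* limit point avoiding a dense sequence.\<close>

theorem exchangeable_martingale_constant:
  fixes f :: "(nat \<rightharpoonup> 'y) \<Rightarrow> 'e::real_normed_vector" and \<Psi> :: "('e \<Rightarrow> real) set"
  assumes mart: "\<And>p i. finite (dom p) \<Longrightarrow> ran p \<subseteq> Y \<Longrightarrow> i \<notin> dom p \<Longrightarrow>
      f p = (\<Sum>z\<in>Y. w z *\<^sub>R f (p(i \<mapsto> z)))"
    and bd: "\<And>p. finite (dom p) \<Longrightarrow> ran p \<subseteq> Y \<Longrightarrow> norm (f p) \<le> C"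
    and exch: "\<And>p p' i j. finite (dom p) \<Longrightarrow> ran p \<subseteq> Y \<Longrightarrow> finite (dom p') \<Longrightarrow> ran p' \<subseteq> Y \<Longrightarrow>
      norm (f (p \<circ> Transposition.transpose i j) - f (p' \<circ> Transposition.transpose i j)) = norm (f p - f p')"
    and Y: "finite Y" "\<And>z. z \<in> Y \<Longrightarrow> 0 < w z" "sum w Y = 1"
    and lin: "\<And>\<psi>. \<psi> \<in> \<Psi> \<Longrightarrow> linear \<psi>" and le: "\<And>\<psi> v. \<psi> \<in> \<Psi> \<Longrightarrow> \<bar>\<psi> v\<bar> \<le> norm v"
    and norming: "\<And>v e. 0 < e \<Longrightarrow> \<exists>\<psi>\<in>\<Psi>. norm v - e < \<psi> v"
    and cluster: "\<And>v::nat \<Rightarrow> 'e. bounded (range v) \<Longrightarrow>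
      \<exists>x. \<forall>\<psi>\<in>\<Psi>. \<forall>t. eventually (\<lambda>n. t \<le> \<psi> (v n)) sequentially \<longrightarrow> t \<le> \<psi> x"
    and sep: "separable_space (euclidean :: 'e topology)"
    and y: "y \<in> Y" "y' \<in> Y"
  shows "f [0 \<mapsto> y] = f [0 \<mapsto> y']"
proof (rule ccontr)
  define \<epsilon> where "\<epsilon> = norm (f [0 \<mapsto> y] - f [0 \<mapsto> y'])"
  assume "f [0 \<mapsto> y] \<noteq> f [0 \<mapsto> y']"
  then have \<epsilon>: "0 < \<epsilon>" by (simp add: \<epsilon>_def)
  have dist: "\<epsilon> \<le> norm (f (p(i \<mapsto> y)) - f (p(i \<mapsto> y')))"
    if "finite (dom p)" "ran p \<subseteq> Y" "i \<notin> dom p" for p i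
    unfolding \<epsilon>_def
    by (rule exchangeable_martingale_distance [of Y f w C \<Psi>]) (use assms that in blast)+
  obtain D :: "'e set" where D: "countable D" "closure D = UNIV"
    using sep by (auto simp: separable_space_def)
  then have "D \<noteq> {}" by auto
  then obtain d :: "nat \<Rightarrow> 'e" where d: "range d = D"
    using D(1) by (metis range_from_nat_into)
  \<comment> \<open>A state is a conditioning \<open>p\<close> with a finite set \<open>S\<close> of
    certificates: a pair \<open>(\<psi>, e)\<close> witnesses that \<open>f p\<close> is farther
    than \<open>\<epsilon> / 4\<close> from \<open>e\<close>. The inequality is strict, so that
    certificates survive a small change of their functionals on \<open>f p\<close>.\<close>
  define good where "good n s \<longleftrightarrow> (case s of (p, S) \<Rightarrow> finite (dom p) \<and> ran p \<subseteq> Y \<and> finite S \<and>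
      (\<forall>(\<psi>,e)\<in>S. \<psi> \<in> \<Psi> \<and> \<epsilon> / 4 < \<psi> (f p - e)))"
    for n :: nat and s :: "(nat \<rightharpoonup> 'y) \<times> (('e \<Rightarrow> real) \<times> 'e) set"
  define step where "step n s s' \<longleftrightarrow> snd s \<subseteq> snd s' \<and> (\<exists>\<psi>. (\<psi>, d n) \<in> snd s')"
    for n and s s' :: "(nat \<rightharpoonup> 'y) \<times> (('e \<Rightarrow> real) \<times> 'e) set"
  have "\<exists>s. \<forall>n. good n (s n) \<and> step n (s n) (s (Suc n))"
  proof (rule dependent_nat_choice)
    show "\<exists>s. good 0 s"
      by (rule exI [of _ "(Map.empty, {})"]) (simp add: good_def)
  next
    fix s n assume "good n s"
    then obtain p S where s: "s = (p, S)" and p: "finite (dom p)" "ran p \<subseteq> Y" and S: "finite S"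
      "\<And>\<psi> e. (\<psi>,e) \<in> S \<Longrightarrow> \<psi> \<in> \<Psi> \<and> \<epsilon> / 4 < \<psi> (f p - e)"
      by (cases s) (auto simp: good_def)
    \<comment> \<open>The least slack among the certificates collected so far; the 1 keeps the
      minimum defined when there are none.\<close>
    define \<delta> where "\<delta> = Min (insert 1 ((\<lambda>(\<psi>,e). \<psi> (f p - e) - \<epsilon> / 4) ` S))"
    have \<delta>: "0 < \<delta>" "\<And>\<psi> e. (\<psi>,e) \<in> S \<Longrightarrow> \<delta> \<le> \<psi> (f p - e) - \<epsilon> / 4"
      using S by (auto simp: \<delta>_def intro!: Min_le)
    let ?G = "(\<lambda>(\<psi>,e). \<psi> \<circ> f) ` S"
    obtain i where i: "i \<notin> {}" "\<And>r. r \<in> {p} \<Longrightarrow> i \<notin> dom r"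
      "\<And>g r x. g \<in> ?G \<Longrightarrow> r \<in> {p} \<Longrightarrow> x \<in> Y \<Longrightarrow> \<bar>g (r(i \<mapsto> x)) - g r\<bar> < \<delta>"
    proof (rule martingale_distant_coordinate [of ?G Y w C "{p}" "{}" \<delta>])
      fix g i and p :: "nat \<rightharpoonup> 'y" assume "g \<in> ?G" and p: "finite (dom p)" "ran p \<subseteq> Y" "i \<notin> dom p"
      then obtain \<psi> e where "(\<psi>,e) \<in> S" and "g = \<psi> \<circ> f" by auto
      then have \<psi>: "\<psi> \<in> \<Psi>" "g = \<psi> \<circ> f" using S(2) by auto
      from this have "g p = \<psi> (\<Sum>z\<in>Y. w z *\<^sub>R f (p(i \<mapsto> z)))"
        using mart [OF p] by simp
      also have "\<dots> = (\<Sum>z\<in>Y. w z * g (p(i \<mapsto> z)))"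
        using \<psi>(2) lin [OF \<psi>(1)] by (simp add: linear_sum linear_scale)
      finally show "g p = (\<Sum>z\<in>Y. w z * g (p(i \<mapsto> z)))" .
    next
      fix g and p :: "nat \<rightharpoonup> 'y" assume "g \<in> ?G" "finite (dom p)" "ran p \<subseteq> Y"
      moreover then obtain \<psi> e where "(\<psi>,e) \<in> S" and "g = \<psi> \<circ> f" by auto
      then have \<psi>: "\<psi> \<in> \<Psi>" "g = \<psi> \<circ> f" using S(2) by auto
      ultimately show "\<bar>g p\<bar> \<le> C"
        using le [OF \<psi>(1), of "f p"] bd [of p] by simp
    qed (use Y p S \<delta> in auto)
    have ip: "i \<notin> dom p" using i by simp
    have "\<epsilon> \<le> norm (f (p(i \<mapsto> y)) - f (p(i \<mapsto> y')))"
      using dist p ip by blast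
    also have "\<dots> \<le> norm (f (p(i \<mapsto> y)) - d n) + norm (f (p(i \<mapsto> y')) - d n)"
      using norm_triangle_ineq4 [of "f (p(i \<mapsto> y)) - d n" "f (p(i \<mapsto> y')) - d n"] by simp
    \<comment> \<open>The two values are at least \<open>\<epsilon>\<close> apart, so one of them is
      at least \<open>\<epsilon> / 2\<close> away from \<open>d n\<close>; a nearly norming
      functional loses less than \<open>\<epsilon> / 4\<close> of this.\<close>
    finally obtain z where z: "z \<in> Y" "\<epsilon> / 2 \<le> norm (f (p(i \<mapsto> z)) - d n)"
      using y by (metis add_le_cancel_left field_sum_of_halves le_less_linear add_strict_mono not_less)
    obtain \<psi>' where \<psi>': "\<psi>' \<in> \<Psi>" "norm (f (p(i \<mapsto> z)) - d n) - \<epsilon> / 4 < \<psi>' (f (p(i \<mapsto> z)) - d n)"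
      using norming [of "\<epsilon> / 4"] \<epsilon> by fastforce
    have "\<epsilon> / 4 < \<psi> (f (p(i \<mapsto> z)) - e)" if "(\<psi>,e) \<in> S" for \<psi> e
    proof -
      have "\<psi> \<circ> f \<in> ?G" using that by force
      then have "\<bar>\<psi> (f (p(i \<mapsto> z))) - \<psi> (f p)\<bar> < \<delta>"
        using i(3) [of "\<psi> \<circ> f" p z] z by simp
      moreover have "\<psi> (a - b) = \<psi> a - \<psi> b" for a b
        using linear_diff [OF lin] S(2) [OF that] by blast
      ultimately show ?thesis
        using \<delta>(2) [OF that] by simp
    qed
    then have "good (Suc n) (p(i \<mapsto> z), insert (\<psi>', d n) S)"
      using p S z \<psi>' by (auto simp: good_def ran_def)
    moreover have "step n s (p(i \<mapsto> z), insert (\<psi>', d n) S)"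
      by (auto simp: step_def s)
    ultimately show "\<exists>s'. good (Suc n) s' \<and> step n s s'" by blast
  qed
  then obtain s where "\<forall>n. good n (s n) \<and> step n (s n) (s (Suc n))" ..
  then have s: "\<And>n. good n (s n)" "\<And>n. step n (s n) (s (Suc n))" by simp_all
  have mono: "snd (s m) \<subseteq> snd (s n)" if "m \<le> n" for m n
    by (rule lift_Suc_mono_le [of "\<lambda>n. snd (s n)"]) (use s(2) that in \<open>auto simp: step_def\<close>)
  have "norm (f (fst (s n))) \<le> C" for n
    using s(1) [of n] by (intro bd) (auto simp: good_def split: prod.splits)
  then have "bounded (range (\<lambda>n. f (fst (s n))))"
    by (auto simp: bounded_iff)
  then obtain x where x: "\<And>\<psi> t. \<psi> \<in> \<Psi> \<Longrightarrow> eventually (\<lambda>n. t \<le> \<psi> (f (fst (s n)))) sequentially \<Longrightarrow> t \<le> \<psi> x"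
    using cluster by blast
  \<comment> \<open>From stage \<open>Suc n\<close> on, a certificate against \<open>d n\<close> is
    in force. Being a half-space condition, it passes to \<open>x\<close>, with a weak
    inequality.\<close>
  have far: "\<epsilon> / 4 \<le> norm (x - d n)" for n
  proof -
    obtain \<psi> where \<psi>: "(\<psi>, d n) \<in> snd (s (Suc n))"
      using s(2) [of n] by (auto simp: step_def)
    have g: "\<psi> \<in> \<Psi> \<and> \<epsilon> / 4 < \<psi> (f (fst (s m)) - d n)" if "Suc n \<le> m" for m
      using s(1) [of m] mono [OF that] \<psi> by (auto simp: good_def split: prod.splits)
    then have \<psi>\<Psi>: "\<psi> \<in> \<Psi>" by blast
    have "eventually (\<lambda>m. \<epsilon> / 4 + \<psi> (d n) \<le> \<psi> (f (fst (s m)))) sequentially"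
      using eventually_ge_at_top [of "Suc n"]
      by eventually_elim (use g linear_diff [OF lin [OF \<psi>\<Psi>]] in \<open>auto simp: less_imp_le algebra_simps\<close>)
    then have "\<epsilon> / 4 + \<psi> (d n) \<le> \<psi> x" using x \<psi>\<Psi> by blast
    then show ?thesis
      using le [OF \<psi>\<Psi>, of "x - d n"] linear_diff [OF lin [OF \<psi>\<Psi>]] by simp
  qed
  have "x \<in> closure D" using D by simp
  then obtain n where "dist (d n) x < \<epsilon> / 4"
    using \<epsilon> d by (metis closure_approachable rangeE zero_less_divide_iff zero_less_numeral)
  then show False
    using far [of n] by (simp add: dist_norm norm_minus_commute)
qed

section \<open>Faces and prisms\<close>

definition face :: "nat \<Rightarrow> 'a list \<Rightarrow> 'a list" where
  "face i xs = take i xs @ drop (Suc i) xs"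

lemma length_face [simp]: "i < length xs \<Longrightarrow> length (face i xs) = length xs - 1"
  by (simp add: face_def)

lemma set_face: "set (face i xs) \<subseteq> set xs"
  by (auto simp: face_def dest: in_set_takeD in_set_dropD)

lemma map_face: "map f (face i xs) = face i (map f xs)"
  by (simp add: face_def take_map drop_map)

lemma nth_face: "j < length xs - 1 \<Longrightarrow> i < length xs \<Longrightarrow> face i xs ! j = (if j < i then xs ! j else xs ! Suc j)"
  by (auto simp: face_def nth_append min_def)

lemma face_face: "j < i \<Longrightarrow> i < length xs \<Longrightarrow> face j (face i xs) = face (i - 1) (face j xs)"
  by (rule nth_equalityI) (auto simp: nth_face)

lemma face_Cons_0 [simp]: "face 0 (x # xs) = xs"
  and face_Cons_Suc [simp]: "face (Suc i) (x # xs) = x # face i xs"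
  by (simp_all add: face_def)

text \<open>The cancellation that makes the coboundary square to zero: the term at
  \<open>(i, j)\<close> with \<open>j < i\<close> is matched with the term at
  \<open>(j, i - 1)\<close>, whose sign is opposite.\<close>

lemma sum_alternating_pairs:
  fixes g :: "nat \<Rightarrow> nat \<Rightarrow> 'e::real_vector"
  assumes g: "\<And>i j. j < i \<Longrightarrow> i \<le> Suc n \<Longrightarrow> g i j = g j (i - 1)"
  shows "(\<Sum>i\<le>Suc n. (-1) ^ i *\<^sub>R (\<Sum>j\<le>n. (-1) ^ j *\<^sub>R g i j)) = 0"
proof -
  let ?A = "{(i,j). i \<le> Suc n \<and> j < i}" and ?B = "{(i,j). i \<le> j \<and> j \<le> n}"
  let ?t = "\<lambda>(i,j). (-1) ^ (i + j) *\<^sub>R g i j"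
  have fin: "finite ?A" "finite ?B"
    by (rule finite_subset [of _ "{..Suc n} \<times> {..Suc n}"]; auto)+
  have "(\<Sum>i\<le>Suc n. (-1) ^ i *\<^sub>R (\<Sum>j\<le>n. (-1) ^ j *\<^sub>R g i j)) = (\<Sum>p\<in>{..Suc n} \<times> {..n}. ?t p)"
    by (simp add: scaleR_sum_right sum.cartesian_product power_add)
  also have "{..Suc n} \<times> {..n} = ?A \<union> ?B" by auto
  also have "sum ?t (?A \<union> ?B) = sum ?t ?A + sum ?t ?B"
    using fin by (intro sum.union_disjoint) auto
  also have "sum ?t ?A = sum (\<lambda>p. - ?t p) ?B"
  proof (rule sum.reindex_bij_witness [of _ "\<lambda>(i,j). (Suc j, i)" "\<lambda>(i,j). (j, i - 1)"])
    fix p assume "p \<in> ?A"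
    then obtain i j where p: "p = (Suc i, j)" "i \<le> n" "j \<le> i"
      by (cases p; cases "fst p") auto
    then show "- ?t (case p of (i, j) \<Rightarrow> (j, i - 1)) = ?t p"
      using g [of j "Suc i"] by (simp add: add.commute)
  qed auto
  finally show ?thesis by (simp add: sum_negf)
qed

definition prism :: "('a list \<Rightarrow> 'e::real_vector) \<Rightarrow> 'a list \<Rightarrow> 'a list \<Rightarrow> 'e" where
  "prism C as bs = (\<Sum>i<length as. (-1) ^ i *\<^sub>R C (take (Suc i) as @ drop i bs))"

text \<open>Add up, with alternating signs, the cocycle identities on the simplices
  \<open>P i\<close> that triangulate the prism. The faces \<open>i\<close> and \<open>Suc i\<close>
  of \<open>P i\<close> are \<open>R i\<close> and \<open>R (Suc i)\<close> and telescope from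
  \<open>bs\<close> to \<open>as\<close>; the remaining faces reassemble into the prisms over the
  faces of \<open>as\<close> and \<open>bs\<close>.\<close>

lemma prism_homotopy:
  fixes C :: "'a list \<Rightarrow> 'e::real_vector"
  assumes cocycle: "\<And>xs. set xs \<subseteq> A \<Longrightarrow> length xs = k + 2 \<Longrightarrow> (\<Sum>i\<le>Suc k. (-1) ^ i *\<^sub>R C (face i xs)) = 0"
    and as: "set as \<subseteq> A" "length as = Suc k" and bs: "set bs \<subseteq> A" "length bs = Suc k"
  shows "C bs - C as = (\<Sum>m\<le>k. (-1) ^ m *\<^sub>R prism C (face m as) (face m bs))"
proof -
  define P where "P i = take (Suc i) as @ drop i bs" for i
  define R where "R i = take i as @ drop i bs" for i
  have len: "length (P i) = k + 2" if "i \<le> k" for i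
    using that as bs by (simp add: P_def)
  have setP: "set (P i) \<subseteq> A" for i
    using as bs set_take_subset [of "Suc i" as] set_drop_subset [of i bs] unfolding P_def set_append by blast
  have diag: "face i (P i) = R i" "face (Suc i) (P i) = R (Suc i)" if "i \<le> k" for i
    using that as bs by (auto simp: face_def P_def R_def take_Suc_conv_app_nth)
  have low: "face l (P i) = take i (face l as) @ drop (i - 1) (face l bs)" if "l < i" "i \<le> k" for l i
    using that as bs by (intro nth_equalityI) (auto simp: P_def nth_face nth_append)
  \<comment> \<open>The entry \<open>m\<close> of \<open>bs\<close> stands at position
    \<open>Suc m\<close> of \<open>P i\<close>, whence the shift between the face and the index
    \<open>m\<close>.\<close>
  have high: "face (Suc m) (P i) = take (Suc i) (face m as) @ drop i (face m bs)" if "i < m" "m \<le> k" for m i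
    using that as bs by (intro nth_equalityI) (auto simp: P_def nth_face nth_append)
  define lo where "lo i l = C (take i (face l as) @ drop (i - 1) (face l bs))" for i l
  define hi where "hi i m = C (take (Suc i) (face m as) @ drop i (face m bs))" for i m
  have row: "(\<Sum>l<i. (-1) ^ l *\<^sub>R lo i l) + (-1) ^ i *\<^sub>R (C (R i) - C (R (Suc i)))
      - (\<Sum>m\<in>{i<..k}. (-1) ^ m *\<^sub>R hi i m) = 0" if i: "i \<le> k" for i
  proof -
    have "0 = (\<Sum>l\<le>Suc k. (-1) ^ l *\<^sub>R C (face l (P i)))"
      using cocycle [OF setP len [OF i]] by simp
    also have "{..Suc k} = {..<i} \<union> {i, Suc i} \<union> Suc ` {i<..k}"
      using i by (auto simp: image_iff Bex_def) presburger
    also have "(\<Sum>l\<in>\<dots>. (-1) ^ l *\<^sub>R C (face l (P i)))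
        = (\<Sum>l<i. (-1) ^ l *\<^sub>R C (face l (P i))) + (\<Sum>l\<in>{i, Suc i}. (-1) ^ l *\<^sub>R C (face l (P i)))
          + (\<Sum>l\<in>Suc ` {i<..k}. (-1) ^ l *\<^sub>R C (face l (P i)))"
      by (subst sum.union_disjoint; (subst sum.union_disjoint)?) auto
    also have "(\<Sum>l<i. (-1) ^ l *\<^sub>R C (face l (P i))) = (\<Sum>l<i. (-1) ^ l *\<^sub>R lo i l)"
      using i by (intro sum.cong) (auto simp: low lo_def)
    also have "(\<Sum>l\<in>{i, Suc i}. (-1) ^ l *\<^sub>R C (face l (P i))) = (-1) ^ i *\<^sub>R (C (R i) - C (R (Suc i)))"
      using diag [OF i] by (simp add: scaleR_diff_right)
    also have "(\<Sum>l\<in>Suc ` {i<..k}. (-1) ^ l *\<^sub>R C (face l (P i))) = - (\<Sum>m\<in>{i<..k}. (-1) ^ m *\<^sub>R hi i m)"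
      by (subst sum.reindex) (auto simp: high hi_def sum_negf [symmetric] intro!: sum.cong)
    finally show ?thesis by simp
  qed
  have tele: "(\<Sum>i\<le>k. C (R i) - C (R (Suc i))) = C bs - C as"
    using sum_telescope [of "\<lambda>i. C (R i)" k] as bs by (simp add: R_def)
  have "0 = (\<Sum>i\<le>k. (-1) ^ i *\<^sub>R ((\<Sum>l<i. (-1) ^ l *\<^sub>R lo i l) + (-1) ^ i *\<^sub>R (C (R i) - C (R (Suc i)))
      - (\<Sum>m\<in>{i<..k}. (-1) ^ m *\<^sub>R hi i m)))"
    using row by simp
  also have "\<dots> = (\<Sum>i\<le>k. \<Sum>l<i. (-1) ^ (i + l) *\<^sub>R lo i l) + (\<Sum>i\<le>k. C (R i) - C (R (Suc i)))
      - (\<Sum>i\<le>k. \<Sum>m\<in>{i<..k}. (-1) ^ (i + m) *\<^sub>R hi i m)"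
    by (simp add: scaleR_diff_right scaleR_add_right sum_subtractf sum.distrib scaleR_sum_right power_add
        flip: power_add mult_2)
  also have "(\<Sum>i\<le>k. \<Sum>m\<in>{i<..k}. (-1) ^ (i + m) *\<^sub>R hi i m) = (\<Sum>m\<le>k. \<Sum>i<m. (-1) ^ (i + m) *\<^sub>R hi i m)"
    unfolding sum.Sigma [of "{..k}" "\<lambda>i. {i<..k}", simplified] sum.Sigma [of "{..k}" "\<lambda>m. {..<m}", simplified]
    by (rule sum.reindex_bij_witness [of _ "\<lambda>(m,i). (i,m)" "\<lambda>(i,m). (m,i)"]) auto
  \<comment> \<open>\<open>lo (Suc i) l\<close> is \<open>hi i l\<close>: the low faces supply just
    the indices \<open>i \<ge> l\<close> that the high faces miss.\<close>
  also have "(\<Sum>i\<le>k. \<Sum>l<i. (-1) ^ (i + l) *\<^sub>R lo i l) = (\<Sum>l\<le>k. \<Sum>i\<in>{l..<k}. - ((-1) ^ (i + l) *\<^sub>R hi i l))"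
    unfolding sum.Sigma [of "{..k}" "\<lambda>l. {l..<k}", simplified] sum.Sigma [of "{..k}" "\<lambda>m. {..<m}", simplified]
    by (rule sum.reindex_bij_witness [of _ "\<lambda>(l,i). (Suc i,l)" "\<lambda>(i,l). (l,i - 1)"])
       (auto simp: lo_def hi_def gr0_conv_Suc dest!: less_imp_Suc_add)
  also have "(\<Sum>l\<le>k. \<Sum>i\<in>{l..<k}. - ((-1) ^ (i + l) *\<^sub>R hi i l)) + (\<Sum>i\<le>k. C (R i) - C (R (Suc i)))
      - (\<Sum>m\<le>k. \<Sum>i<m. (-1) ^ (i + m) *\<^sub>R hi i m)
      = (C bs - C as) - (\<Sum>m\<le>k. (\<Sum>i<m. (-1) ^ (i + m) *\<^sub>R hi i m) + (\<Sum>i\<in>{m..<k}. (-1) ^ (i + m) *\<^sub>R hi i m))"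
    by (simp add: tele sum.distrib sum_negf)
  also have "(\<Sum>m\<le>k. (\<Sum>i<m. (-1) ^ (i + m) *\<^sub>R hi i m) + (\<Sum>i\<in>{m..<k}. (-1) ^ (i + m) *\<^sub>R hi i m))
      = (\<Sum>m\<le>k. (-1) ^ m *\<^sub>R prism C (face m as) (face m bs))"
  proof (rule sum.cong)
    fix m assume "m \<in> {..k}"
    then have m: "m \<le> k" by simp
    have "(\<Sum>i<m. (-1) ^ (i + m) *\<^sub>R hi i m) + (\<Sum>i\<in>{m..<k}. (-1) ^ (i + m) *\<^sub>R hi i m)
        = (\<Sum>i\<in>{..<m} \<union> {m..<k}. (-1) ^ (i + m) *\<^sub>R hi i m)"
      by (rule sum.union_disjoint [symmetric]) auto
    also have "\<dots> = (\<Sum>i<k. (-1) ^ (i + m) *\<^sub>R hi i m)"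
      using m by (intro sum.cong) auto
    also have "\<dots> = (-1) ^ m *\<^sub>R prism C (face m as) (face m bs)"
      using m as by (simp add: prism_def hi_def scaleR_sum_right power_add mult.commute)
    finally show "(\<Sum>i<m. (-1) ^ (i + m) *\<^sub>R hi i m) + (\<Sum>i\<in>{m..<k}. (-1) ^ (i + m) *\<^sub>R hi i m)
        = (-1) ^ m *\<^sub>R prism C (face m as) (face m bs)" .
  qed simp
  finally show ?thesis by simp
qed

section \<open>Random tuples\<close>

text \<open>The expectation of a vector-valued function, written as a finite sum so that it makes
  sense in any real vector space. It is meaningful for laws of finite support.\<close>

definition pmf_avg :: "'a pmf \<Rightarrow> ('a \<Rightarrow> 'e::real_vector) \<Rightarrow> 'e" where
  "pmf_avg p f = (\<Sum>a\<in>set_pmf p. pmf p a *\<^sub>R f a)"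

lemma pmf_avg_superset:
  assumes "finite A" "set_pmf p \<subseteq> A"
  shows "pmf_avg p f = (\<Sum>a\<in>A. pmf p a *\<^sub>R f a)"
  unfolding pmf_avg_def using assms by (intro sum.mono_neutral_left) (auto simp: set_pmf_iff)

lemma pmf_avg_return [simp]: "pmf_avg (return_pmf x) f = f x"
  by (simp add: pmf_avg_def)

lemma pmf_avg_cong: "(\<And>x. x \<in> set_pmf p \<Longrightarrow> f x = g x) \<Longrightarrow> pmf_avg p f = pmf_avg p g"
  by (simp add: pmf_avg_def)

lemma pmf_avg_bind:
  assumes "finite (set_pmf p)" "\<And>x. x \<in> set_pmf p \<Longrightarrow> finite (set_pmf (f x))"
  shows "pmf_avg (bind_pmf p f) h = pmf_avg p (\<lambda>x. pmf_avg (f x) h)"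
proof -
  let ?A = "set_pmf p" and ?B = "\<Union>x\<in>set_pmf p. set_pmf (f x)"
  have fin: "finite ?B" using assms by auto
  have bind: "pmf (bind_pmf p f) b = (\<Sum>a\<in>?A. pmf p a * pmf (f a) b)" for b
    using assms by (subst pmf_bind, subst integral_measure_pmf [of ?A]) auto
  have "pmf_avg (bind_pmf p f) h = (\<Sum>b\<in>?B. \<Sum>a\<in>?A. (pmf p a * pmf (f a) b) *\<^sub>R h b)"
    using fin by (subst pmf_avg_superset [of ?B]) (auto simp: bind scaleR_sum_left)
  also have "\<dots> = (\<Sum>a\<in>?A. pmf p a *\<^sub>R (\<Sum>b\<in>?B. pmf (f a) b *\<^sub>R h b))"
    by (subst sum.swap) (simp add: scaleR_sum_right)
  also have "\<dots> = (\<Sum>a\<in>?A. pmf p a *\<^sub>R pmf_avg (f a) h)"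
    using fin by (intro sum.cong refl arg_cong [of _ _ "scaleR _"] pmf_avg_superset [symmetric]) auto
  finally show ?thesis by (simp add: pmf_avg_def)
qed

lemma pmf_avg_map:
  "finite (set_pmf p) \<Longrightarrow> pmf_avg (map_pmf g p) h = pmf_avg p (\<lambda>x. h (g x))"
  by (simp add: map_pmf_def pmf_avg_bind)

lemma sum_pmf_superset: "finite A \<Longrightarrow> set_pmf p \<subseteq> A \<Longrightarrow> (\<Sum>a\<in>A. pmf p a) = 1"
  using measure_pmf.prob_space [of p] measure_measure_pmf_finite [of A p]
  by (metis sum_pmf_eq_1)

lemma pmf_avg_sum: "pmf_avg p (\<lambda>x. \<Sum>i\<in>I. c i *\<^sub>R f i x) = (\<Sum>i\<in>I. c i *\<^sub>R pmf_avg p (f i))"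
  unfolding pmf_avg_def scaleR_sum_right
  by (subst sum.swap) (simp add: mult.commute)

lemma norm_pmf_avg_le:
  assumes "finite (set_pmf p)" "\<And>x. x \<in> set_pmf p \<Longrightarrow> norm (f x) \<le> C"
  shows "norm (pmf_avg p f) \<le> (C::real)"
proof -
  have "norm (pmf_avg p f) \<le> (\<Sum>a\<in>set_pmf p. norm (pmf p a *\<^sub>R f a))"
    unfolding pmf_avg_def by (rule norm_sum)
  also have "\<dots> \<le> (\<Sum>a\<in>set_pmf p. pmf p a * C)"
    using assms by (intro sum_mono) (auto intro: mult_left_mono)
  also have "\<dots> = C"
    using assms by (simp add: sum_pmf_superset flip: sum_distrib_right)
  finally show ?thesis .
qed

lemma linear_pmf_avg: "linear T \<Longrightarrow> T (pmf_avg p f) = pmf_avg p (\<lambda>x. T (f x))"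
  by (simp add: pmf_avg_def linear_sum linear_scale)

fun list_pmf :: "'a pmf list \<Rightarrow> 'a list pmf" where
  "list_pmf [] = return_pmf []"
| "list_pmf (\<nu> # \<nu>s) = bind_pmf \<nu> (\<lambda>x. map_pmf (Cons x) (list_pmf \<nu>s))"

lemma set_list_pmf: "set_pmf (list_pmf \<nu>s) = {xs. list_all2 (\<lambda>x \<nu>. x \<in> set_pmf \<nu>) xs \<nu>s}"
  by (induction \<nu>s) (auto simp: list_all2_Cons2)

lemma finite_set_list_pmf:
  "(\<And>\<nu>. \<nu> \<in> set \<nu>s \<Longrightarrow> finite (set_pmf \<nu>)) \<Longrightarrow> finite (set_pmf (list_pmf \<nu>s))"
  by (induction \<nu>s) auto

lemma list_pmf_return: "list_pmf (map return_pmf xs) = return_pmf xs"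
  by (induction xs) (simp_all add: bind_return_pmf)

lemma list_pmf_map: "list_pmf (map (map_pmf g) \<nu>s) = map_pmf (map g) (list_pmf \<nu>s)"
  by (induction \<nu>s) (simp_all add: map_bind_pmf bind_map_pmf map_pmf_comp)

text \<open>If each entry is a mixture, the hidden parameters of all entries can be drawn beforehand
  and independently. This allows one letter of each of several random words to be revealed at the
  same time.\<close>

lemma list_pmf_bind:
  "list_pmf (map (\<lambda>j. bind_pmf \<mu> (N j)) js) =
    bind_pmf (list_pmf (map (\<lambda>_. \<mu>) js)) (\<lambda>z. list_pmf (map2 N js z))"
proof (induction js)
  case (Cons j js)
  have "list_pmf (map (\<lambda>j. bind_pmf \<mu> (N j)) (j # js)) =
      bind_pmf \<mu> (\<lambda>z. bind_pmf (N j z) (\<lambda>x. bind_pmf (list_pmf (map (\<lambda>_. \<mu>) js))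
        (\<lambda>zs. map_pmf (Cons x) (list_pmf (map2 N js zs)))))"
    by (simp add: Cons.IH bind_assoc_pmf map_bind_pmf)
  also have "\<dots> = bind_pmf \<mu> (\<lambda>z. bind_pmf (list_pmf (map (\<lambda>_. \<mu>) js)) (\<lambda>zs. bind_pmf (N j z) (\<lambda>x.
        map_pmf (Cons x) (list_pmf (map2 N js zs)))))"
    by (subst bind_commute_pmf) (rule refl)
  also have "\<dots> = bind_pmf (list_pmf (map (\<lambda>_. \<mu>) (j # js))) (\<lambda>z. list_pmf (map2 N (j # js) z))"
    by (simp add: bind_assoc_pmf bind_map_pmf)
  finally show ?case .
qed (simp add: bind_return_pmf)

text \<open>Omitting an entry of a product law gives the product of the other factors. Through this,
  averaging a cocycle over independent entries yields a cocycle on laws.\<close>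

lemma list_pmf_face:
  "i < length \<nu>s \<Longrightarrow> map_pmf (face i) (list_pmf \<nu>s) = list_pmf (face i \<nu>s)"
proof (induction \<nu>s arbitrary: i)
  case (Cons \<nu> \<nu>s)
  show ?case
  proof (cases i)
    case 0
    then show ?thesis by (simp add: map_bind_pmf map_pmf_comp)
  next
    case (Suc j)
    then have IH: "map_pmf (face j) (list_pmf \<nu>s) = list_pmf (face j \<nu>s)"
      using Cons by simp
    show ?thesis
      by (simp add: Suc map_bind_pmf map_pmf_comp flip: IH)
  qed
qed simp

section \<open>Permutable commuting copies\<close>

text \<open>The block structure in abstract form: \<open>F\<close> acts in block 0, and
  \<open>\<sigma>\<close> lets the finitary permutations act on the blocks. The last two axioms
  mention block 0 only; conjugation by transpositions transports them to all blocks.\<close>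

locale permutable_copies = group G for G :: "('g, 'm) monoid_scheme" (structure) +
  fixes F :: "'g set" and \<sigma> :: "(nat \<Rightarrow> nat) \<Rightarrow> 'g"
  assumes finite_F: "finite F" and F_carrier: "F \<subseteq> carrier G" and one_F: "\<one> \<in> F"
    and perm_closed: "permutation \<pi> \<Longrightarrow> \<sigma> \<pi> \<in> carrier G"
    and perm_comp: "permutation \<pi> \<Longrightarrow> permutation \<pi>' \<Longrightarrow> \<sigma> (\<pi> \<circ> \<pi>') = \<sigma> \<pi> \<otimes> \<sigma> \<pi>'"
    and perm_fix: "permutation \<pi> \<Longrightarrow> \<pi> 0 = 0 \<Longrightarrow> h \<in> F \<Longrightarrow> \<sigma> \<pi> \<otimes> h = h \<otimes> \<sigma> \<pi>"
    and perm_move: "permutation \<pi> \<Longrightarrow> \<pi> 0 \<noteq> 0 \<Longrightarrow> h \<in> F \<Longrightarrow> h' \<in> F \<Longrightarrow>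
      (\<sigma> \<pi> \<otimes> h' \<otimes> inv (\<sigma> \<pi>)) \<otimes> h = h \<otimes> (\<sigma> \<pi> \<otimes> h' \<otimes> inv (\<sigma> \<pi>))"
begin

abbreviation swap :: "nat \<Rightarrow> nat \<Rightarrow> nat \<Rightarrow> nat" where
  "swap i j \<equiv> Transposition.transpose i j"

definition copy :: "nat \<Rightarrow> 'g \<Rightarrow> 'g" where
  "copy i h = \<sigma> (swap 0 i) \<otimes> h \<otimes> inv (\<sigma> (swap 0 i))"

lemma F_closed [simp]: "h \<in> F \<Longrightarrow> h \<in> carrier G"
  using F_carrier by auto

lemma permutation_swap [simp]: "permutation (swap i j)"
  by (rule permutation_swap_id)

lemma swap_closed [simp]: "\<sigma> (swap i j) \<in> carrier G"
  by (simp add: perm_closed)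

lemma perm_id: "\<sigma> id = \<one>"
  using perm_comp [of id id] perm_closed [of id] by (simp add: permutation_id)

lemma swap_swap: "\<sigma> (swap i j) \<otimes> \<sigma> (swap i j) = \<one>"
  using perm_comp [of "swap i j" "swap i j"] by (simp add: perm_id)

lemma copy_closed [simp]: "h \<in> F \<Longrightarrow> copy i h \<in> carrier G"
  by (simp add: copy_def)

lemma copy_0: "h \<in> F \<Longrightarrow> copy 0 h = h"
  by (simp add: copy_def perm_id flip: id_def)

text \<open>A permutation differs from the transposition of 0 and \<open>\<pi> 0\<close> by one that
  fixes 0, and the latter commutes with \<open>F\<close>. So the conjugate depends only on
  \<open>\<pi> 0\<close>.\<close>

lemma conj_eq_copy:
  assumes "permutation \<pi>" "h \<in> F"
  shows "\<sigma> \<pi> \<otimes> h \<otimes> inv (\<sigma> \<pi>) = copy (\<pi> 0) h"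
proof -
  define \<tau> where "\<tau> = swap 0 (\<pi> 0)"
  define \<delta> where "\<delta> = \<tau> \<circ> \<pi>"
  have \<tau>: "permutation \<tau>" and \<delta>: "permutation \<delta>" "\<delta> 0 = 0"
    using assms by (auto simp: \<tau>_def \<delta>_def permutation_compose)
  have "\<pi> = \<tau> \<circ> \<delta>" by (simp add: \<delta>_def \<tau>_def fun_eq_iff)
  then have \<pi>: "\<sigma> \<pi> = \<sigma> \<tau> \<otimes> \<sigma> \<delta>" using perm_comp \<tau> \<delta> by simp
  have [simp]: "\<sigma> \<tau> \<in> carrier G" "\<sigma> \<delta> \<in> carrier G" "h \<in> carrier G"
    using \<tau> \<delta> assms perm_closed by auto
  have cancel: "\<sigma> \<delta> \<otimes> (inv (\<sigma> \<delta>) \<otimes> inv (\<sigma> \<tau>)) = inv (\<sigma> \<tau>)"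
    by (simp flip: m_assoc)
  have "\<sigma> \<pi> \<otimes> h \<otimes> inv (\<sigma> \<pi>) = \<sigma> \<tau> \<otimes> (\<sigma> \<delta> \<otimes> h) \<otimes> (inv (\<sigma> \<delta>) \<otimes> inv (\<sigma> \<tau>))"
    by (simp add: \<pi> inv_mult_group m_assoc)
  also have "\<dots> = \<sigma> \<tau> \<otimes> h \<otimes> (\<sigma> \<delta> \<otimes> inv (\<sigma> \<delta>)) \<otimes> inv (\<sigma> \<tau>)"
    unfolding perm_fix [OF \<delta> assms(2)] by (simp add: m_assoc cancel)
  also have "\<dots> = copy (\<pi> 0) h"
    by (simp add: copy_def \<tau>_def)
  finally show ?thesis .
qed

lemma swap_copy:
  assumes h: "h \<in> F"
  shows "\<sigma> (swap i j) \<otimes> copy l h = copy (swap i j l) h \<otimes> \<sigma> (swap i j)"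
proof -
  have p: "permutation (swap i j \<circ> swap 0 l)" by (simp add: permutation_compose)
  have "copy (swap i j l) h = \<sigma> (swap i j \<circ> swap 0 l) \<otimes> h \<otimes> inv (\<sigma> (swap i j \<circ> swap 0 l))"
    using conj_eq_copy [OF p h] by simp
  also have "\<dots> = \<sigma> (swap i j) \<otimes> copy l h \<otimes> inv (\<sigma> (swap i j))"
    using h by (simp add: perm_comp copy_def inv_mult_group m_assoc)
  finally show ?thesis
    using h by (simp add: m_assoc)
qed

text \<open>Conjugation by the transposition of 0 and \<open>i\<close> brings the first copy to
  block 0 and the second to a block other than 0, where \<open>perm_move\<close> applies.\<close>

lemma copy_commute:
  assumes "i \<noteq> j" "h \<in> F" "h' \<in> F"
  shows "copy i h \<otimes> copy j h' = copy j h' \<otimes> copy i h"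
proof -
  let ?s = "\<sigma> (swap 0 i)" and ?l = "swap 0 i j"
  have "?l \<noteq> 0" using assms by (auto simp: Transposition.transpose_def)
  then have comm: "copy ?l h' \<otimes> h = h \<otimes> copy ?l h'"
    using perm_move [of "swap 0 ?l" h h'] assms by (simp add: copy_def)
  have i: "copy i h \<otimes> ?s = ?s \<otimes> h" and j: "copy j h' \<otimes> ?s = ?s \<otimes> copy ?l h'"
    using swap_copy [of h 0 i 0] swap_copy [of h' 0 i ?l] assms by (simp_all add: copy_0)
  have "copy i h \<otimes> copy j h' \<otimes> ?s = ?s \<otimes> (h \<otimes> copy ?l h')"
    using assms i j by (metis m_assoc copy_closed swap_closed F_closed)
  also have "\<dots> = copy j h' \<otimes> copy i h \<otimes> ?s"
    using assms i j comm by (metis m_assoc copy_closed swap_closed F_closed)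
  finally show ?thesis
    using assms by simp
qed

text \<open>The guard makes the folded operation commute on the whole type.\<close>

definition word :: "(nat \<Rightarrow> 'g) \<Rightarrow> nat set \<Rightarrow> 'g" where
  "word a I = Finite_Set.fold (\<lambda>i x. if x \<in> carrier G then copy i (a i) \<otimes> x else x) \<one> I"

lemma word_empty [simp]: "word a {} = \<one>"
  by (simp add: word_def)

lemma word_props:
  assumes "finite I" "a ` I \<subseteq> F"
  shows "word a I \<in> carrier G"
    and "i \<notin> I \<Longrightarrow> a i \<in> F \<Longrightarrow> word a (insert i I) = copy i (a i) \<otimes> word a I"
proof -
  interpret comp_fun_commute_on "{i. a i \<in> F}" "\<lambda>i x. if x \<in> carrier G then copy i (a i) \<otimes> x else x"
  proof
    fix i j assume ij: "i \<in> {i. a i \<in> F}" "j \<in> {i. a i \<in> F}"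
    have "copy i (a i) \<otimes> (copy j (a j) \<otimes> x) = copy j (a j) \<otimes> (copy i (a i) \<otimes> x)" if x: "x \<in> carrier G" for x
    proof (cases "i = j")
      case False
      then show ?thesis
        using copy_commute [OF False, of "a i" "a j"] ij x by (simp flip: m_assoc)
    qed simp
    then show "(\<lambda>x. if x \<in> carrier G then copy j (a j) \<otimes> x else x) \<circ> (\<lambda>x. if x \<in> carrier G then copy i (a i) \<otimes> x else x)
      = (\<lambda>x. if x \<in> carrier G then copy i (a i) \<otimes> x else x) \<circ> (\<lambda>x. if x \<in> carrier G then copy j (a j) \<otimes> x else x)"
      using ij by (auto simp: fun_eq_iff)
  qed
  have ins: "word a (insert i I) = (if word a I \<in> carrier G then copy i (a i) \<otimes> word a I else word a I)"
    if "finite I" "a ` I \<subseteq> F" "i \<notin> I" "a i \<in> F" for i I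
    unfolding word_def using that by (subst fold_insert) auto
  show closed: "word a I \<in> carrier G"
    using assms by (induction I rule: finite_induct) (auto simp: ins)
  show "i \<notin> I \<Longrightarrow> a i \<in> F \<Longrightarrow> word a (insert i I) = copy i (a i) \<otimes> word a I"
    using ins [OF assms] closed by simp
qed

lemma word_cong:
  "finite I \<Longrightarrow> a ` I \<subseteq> F \<Longrightarrow> (\<And>i. i \<in> I \<Longrightarrow> a i = b i) \<Longrightarrow> word a I = word b I"
  by (induction I rule: finite_induct) (auto simp: word_props(2))

lemma swap_word:
  assumes "finite I" "a ` I \<subseteq> F"
  shows "\<sigma> (swap i j) \<otimes> word a I = word (a \<circ> swap i j) (swap i j ` I) \<otimes> \<sigma> (swap i j)"
  using assms
proof (induction I rule: finite_induct)
  case (insert l I)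
  let ?s = "\<sigma> (swap i j)" and ?t = "swap i j"
  have al: "a l \<in> F" and aI: "a ` I \<subseteq> F" using insert by auto
  have tI: "finite (?t ` I)" "(a \<circ> ?t) ` ?t ` I \<subseteq> F" "?t l \<notin> ?t ` I"
    using insert aI by (auto simp: image_iff dest: transpose_eq_imp_eq)
  have [simp]: "word a I \<in> carrier G" "word (a \<circ> ?t) (?t ` I) \<in> carrier G"
    using word_props(1) insert.hyps(1) aI tI by blast+
  have "?s \<otimes> word a (insert l I) = (?s \<otimes> copy l (a l)) \<otimes> word a I"
    using insert.hyps al aI by (simp add: word_props(2) m_assoc)
  also have "\<dots> = copy (?t l) (a l) \<otimes> (?s \<otimes> word a I)"
    using al by (simp add: swap_copy m_assoc)
  also have "\<dots> = (copy (?t l) (a l) \<otimes> word (a \<circ> ?t) (?t ` I)) \<otimes> ?s"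
    unfolding insert.IH [OF aI] using al by (simp add: m_assoc)
  also have "copy (?t l) (a l) \<otimes> word (a \<circ> ?t) (?t ` I) = word (a \<circ> ?t) (insert (?t l) (?t ` I))"
    using word_props(2) [OF tI(1,2,3)] al by simp
  finally show ?case unfolding image_insert .
qed simp

section \<open>Random words with prescribed letters\<close>

definition letter_law :: "(nat \<rightharpoonup> 'g) \<Rightarrow> nat \<Rightarrow> 'g pmf" where
  "letter_law q i = (case q i of None \<Rightarrow> pmf_of_set F | Some z \<Rightarrow> return_pmf z)"

definition word_law :: "nat \<Rightarrow> (nat \<rightharpoonup> 'g) \<Rightarrow> 'g pmf" where
  "word_law N q = bind_pmf (Pi_pmf {..<N} \<one> (letter_law q))
     (\<lambda>a. map_pmf (\<lambda>s. word a {..<N} \<otimes> \<sigma> s) (pmf_of_set {s. s permutes {..<N}}))"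

lemma F_nonempty: "F \<noteq> {}"
  using one_F by auto

lemma set_letter_law: "ran q \<subseteq> F \<Longrightarrow> set_pmf (letter_law q i) \<subseteq> F"
  using finite_F F_nonempty by (auto simp: letter_law_def ran_def split: option.split)

lemma set_letters:
  assumes "ran q \<subseteq> F" "a \<in> set_pmf (Pi_pmf {..<N} \<one> (letter_law q))"
  shows "a i \<in> F"
proof (cases "i < N")
  case True
  then show ?thesis
    using assms set_letter_law [OF assms(1)] by (auto simp: set_Pi_pmf PiE_dflt_def)
next
  case False
  then show ?thesis
    using assms one_F by (auto simp: set_Pi_pmf PiE_dflt_def)
qed

lemma set_perms: "set_pmf (pmf_of_set {s. s permutes {..<N::nat}}) = {s. s permutes {..<N}}"
  by (rule set_pmf_of_set) (auto intro: finite_permutations permutes_id)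

lemma permutes_permutation: "s permutes {..<N::nat} \<Longrightarrow> permutation s"
  by (auto simp: permutation_permutes)

lemma finite_set_word_law: "ran q \<subseteq> F \<Longrightarrow> finite (set_pmf (word_law N q))"
proof -
  assume q: "ran q \<subseteq> F"
  have "finite (set_pmf (Pi_pmf {..<N} \<one> (letter_law q)))"
    using finite_subset [OF set_letter_law [OF q] finite_F]
    by (auto simp: set_Pi_pmf intro!: finite_PiE_dflt)
  then show ?thesis
    by (auto simp: word_law_def set_perms intro: finite_permutations)
qed

lemma set_word_law: "ran q \<subseteq> F \<Longrightarrow> set_pmf (word_law N q) \<subseteq> carrier G"
proof
  fix x assume q: "ran q \<subseteq> F" and "x \<in> set_pmf (word_law N q)"
  then obtain a s where a: "a \<in> set_pmf (Pi_pmf {..<N} \<one> (letter_law q))" and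
    "s permutes {..<N}" "x = word a {..<N} \<otimes> \<sigma> s"
    by (auto simp: word_law_def set_perms)
  moreover have "a ` {..<N} \<subseteq> F" using set_letters [OF q a] by auto
  ultimately show "x \<in> carrier G"
    using word_props(1) [of "{..<N}" a] by (simp add: perm_closed permutes_permutation)
qed

text \<open>The law of total probability for the letter in block \<open>i\<close>. The martingale
  identity of the limits originates here.\<close>

lemma word_law_split:
  assumes "i < N" "q i = None"
  shows "word_law N q = bind_pmf (pmf_of_set F) (\<lambda>z. word_law N (q(i \<mapsto> z)))"
proof -
  have N: "{..<N} = insert i ({..<N} - {i})" using assms by auto
  have same: "Pi_pmf ({..<N} - {i}) \<one> (letter_law (q(i \<mapsto> z))) = Pi_pmf ({..<N} - {i}) \<one> (letter_law q)" for z
    by (rule Pi_pmf_cong) (auto simp: letter_law_def)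
  have "Pi_pmf {..<N} \<one> (letter_law q) = bind_pmf (pmf_of_set F) (\<lambda>z. Pi_pmf {..<N} \<one> (letter_law (q(i \<mapsto> z))))"
    by (subst (1 2) N, subst (1 2) Pi_pmf_insert')
       (auto simp: same letter_law_def assms bind_return_pmf)
  then show ?thesis
    by (simp add: word_law_def bind_assoc_pmf)
qed

lemma Pi_pmf_swap:
  fixes p :: "nat \<Rightarrow> 'b pmf"
  assumes "i < N" "j < N"
  shows "Pi_pmf {..<N} d (p \<circ> swap i j) = map_pmf (\<lambda>a. a \<circ> swap i j) (Pi_pmf {..<N} d p)"
proof (rule pmf_eqI)
  fix a :: "nat \<Rightarrow> 'b"
  let ?t = "swap i j"
  have tN: "?t l < N \<longleftrightarrow> l < N" for l
    using assms by (auto simp: Transposition.transpose_def)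
  have inj: "inj (\<lambda>a :: nat \<Rightarrow> 'b. a \<circ> ?t)"
    by (rule injI) (metis comp_assoc comp_id transpose_comp_involutory)
  have "pmf (map_pmf (\<lambda>a. a \<circ> ?t) (Pi_pmf {..<N} d p)) a
      = pmf (map_pmf (\<lambda>a. a \<circ> ?t) (Pi_pmf {..<N} d p)) ((a \<circ> ?t) \<circ> ?t)"
    by (simp add: comp_assoc)
  also have "\<dots> = pmf (Pi_pmf {..<N} d p) (a \<circ> ?t)"
    by (rule pmf_map_inj') (rule inj)
  also have "\<dots> = (if \<forall>x. x \<notin> {..<N} \<longrightarrow> a (?t x) = d then \<Prod>x<N. pmf (p x) (a (?t x)) else 0)"
    by (simp only: pmf_Pi finite_lessThan comp_apply)
  also have "(\<forall>x. x \<notin> {..<N} \<longrightarrow> a (?t x) = d) \<longleftrightarrow> (\<forall>x. x \<notin> {..<N} \<longrightarrow> a x = d)"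
    using tN by (metis lessThan_iff transpose_involutory)
  also have "(\<Prod>x<N. pmf (p x) (a (?t x))) = (\<Prod>x<N. pmf (p (?t x)) (a x))"
    by (rule prod.reindex_bij_witness [of _ ?t ?t]) (auto simp: tN)
  also have "(if \<forall>x. x \<notin> {..<N} \<longrightarrow> a x = d then \<Prod>x<N. pmf (p (?t x)) (a x) else 0)
      = pmf (Pi_pmf {..<N} d (p \<circ> ?t)) a"
    by (simp only: pmf_Pi finite_lessThan comp_apply)
  finally show "pmf (Pi_pmf {..<N} d (p \<circ> ?t)) a = pmf (map_pmf (\<lambda>a. a \<circ> ?t) (Pi_pmf {..<N} d p)) a"
    by (rule sym)
qed

text \<open>Passing through the word, the transposition relabels the letters and comes out on the
  right, where the uniform permutation absorbs it, its law being invariant under left translation by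
  a transposition of two blocks below \<open>N\<close>.\<close>

lemma swap_word_law:
  assumes q: "ran q \<subseteq> F" and ij: "i < N" "j < N"
  shows "map_pmf (\<lambda>x. \<sigma> (swap i j) \<otimes> x) (word_law N q) = word_law N (q \<circ> swap i j)"
proof -
  let ?t = "swap i j" and ?P = "{s. s permutes {..<N}}"
  have tN: "?t ` {..<N} = {..<N}"
    using ij by (auto simp: Transposition.transpose_def image_iff)
  have tp: "?t permutes {..<N}" using ij by (intro permutes_swap_id) auto
  have perms: "map_pmf ((\<circ>) ?t) (pmf_of_set ?P) = pmf_of_set ?P"
  proof (rule map_pmf_of_set_bij_betw)
    show "bij_betw ((\<circ>) ?t) ?P ?P"
      by (rule bij_betw_byWitness [where f' = "(\<circ>) ?t"])
         (auto simp: comp_assoc [symmetric] intro: permutes_compose tp)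
  qed (auto intro: finite_permutations permutes_id)
  have law: "letter_law (q \<circ> ?t) = letter_law q \<circ> ?t"
    by (auto simp: letter_law_def fun_eq_iff)
  have "map_pmf (\<lambda>x. \<sigma> ?t \<otimes> x) (word_law N q) = bind_pmf (Pi_pmf {..<N} \<one> (letter_law q))
      (\<lambda>a. map_pmf (\<lambda>s. \<sigma> ?t \<otimes> (word a {..<N} \<otimes> \<sigma> s)) (pmf_of_set ?P))"
    by (simp add: word_law_def map_bind_pmf map_pmf_comp)
  also have "\<dots> = bind_pmf (Pi_pmf {..<N} \<one> (letter_law q))
      (\<lambda>a. map_pmf (\<lambda>s. word (a \<circ> ?t) {..<N} \<otimes> \<sigma> (?t \<circ> s)) (pmf_of_set ?P))"
  proof (intro bind_pmf_cong map_pmf_cong refl)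
    fix a s assume a: "a \<in> set_pmf (Pi_pmf {..<N} \<one> (letter_law q))" and "s \<in> set_pmf (pmf_of_set ?P)"
    then have s: "permutation s" by (simp add: set_perms permutes_permutation)
    have aF: "a ` {..<N} \<subseteq> F" "(a \<circ> ?t) ` {..<N} \<subseteq> F" using set_letters [OF q a] by auto
    show "\<sigma> ?t \<otimes> (word a {..<N} \<otimes> \<sigma> s) = word (a \<circ> ?t) {..<N} \<otimes> \<sigma> (?t \<circ> s)"
      using swap_word [of "{..<N}" a i j] word_props(1) [of "{..<N}"] aF s
      by (simp add: tN perm_comp perm_closed flip: m_assoc)
  qed
  also have "\<dots> = bind_pmf (Pi_pmf {..<N} \<one> (letter_law q))
      (\<lambda>a. map_pmf (\<lambda>s. word (a \<circ> ?t) {..<N} \<otimes> \<sigma> s) (map_pmf ((\<circ>) ?t) (pmf_of_set ?P)))"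
    by (simp add: map_pmf_comp)
  also have "\<dots> = word_law N (q \<circ> ?t)"
    by (simp add: perms word_law_def law Pi_pmf_swap [OF ij] bind_map_pmf)
  finally show ?thesis .
qed

text \<open>The copy in block 0 of a letter is the letter itself, and commutation lets it stand at
  the far left of the word. Left multiplication by \<open>h\<close> thus replaces the letter
  \<open>\<one>\<close> by \<open>h\<close> and leaves all other choices alone.\<close>

lemma translate_word_law:
  assumes "0 < N" "h \<in> F"
  shows "map_pmf (\<lambda>x. h \<otimes> x) (word_law N [0 \<mapsto> \<one>]) = word_law N [0 \<mapsto> h]"
proof -
  let ?I = "{..<N} - {0}" and ?P = "{s. s permutes {..<N}}"
  have N: "{..<N} = insert 0 ?I" using assms by auto
  \<comment> \<open>Once fixed, the letter of block 0 factors out on the left, and what follows it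
    has a law independent of \<open>z\<close>.\<close>
  have law: "word_law N [0 \<mapsto> z] = bind_pmf (Pi_pmf ?I \<one> (letter_law Map.empty))
      (\<lambda>a. map_pmf (\<lambda>s. z \<otimes> word a ?I \<otimes> \<sigma> s) (pmf_of_set ?P))" if z: "z \<in> F" for z
  proof -
    have same: "Pi_pmf ?I \<one> (letter_law [0 \<mapsto> z]) = Pi_pmf ?I \<one> (letter_law Map.empty)"
      by (rule Pi_pmf_cong) (auto simp: letter_law_def)
    have "Pi_pmf {..<N} \<one> (letter_law [0 \<mapsto> z]) =
        bind_pmf (Pi_pmf ?I \<one> (letter_law Map.empty)) (\<lambda>a. return_pmf (a(0 := z)))"
      by (subst N, subst Pi_pmf_insert') (auto simp: same, simp add: letter_law_def bind_return_pmf)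
    then have "word_law N [0 \<mapsto> z] = bind_pmf (Pi_pmf ?I \<one> (letter_law Map.empty))
        (\<lambda>a. map_pmf (\<lambda>s. word (a(0 := z)) {..<N} \<otimes> \<sigma> s) (pmf_of_set ?P))"
      by (simp add: word_law_def bind_assoc_pmf bind_return_pmf)
    also have "\<dots> = bind_pmf (Pi_pmf ?I \<one> (letter_law Map.empty))
        (\<lambda>a. map_pmf (\<lambda>s. z \<otimes> word a ?I \<otimes> \<sigma> s) (pmf_of_set ?P))"
    proof (intro bind_pmf_cong map_pmf_cong refl arg_cong2 [of _ _ _ _ "(\<otimes>)"])
      fix a assume "a \<in> set_pmf (Pi_pmf ?I \<one> (letter_law Map.empty))"
      then have a: "a i \<in> F" for i
        using set_letter_law [of Map.empty i] one_F
        by (cases "i \<in> ?I") (auto simp: set_Pi_pmf PiE_dflt_def)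
      have "word (a(0 := z)) {..<N} = copy 0 ((a(0 := z)) 0) \<otimes> word (a(0 := z)) ?I"
        using a z by (subst N, intro word_props(2)) auto
      also have "word (a(0 := z)) ?I = word a ?I"
        using a z by (intro word_cong) auto
      finally show "word (a(0 := z)) {..<N} = z \<otimes> word a ?I"
        unfolding fun_upd_same copy_0 [OF z] .
    qed
    finally show ?thesis .
  qed
  have "map_pmf (\<lambda>x. h \<otimes> x) (word_law N [0 \<mapsto> \<one>]) = bind_pmf (Pi_pmf ?I \<one> (letter_law Map.empty))
      (\<lambda>a. map_pmf (\<lambda>s. h \<otimes> (\<one> \<otimes> word a ?I \<otimes> \<sigma> s)) (pmf_of_set ?P))"
    by (simp add: law one_F map_bind_pmf map_pmf_comp)
  also have "\<dots> = word_law N [0 \<mapsto> h]"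
    unfolding law [OF assms(2)]
  proof (intro bind_pmf_cong map_pmf_cong refl)
    fix a s assume "a \<in> set_pmf (Pi_pmf ?I \<one> (letter_law Map.empty))" and "s \<in> set_pmf (pmf_of_set ?P)"
    then have "a i \<in> F" "permutation s" for i
      using set_letter_law [of Map.empty i] one_F
      by (cases "i \<in> ?I"; auto simp: set_Pi_pmf PiE_dflt_def set_perms permutes_permutation)+
    then show "h \<otimes> (\<one> \<otimes> word a ?I \<otimes> \<sigma> s) = h \<otimes> word a ?I \<otimes> \<sigma> s"
      using assms word_props(1) [of ?I a] by (simp add: m_assoc perm_closed image_subset_iff)
  qed
  finally show ?thesis .
qed

end

section \<open>Primitives of bounded cocycles\<close>

lemma blinfun_norming:
  assumes "0 < e"
  obtains \<xi> where "norm \<xi> \<le> 1" "norm f - e < blinfun_apply f \<xi>"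
proof (rule ccontr)
  assume no: "\<not> thesis"
  have le: "blinfun_apply f \<xi> \<le> norm f - e" if "norm \<xi> \<le> 1" for \<xi>
    using no that \<open>\<And>\<xi>. norm \<xi> \<le> 1 \<Longrightarrow> norm f - e < blinfun_apply f \<xi> \<Longrightarrow> thesis\<close> by force
  have "norm f \<le> norm f - e"
  proof (rule norm_blinfun_bound)
    show "0 \<le> norm f - e" using le [of 0] by (simp add: blinfun.zero_right)
    show "norm (blinfun_apply f x) \<le> (norm f - e) * norm x" for x
    proof (cases "x = 0")
      case False
      then have "blinfun_apply f (x /\<^sub>R norm x) \<le> norm f - e" "blinfun_apply f (- (x /\<^sub>R norm x)) \<le> norm f - e"
        by (intro le; simp)+
      then have "\<bar>blinfun_apply f x\<bar> / norm x \<le> norm f - e"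
        by (simp add: blinfun.scaleR_right blinfun.minus_right abs_if divide_inverse mult.commute)
      then show ?thesis
        using False by (simp add: divide_le_eq)
    qed (simp add: blinfun.zero_right)
  qed
  then show False using assms by simp
qed

lemma norm_signed_sum_le:
  fixes u :: "nat \<Rightarrow> 'e::real_normed_vector"
  shows "(\<And>i. i < n \<Longrightarrow> norm (u i) \<le> M) \<Longrightarrow> norm (\<Sum>i<n. (-1) ^ i *\<^sub>R u i) \<le> real n * M"
  using sum_norm_bound [of "{..<n}" "\<lambda>i. (-1) ^ i *\<^sub>R u i" M] by (simp add: power_abs)

lemma sum_alternating: "(\<Sum>i\<le>n. (-1 :: real) ^ i) = (if even n then 1 else 0)"
  by (induction n) auto

text \<open>\<open>\<tau> g\<close> is the pre-adjoint of \<open>\<rho> g\<close>. For a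
  contragredient action it is the action of the inverse of \<open>g\<close> on the predual.\<close>

locale dual_module = banach_module G \<rho>
  for G :: "('g, 'm) monoid_scheme" (structure) and \<rho> :: "'g \<Rightarrow> 'e::banach \<Rightarrow> 'e" +
  fixes \<Phi> :: "'e \<Rightarrow> ('f::banach \<Rightarrow>\<^sub>L real)" and \<tau> :: "'g \<Rightarrow> 'f \<Rightarrow> 'f"
  assumes lin: "linear \<Phi>" and bij: "bij \<Phi>" and iso: "norm (\<Phi> v) = norm v"
    and contra: "g \<in> carrier G \<Longrightarrow> blinfun_apply (\<Phi> (\<rho> g v)) \<xi> = blinfun_apply (\<Phi> v) (\<tau> g \<xi>)"
begin

lemma equivariant_limit:
  assumes "weak_limit_operator \<Phi> Fl W" "g \<in> carrier G" "bounded (range u)"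
  shows "W (\<lambda>i. \<rho> g (u i)) = \<rho> g (W u)"
proof (rule weak_limit_operator.equivariant [OF assms(1) assms(3), where T' = "\<tau> g"])
  show "bounded (range (\<lambda>i. \<rho> g (u i)))"
    using assms(3) isometric_action [OF assms(2)] by (simp add: bounded_iff)
qed (rule contra [OF assms(2)])

end

locale bounded_cocycle = dual_module G \<rho> \<Phi> \<tau>
  for G :: "('g, 'm) monoid_scheme" (structure) and \<rho> :: "'g \<Rightarrow> 'e::banach \<Rightarrow> 'e"
    and \<Phi> :: "'e \<Rightarrow> ('f::banach \<Rightarrow>\<^sub>L real)" and \<tau> :: "'g \<Rightarrow> 'f \<Rightarrow> 'f" +
  fixes c :: "'g list \<Rightarrow> 'e" and k :: nat and M :: real
  assumes bound: "norm (c xs) \<le> M"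
    and invariant: "g \<in> carrier G \<Longrightarrow> set xs \<subseteq> carrier G \<Longrightarrow> length xs = Suc k \<Longrightarrow>
      c (map (\<lambda>x. g \<otimes> x) xs) = \<rho> g (c xs)"
    and cocycle: "set xs \<subseteq> carrier G \<Longrightarrow> length xs = k + 2 \<Longrightarrow> (\<Sum>i\<le>Suc k. (-1) ^ i *\<^sub>R c (face i xs)) = 0"
begin

section \<open>Cocycles evaluated on finitely supported laws\<close>

definition laws :: "'g pmf set" where
  "laws = {\<nu>. finite (set_pmf \<nu>) \<and> set_pmf \<nu> \<subseteq> carrier G}"

text \<open>The extension of \<open>c\<close> from group elements to laws that is affine in each
  argument; group elements are embedded as point masses.\<close>

definition ext :: "'g pmf list \<Rightarrow> 'e" where
  "ext \<nu>s = pmf_avg (list_pmf \<nu>s) c"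

lemma finite_laws: "set \<nu>s \<subseteq> laws \<Longrightarrow> finite (set_pmf (list_pmf \<nu>s))"
  by (rule finite_set_list_pmf) (auto simp: laws_def)

lemma list_laws:
  assumes "set \<nu>s \<subseteq> laws" "xs \<in> set_pmf (list_pmf \<nu>s)"
  shows "length xs = length \<nu>s" "set xs \<subseteq> carrier G"
proof -
  have all2: "list_all2 (\<lambda>x \<nu>. x \<in> set_pmf \<nu>) xs \<nu>s"
    using assms(2) by (simp add: set_list_pmf)
  then show "length xs = length \<nu>s" by (rule list_all2_lengthD)
  show "set xs \<subseteq> carrier G"
    using all2 assms(1) by (induction rule: list_all2_induct) (auto simp: laws_def)
qed

lemma ext_bound: "set \<nu>s \<subseteq> laws \<Longrightarrow> norm (ext \<nu>s) \<le> M"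
  unfolding ext_def by (rule norm_pmf_avg_le) (auto simp: finite_laws bound)

lemma ext_return: "ext (map return_pmf xs) = c xs"
  by (simp add: ext_def list_pmf_return)

lemma ext_translate:
  assumes "g \<in> carrier G" "set \<nu>s \<subseteq> laws" "length \<nu>s = Suc k"
  shows "ext (map (map_pmf (\<lambda>x. g \<otimes> x)) \<nu>s) = \<rho> g (ext \<nu>s)"
proof -
  have "ext (map (map_pmf (\<lambda>x. g \<otimes> x)) \<nu>s) = pmf_avg (list_pmf \<nu>s) (\<lambda>xs. c (map (\<lambda>x. g \<otimes> x) xs))"
    using assms by (simp add: ext_def list_pmf_map pmf_avg_map finite_laws)
  also have "\<dots> = pmf_avg (list_pmf \<nu>s) (\<lambda>xs. \<rho> g (c xs))"
    using assms list_laws by (intro pmf_avg_cong invariant) auto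
  also have "\<dots> = \<rho> g (ext \<nu>s)"
    using linear_action [OF assms(1)] by (simp add: ext_def linear_pmf_avg)
  finally show ?thesis .
qed

lemma ext_cocycle:
  assumes "set \<nu>s \<subseteq> laws" "length \<nu>s = k + 2"
  shows "(\<Sum>i\<le>Suc k. (-1) ^ i *\<^sub>R ext (face i \<nu>s)) = 0"
proof -
  have "(\<Sum>i\<le>Suc k. (-1) ^ i *\<^sub>R ext (face i \<nu>s))
      = (\<Sum>i\<le>Suc k. (-1) ^ i *\<^sub>R pmf_avg (list_pmf \<nu>s) (\<lambda>xs. c (face i xs)))"
    using assms by (intro sum.cong) (simp_all add: ext_def finite_laws pmf_avg_map flip: list_pmf_face)
  also have "\<dots> = pmf_avg (list_pmf \<nu>s) (\<lambda>xs. \<Sum>i\<le>Suc k. (-1) ^ i *\<^sub>R c (face i xs))"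
    by (rule pmf_avg_sum [symmetric])
  also have "\<dots> = pmf_avg (list_pmf \<nu>s) (\<lambda>_. 0)"
    using assms list_laws by (intro pmf_avg_cong cocycle) auto
  finally show ?thesis by (simp add: pmf_avg_def)
qed

text \<open>All faces of the constant tuple coincide, and for odd \<open>k\<close> the
  \<open>k + 2\<close> alternating signs add up to 1, so the cocycle identity leaves a single copy
  of the value.\<close>

lemma ext_replicate:
  assumes "\<nu> \<in> laws" "odd k"
  shows "ext (replicate (Suc k) \<nu>) = 0"
proof -
  have "0 = (\<Sum>i\<le>Suc k. (-1) ^ i *\<^sub>R ext (face i (replicate (k + 2) \<nu>)))"
    using assms by (intro ext_cocycle [symmetric]) auto
  also have "\<dots> = (\<Sum>i\<le>Suc k. (-1) ^ i *\<^sub>R ext (replicate (Suc k) \<nu>))"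
  proof (intro sum.cong refl arg_cong2 [of _ _ _ _ "scaleR"] arg_cong [of _ _ ext])
    fix i assume "i \<in> {..Suc k}"
    then show "face i (replicate (k + 2) \<nu>) = replicate (Suc k) \<nu>"
      by (intro nth_equalityI) (auto simp: nth_face simp del: replicate.simps)
  qed
  also have "\<dots> = (\<Sum>i\<le>Suc k. (-1 :: real) ^ i) *\<^sub>R ext (replicate (Suc k) \<nu>)"
    by (rule scaleR_sum_left [symmetric])
  also have "(\<Sum>i\<le>Suc k. (-1 :: real) ^ i) = 1"
    using assms(2) by (simp add: sum_alternating)
  finally show ?thesis by simp
qed

end

section \<open>Averages of a cocycle over tuples of random words\<close>

locale cocycle_with_copies = bounded_cocycle G \<rho> \<Phi> \<tau> c k M + copies: permutable_copies G F \<sigma>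
  for G :: "('g, 'm) monoid_scheme" (structure) and \<rho> :: "'g \<Rightarrow> 'e::banach \<Rightarrow> 'e"
    and \<Phi> :: "'e \<Rightarrow> ('f::banach \<Rightarrow>\<^sub>L real)" and \<tau> :: "'g \<Rightarrow> 'f \<Rightarrow> 'f"
    and c :: "'g list \<Rightarrow> 'e" and k :: nat and M :: real and F and \<sigma> +
  assumes separable: "separable_space (euclidean :: 'e topology)"
begin

text \<open>A coordinate of the martingale is a block, and its letter is a whole tuple: entry
  \<open>j\<close> is the letter that the \<open>j\<close>-th of the \<open>k + 1\<close>
  independent words has in that block. The tuple of words thus becomes a single family indexed by
  blocks.\<close>

definition tuple_law :: "nat \<Rightarrow> (nat \<rightharpoonup> 'g list) \<Rightarrow> 'g pmf list" where
  "tuple_law N p = map (\<lambda>j. copies.word_law N (\<lambda>i. map_option (\<lambda>z. z ! j) (p i))) [0..<Suc k]"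

abbreviation "Y \<equiv> {z. set z \<subseteq> F \<and> length z = Suc k}"

lemma ran_nth: "ran p \<subseteq> Y \<Longrightarrow> j < Suc k \<Longrightarrow> ran (\<lambda>i. map_option (\<lambda>z. z ! j) (p i)) \<subseteq> F"
  by (force simp: ran_def)

lemma word_law_laws: "ran q \<subseteq> F \<Longrightarrow> copies.word_law N q \<in> laws"
  using copies.finite_set_word_law copies.set_word_law by (simp add: laws_def)

lemma tuple_law_laws: "ran p \<subseteq> Y \<Longrightarrow> set (tuple_law N p) \<subseteq> laws"
  unfolding tuple_law_def set_map by (intro image_subsetI word_law_laws ran_nth) auto

lemma length_tuple_law [simp]: "length (tuple_law N p) = Suc k"
  by (simp add: tuple_law_def)

definition letter_tuples :: "'g list pmf" where
  "letter_tuples = list_pmf (map (\<lambda>_. pmf_of_set F) [0..<Suc k])"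

lemma set_letter_tuples: "set_pmf letter_tuples = Y"
proof -
  have "set_pmf (pmf_of_set F) = F"
    using copies.finite_F copies.F_nonempty by (rule set_pmf_of_set [rotated])
  then show ?thesis
    by (auto simp: letter_tuples_def set_list_pmf list_all2_conv_all_nth in_set_conv_nth subset_iff
        simp del: upt_Suc)
qed

lemma finite_Y: "finite Y"
  using finite_lists_length_eq [OF copies.finite_F, of "Suc k"] by simp

text \<open>Total probability in all \<open>k + 1\<close> words at once: independence collects the
  \<open>k + 1\<close> letters of block \<open>i\<close> into one random element of
  \<open>Y\<close>.\<close>

lemma ext_tuple_law_split:
  assumes p: "ran p \<subseteq> Y" "p i = None" and i: "i < N"
  shows "ext (tuple_law N p) = (\<Sum>z\<in>Y. pmf letter_tuples z *\<^sub>R ext (tuple_law N (p(i \<mapsto> z))))"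
proof -
  define q where "q j = (\<lambda>i. map_option (\<lambda>z. z ! j) (p i))" for j :: nat
  have pz: "ran (p(i \<mapsto> z)) \<subseteq> Y" if "z \<in> Y" for z
    using p that by (auto simp: ran_def)
  have "tuple_law N p = map (\<lambda>j. bind_pmf (pmf_of_set F) (\<lambda>x. copies.word_law N ((q j)(i \<mapsto> x)))) [0..<Suc k]"
    unfolding tuple_law_def q_def using p i by (intro map_cong refl copies.word_law_split) auto
  then have "list_pmf (tuple_law N p) = bind_pmf letter_tuples
      (\<lambda>z. list_pmf (map2 (\<lambda>j x. copies.word_law N ((q j)(i \<mapsto> x))) [0..<Suc k] z))"
    unfolding letter_tuples_def by (simp only: list_pmf_bind)
  also have "\<dots> = bind_pmf letter_tuples (\<lambda>z. list_pmf (tuple_law N (p(i \<mapsto> z))))"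
  proof (intro bind_pmf_cong refl arg_cong [of _ _ list_pmf])
    fix z assume "z \<in> set_pmf letter_tuples"
    then have z: "length z = Suc k" by (simp add: set_letter_tuples)
    show "map2 (\<lambda>j x. copies.word_law N ((q j)(i \<mapsto> x))) [0..<Suc k] z = tuple_law N (p(i \<mapsto> z))"
      using z by (intro nth_equalityI)
        (auto simp: tuple_law_def q_def fun_upd_def simp del: upt_Suc intro!: arg_cong2 [of _ _ _ _ copies.word_law])
  qed
  finally have eq: "list_pmf (tuple_law N p) = bind_pmf letter_tuples (\<lambda>z. list_pmf (tuple_law N (p(i \<mapsto> z))))" .
  have "ext (tuple_law N p) = pmf_avg letter_tuples (\<lambda>z. ext (tuple_law N (p(i \<mapsto> z))))"
    unfolding ext_def eq
  proof (rule pmf_avg_bind)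
    show "finite (set_pmf letter_tuples)" unfolding set_letter_tuples by (rule finite_Y)
    show "finite (set_pmf (list_pmf (tuple_law N (p(i \<mapsto> z)))))" if "z \<in> set_pmf letter_tuples" for z
      using that unfolding set_letter_tuples by (intro finite_laws tuple_law_laws pz)
  qed
  then show ?thesis by (simp add: pmf_avg_def set_letter_tuples)
qed

text \<open>Exchanging blocks translates all words by the same group element, and invariance of the
  cocycle turns this diagonal translation into an isometry of the module.\<close>

lemma ext_tuple_law_swap:
  assumes p: "ran p \<subseteq> Y" and ij: "i < N" "j < N"
  shows "ext (tuple_law N (p \<circ> copies.swap i j)) = \<rho> (\<sigma> (copies.swap i j)) (ext (tuple_law N p))"
proof -
  have "tuple_law N (p \<circ> copies.swap i j) = map (map_pmf (\<lambda>x. \<sigma> (copies.swap i j) \<otimes> x)) (tuple_law N p)"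
    unfolding tuple_law_def map_map
  proof (intro map_cong refl)
    fix j' assume "j' \<in> set [0..<Suc k]"
    then have "ran (\<lambda>i. map_option (\<lambda>z. z ! j') (p i)) \<subseteq> F"
      using p by (intro ran_nth) auto
    from copies.swap_word_law [OF this ij]
    show "copies.word_law N (\<lambda>l. map_option (\<lambda>z. z ! j') ((p \<circ> copies.swap i j) l)) =
        (map_pmf (\<lambda>x. \<sigma> (copies.swap i j) \<otimes> x) \<circ>
          (\<lambda>j. copies.word_law N (\<lambda>i. map_option (\<lambda>z. z ! j) (p i)))) j'"
      by (simp add: comp_def)
  qed
  then show ?thesis
    using p by (simp add: ext_translate tuple_law_laws)
qed

lemma translate_tuple_law:
  assumes "z \<in> Y" "0 < N"
  shows "map (\<lambda>h. map_pmf (\<lambda>x. h \<otimes> x) (copies.word_law N [0 \<mapsto> \<one>])) z = tuple_law N [0 \<mapsto> z]"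
proof (rule nth_equalityI)
  fix j assume "j < length (map (\<lambda>h. map_pmf (\<lambda>x. h \<otimes> x) (copies.word_law N [0 \<mapsto> \<one>])) z)"
  then have j: "j < Suc k" "z ! j \<in> F" using assms by auto
  have "tuple_law N [0 \<mapsto> z] ! j = copies.word_law N (\<lambda>i. map_option (\<lambda>z. z ! j) ([0 \<mapsto> z] i))"
    using j by (simp add: tuple_law_def del: upt_Suc fun_upd_apply)
  also have "\<dots> = copies.word_law N [0 \<mapsto> z ! j]"
    by (rule arg_cong [of _ _ "copies.word_law N"]) auto
  also have "\<dots> = map (\<lambda>h. map_pmf (\<lambda>x. h \<otimes> x) (copies.word_law N [0 \<mapsto> \<one>])) z ! j"
    using assms j by (simp add: copies.translate_word_law)
  finally show "map (\<lambda>h. map_pmf (\<lambda>x. h \<otimes> x) (copies.word_law N [0 \<mapsto> \<one>])) z ! j = tuple_law N [0 \<mapsto> z] ! j" ..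
qed (use assms in simp)

text \<open>The limits \<open>f p\<close> form an exchangeable martingale: its identities hold at
  stage \<open>N\<close> as soon as the blocks involved are below \<open>N\<close>, hence
  eventually, and \<open>W\<close> sees only what holds eventually.\<close>

lemma limit_constant:
  assumes W: "weak_limit_operator \<Phi> sequentially W" and yz: "y \<in> Y" "z \<in> Y"
  shows "W (\<lambda>N. ext (tuple_law N [0 \<mapsto> y])) = W (\<lambda>N. ext (tuple_law N [0 \<mapsto> z]))"
proof -
  interpret W: weak_limit_operator \<Phi> sequentially W by (rule W)
  define f where "f p = W (\<lambda>N. ext (tuple_law N p))" for p
  have le: "norm (ext (tuple_law N p)) \<le> M" if "ran p \<subseteq> Y" for N p
    using that by (intro ext_bound tuple_law_laws)
  then have bd: "bounded (range (\<lambda>N. ext (tuple_law N p)))" if "ran p \<subseteq> Y" for p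
    using that by (auto simp: bounded_iff)
  have swap: "f (p \<circ> copies.swap i j) = \<rho> (\<sigma> (copies.swap i j)) (f p)" if p: "ran p \<subseteq> Y" for p i j
  proof -
    have p': "ran (p \<circ> copies.swap i j) \<subseteq> Y" using p by (auto simp: ran_def)
    have s: "\<sigma> (copies.swap i j) \<in> carrier G" by simp
    have "bounded (range (\<lambda>N. \<rho> (\<sigma> (copies.swap i j)) (ext (tuple_law N p))))"
      using le [OF p] isometric_action [OF s] by (auto simp: bounded_iff)
    then have "f (p \<circ> copies.swap i j) = W (\<lambda>N. \<rho> (\<sigma> (copies.swap i j)) (ext (tuple_law N p)))"
      unfolding f_def
    proof (rule W.cong [OF bd [OF p']])
      show "\<forall>\<^sub>F N in sequentially. ext (tuple_law N (p \<circ> copies.swap i j)) = \<rho> (\<sigma> (copies.swap i j)) (ext (tuple_law N p))"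
        using eventually_gt_at_top [of "max i j"]
        by (rule eventually_mono) (rule ext_tuple_law_swap [OF p]; simp)
    qed
    also have "\<dots> = \<rho> (\<sigma> (copies.swap i j)) (f p)"
      unfolding f_def by (rule equivariant_limit [OF W s bd [OF p]])
    finally show ?thesis .
  qed
  \<comment> \<open>Evaluation on the unit ball of the predual. These functionals norm
    \<open>'e\<close>, and \<open>W\<close> respects their half-spaces, which provides the cluster
    points.\<close>
  let ?\<Psi> = "(\<lambda>\<xi> v. blinfun_apply (\<Phi> v) \<xi>) ` {\<xi>. norm \<xi> \<le> 1}"
  have "f [0 \<mapsto> y] = f [0 \<mapsto> z]"
  proof (rule exchangeable_martingale_constant [where \<Psi> = ?\<Psi> and w = "pmf letter_tuples" and C = M and Y = Y])
    fix p :: "nat \<rightharpoonup> 'g list" and i assume p: "finite (dom p)" "ran p \<subseteq> Y" "i \<notin> dom p"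
    have pz: "ran (p(i \<mapsto> z)) \<subseteq> Y" if "z \<in> Y" for z
      using p that by (auto simp: ran_def)
    \<comment> \<open>A crude bound uniform in \<open>N\<close>; replacing one family by another
      under \<open>W\<close> takes boundedness besides eventual equality.\<close>
    have fin: "norm (\<Sum>z\<in>Y. pmf letter_tuples z *\<^sub>R ext (tuple_law N (p(i \<mapsto> z)))) \<le> (\<Sum>z\<in>Y. M)" for N
    proof (rule sum_norm_le)
      fix z assume "z \<in> Y"
      then have "norm (ext (tuple_law N (p(i \<mapsto> z)))) \<le> M" by (intro le pz)
      then show "norm (pmf letter_tuples z *\<^sub>R ext (tuple_law N (p(i \<mapsto> z)))) \<le> M"
        using pmf_le_1 [of letter_tuples z] by (simp add: mult_le_one mult_left_le_one_le order_trans [OF mult_left_le_one_le])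
    qed
    have "f p = W (\<lambda>N. \<Sum>z\<in>Y. pmf letter_tuples z *\<^sub>R ext (tuple_law N (p(i \<mapsto> z))))"
      unfolding f_def
    proof (rule W.cong)
      show "bounded (range (\<lambda>N. \<Sum>z\<in>Y. pmf letter_tuples z *\<^sub>R ext (tuple_law N (p(i \<mapsto> z)))))"
        unfolding bounded_iff using fin by blast
      show "\<forall>\<^sub>F N in sequentially. ext (tuple_law N p) = (\<Sum>z\<in>Y. pmf letter_tuples z *\<^sub>R ext (tuple_law N (p(i \<mapsto> z))))"
        using eventually_gt_at_top [of i]
        by eventually_elim (use p in \<open>auto intro!: ext_tuple_law_split\<close>)
    qed (rule bd [OF p(2)])
    also have "\<dots> = (\<Sum>z\<in>Y. pmf letter_tuples z *\<^sub>R f (p(i \<mapsto> z)))"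
      unfolding f_def by (intro W.sum finite_Y bd pz)
    finally show "f p = (\<Sum>z\<in>Y. pmf letter_tuples z *\<^sub>R f (p(i \<mapsto> z)))" .
  next
    fix p :: "nat \<rightharpoonup> 'g list" assume p: "finite (dom p)" "ran p \<subseteq> Y"
    then show "norm (f p) \<le> M"
      unfolding f_def by (intro W.norm_le bd always_eventually allI le)
  next
    fix p p' :: "nat \<rightharpoonup> 'g list" and i j assume p: "ran p \<subseteq> Y" "ran p' \<subseteq> Y"
    have s: "\<sigma> (copies.swap i j) \<in> carrier G" by simp
    show "norm (f (p \<circ> copies.swap i j) - f (p' \<circ> copies.swap i j)) = norm (f p - f p')"
      using isometric_action [OF s, of "f p - f p'"] linear_diff [OF linear_action [OF s]]
      by (simp add: swap p)
  next
    fix v and e :: real assume "0 < e"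
    then obtain \<xi> where "norm \<xi> \<le> 1" "norm (\<Phi> v) - e < blinfun_apply (\<Phi> v) \<xi>"
      by (rule blinfun_norming)
    then show "\<exists>\<psi>\<in>?\<Psi>. norm v - e < \<psi> v" by (auto simp: iso)
  next
    fix v :: "nat \<Rightarrow> 'e" assume "bounded (range v)"
    then show "\<exists>x. \<forall>\<psi>\<in>?\<Psi>. \<forall>t. (\<forall>\<^sub>F n in sequentially. t \<le> \<psi> (v n)) \<longrightarrow> t \<le> \<psi> x"
      by (intro exI [of _ "W v"]) (auto intro: W.halfspace)
  next
    fix \<psi> assume "\<psi> \<in> ?\<Psi>"
    then obtain \<xi> where \<xi>: "norm \<xi> \<le> 1" "\<psi> = (\<lambda>v. blinfun_apply (\<Phi> v) \<xi>)" by auto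
    show "linear \<psi>"
      unfolding \<xi> by (rule linearI) (simp_all add: linear_add [OF lin] linear_scale [OF lin] blinfun.add_left blinfun.scaleR_left)
    have "\<bar>blinfun_apply (\<Phi> v) \<xi>\<bar> \<le> norm v * norm \<xi>" for v
      using norm_blinfun [of "\<Phi> v" \<xi>] by (simp add: iso)
    then show "\<bar>\<psi> v\<bar> \<le> norm v" for v
      unfolding \<xi>(2) using mult_left_mono [OF \<xi>(1) norm_ge_zero [of v]] by (metis mult.right_neutral order_trans)
  next
    show "sum (pmf letter_tuples) Y = 1"
      by (rule sum_pmf_superset) (simp_all add: finite_Y set_letter_tuples)
    show "0 < pmf letter_tuples z" if "z \<in> Y" for z
      using that by (intro pmf_positive) (simp add: set_letter_tuples)
  qed (use finite_Y separable yz in auto)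
  then show ?thesis by (simp add: f_def)
qed

text \<open>\<open>b\<close> is the limit of the prisms between the point masses at
  \<open>hs\<close> and the translates of one law by the entries of \<open>hs\<close>. Translation
  acts on both ends, so \<open>b\<close> is equivariant on the whole group, and a prism over
  \<open>k\<close> entries has \<open>k\<close> summands, so the bound does not depend on
  \<open>F\<close>. The set \<open>F\<close> enters only when the limit of the far ends is
  identified with the constant \<open>v\<close>.\<close>

lemma primitive_on_finite_set:
  obtains b :: "'g list \<Rightarrow> 'e" and v where
    "\<And>hs. set hs \<subseteq> carrier G \<Longrightarrow> length hs = k \<Longrightarrow> norm (b hs) \<le> real k * M"
    "\<And>g hs. g \<in> carrier G \<Longrightarrow> set hs \<subseteq> carrier G \<Longrightarrow> length hs = k \<Longrightarrow> b (map (\<lambda>x. g \<otimes> x) hs) = \<rho> g (b hs)"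
    "norm v \<le> M" "odd k \<Longrightarrow> v = 0"
    "\<And>hs. set hs \<subseteq> F \<Longrightarrow> length hs = Suc k \<Longrightarrow> v - c hs = (\<Sum>m\<le>k. (-1) ^ m *\<^sub>R b (face m hs))"
proof -
  obtain W where W: "weak_limit_operator \<Phi> sequentially W"
    using weak_limit_operator_exists [OF lin bij iso] by (metis sequentially_bot)
  interpret W: weak_limit_operator \<Phi> sequentially W by (rule W)
  define \<nu> where "\<nu> N = copies.word_law N [0 \<mapsto> \<one>]" for N
  define bs where "bs N hs = map (\<lambda>h. map_pmf (\<lambda>x. h \<otimes> x) (\<nu> N)) hs" for N hs
  define B where "B N hs = prism ext (map return_pmf hs) (bs N hs)" for N hs
  \<comment> \<open>The constant tuple as base point: for \<open>0 < N\<close> its tuple of laws is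
    \<open>k + 1\<close> copies of \<open>\<nu> N\<close>, on which the extended cocycle vanishes in
    odd degree.\<close>
  define z where "z = replicate (Suc k) \<one>"
  have \<nu>: "\<nu> N \<in> laws" for N
    unfolding \<nu>_def using copies.one_F by (intro word_law_laws) simp
  have laws_bs: "set (bs N hs) \<subseteq> laws" if "set hs \<subseteq> carrier G" for N hs
    using \<nu>[of N] that by (auto simp: bs_def laws_def intro!: copies.m_closed)
  have laws_ret: "set (map return_pmf hs) \<subseteq> laws" if "set hs \<subseteq> carrier G" for hs
    using that by (auto simp: laws_def)
  have zY: "z \<in> Y" using copies.one_F by (auto simp: z_def)
  have mix: "set (take i (map return_pmf hs) @ drop j (bs N hs)) \<subseteq> laws" if "set hs \<subseteq> carrier G" for N hs i j
    using laws_bs [OF that] laws_ret [OF that] set_take_subset [of i "map return_pmf hs"]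
      set_drop_subset [of j "bs N hs"] unfolding set_append by blast
  have B_le: "norm (B N hs) \<le> real k * M" if "set hs \<subseteq> carrier G" "length hs = k" for N hs
    unfolding B_def prism_def length_map that(2)
    by (intro norm_signed_sum_le ext_bound mix that)
  have B_bd: "bounded (range (\<lambda>N. B N hs))" if "set hs \<subseteq> carrier G" "length hs = k" for hs
    using B_le [OF that] by (auto simp: bounded_iff)
  have B_inv: "B N (map (\<lambda>x. g \<otimes> x) hs) = \<rho> g (B N hs)"
    if g: "g \<in> carrier G" and hs: "set hs \<subseteq> carrier G" "length hs = k" for g hs N
  proof -
    have 1: "map return_pmf (map (\<lambda>x. g \<otimes> x) hs) = map (map_pmf (\<lambda>x. g \<otimes> x)) (map return_pmf hs)"
      by simp
    have 2: "bs N (map (\<lambda>x. g \<otimes> x) hs) = map (map_pmf (\<lambda>x. g \<otimes> x)) (bs N hs)"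
      unfolding bs_def map_map
    proof (intro map_cong refl)
      fix h assume "h \<in> set hs"
      then show "((\<lambda>h. map_pmf (\<lambda>x. h \<otimes> x) (\<nu> N)) \<circ> (\<lambda>x. g \<otimes> x)) h
          = (map_pmf (\<lambda>x. g \<otimes> x) \<circ> (\<lambda>h. map_pmf (\<lambda>x. h \<otimes> x) (\<nu> N))) h"
        unfolding comp_apply map_pmf_comp using \<nu> [of N] g hs
        by (intro map_pmf_cong refl copies.m_assoc) (auto simp: laws_def)
    qed
    have "B N (map (\<lambda>x. g \<otimes> x) hs)
        = (\<Sum>i<k. (-1) ^ i *\<^sub>R \<rho> g (ext (take (Suc i) (map return_pmf hs) @ drop i (bs N hs))))"
      unfolding B_def prism_def 1 2 take_map drop_map map_append [symmetric]
      using hs(2)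
      by (intro sum.cong arg_cong2 [of _ _ _ _ scaleR] ext_translate mix [unfolded take_map] hs(1) g) (auto simp: bs_def)
    also have "\<dots> = \<rho> g (B N hs)"
      using linear_action [OF g] hs by (simp add: B_def prism_def linear_sum linear_scale)
    finally show ?thesis .
  qed
  have split: "ext (bs N hs) - c hs = (\<Sum>m\<le>k. (-1) ^ m *\<^sub>R B N (face m hs))"
    if hs: "set hs \<subseteq> carrier G" "length hs = Suc k" for N hs
  proof -
    have "ext (bs N hs) - ext (map return_pmf hs) = (\<Sum>m\<le>k. (-1) ^ m *\<^sub>R prism ext (face m (map return_pmf hs)) (face m (bs N hs)))"
      using hs by (intro prism_homotopy [where A = laws] ext_cocycle laws_bs laws_ret) (auto simp: bs_def)
    then show ?thesis
      by (simp add: ext_return B_def bs_def map_face)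
  qed
  have tl_bd: "bounded (range (\<lambda>N. ext (tuple_law N [0 \<mapsto> y])))" if "y \<in> Y" for y
    using that by (auto simp: bounded_iff intro!: exI [of _ M] ext_bound tuple_law_laws)
  define v where "v = W (\<lambda>N. ext (tuple_law N [0 \<mapsto> z]))"
  show thesis
  proof
    show "norm (W (\<lambda>N. B N hs)) \<le> real k * M" if "set hs \<subseteq> carrier G" "length hs = k" for hs
      using B_le [OF that] by (intro W.norm_le B_bd that) auto
    show "W (\<lambda>N. B N (map (\<lambda>x. g \<otimes> x) hs)) = \<rho> g (W (\<lambda>N. B N hs))"
      if "g \<in> carrier G" "set hs \<subseteq> carrier G" "length hs = k" for g hs
      by (simp add: B_inv that equivariant_limit [OF W] B_bd)
    show "norm v \<le> M"
      unfolding v_def using zY by (intro W.norm_le tl_bd always_eventually allI ext_bound tuple_law_laws) auto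
    show "v = 0" if "odd k"
    proof -
      have "tuple_law N [0 \<mapsto> z] = replicate (Suc k) (\<nu> N)" if "0 < N" for N
      proof -
        have "tuple_law N [0 \<mapsto> z] = map (\<lambda>h. map_pmf (\<lambda>x. h \<otimes> x) (\<nu> N)) z"
          unfolding \<nu>_def by (rule translate_tuple_law [OF zY that, symmetric])
        also have "\<dots> = replicate (Suc k) (\<nu> N)"
          unfolding z_def \<nu>_def map_replicate copies.translate_word_law [OF that copies.one_F] ..
        finally show ?thesis .
      qed
      then have "\<forall>\<^sub>F N in sequentially. ext (tuple_law N [0 \<mapsto> z]) = 0"
        using ext_replicate [OF \<nu> that] by (intro eventually_mono [OF eventually_gt_at_top [of 0]]) simp
      then have "W (\<lambda>N. ext (tuple_law N [0 \<mapsto> z])) = W (\<lambda>N. 0)"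
        by (intro W.cong tl_bd zY) auto
      then show ?thesis by (simp add: v_def W.const)
    qed
    show "v - c hs = (\<Sum>m\<le>k. (-1) ^ m *\<^sub>R W (\<lambda>N. B N (face m hs)))" if hs: "set hs \<subseteq> F" "length hs = Suc k" for hs
    proof -
      have hsG: "set hs \<subseteq> carrier G" using hs copies.F_carrier by auto
      have face: "set (face m hs) \<subseteq> carrier G" "length (face m hs) = k" if "m \<le> k" for m
        using hs hsG that set_face [of m hs] by auto
      have bdd: "bounded (range (\<lambda>N. ext (bs N hs)))"
        using ext_bound [OF laws_bs [OF hsG]] by (auto simp: bounded_iff)
      have "v = W (\<lambda>N. ext (tuple_law N [0 \<mapsto> hs]))"
        unfolding v_def using hs by (intro limit_constant W zY) simp
      also have "\<dots> = W (\<lambda>N. ext (bs N hs))"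
        using hs translate_tuple_law [of hs]
        by (intro W.cong tl_bd bdd eventually_mono [OF eventually_gt_at_top [of 0]])
           (simp_all add: bs_def \<nu>_def)
      finally have "v - c hs = W (\<lambda>N. ext (bs N hs) - c hs)"
        using W.diff [OF bdd, of "\<lambda>_. c hs"] by (simp add: W.const)
      also have "\<dots> = W (\<lambda>N. \<Sum>m\<le>k. (-1) ^ m *\<^sub>R B N (face m hs))"
        using split [OF hsG hs(2)] by simp
      also have "\<dots> = (\<Sum>m\<le>k. (-1) ^ m *\<^sub>R W (\<lambda>N. B N (face m hs)))"
        using face by (intro W.sum B_bd) auto
      finally show ?thesis .
    qed
  qed
qed

end

section \<open>Bounded cohomology\<close>

context banach_module
begin

lemma rho_add: "g \<in> carrier G \<Longrightarrow> \<rho> g (u + v) = \<rho> g u + \<rho> g v"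
  by (rule linear_add [OF linear_action])

lemma rho_scale: "g \<in> carrier G \<Longrightarrow> \<rho> g (a *\<^sub>R v) = a *\<^sub>R \<rho> g v"
  by (rule linear_scale [OF linear_action])

lemma map_translate_tuples:
  "g \<in> carrier G \<Longrightarrow> xs \<in> tuples G k \<Longrightarrow> map (\<lambda>x. g \<otimes> x) xs \<in> tuples G k"
  using group_hom by (auto simp: tuples_def group_hom_def intro!: monoid.m_closed group.is_monoid)

lemma map_translate_inverse:
  assumes "g \<in> carrier G" "xs \<in> tuples G k"
  shows "map (\<lambda>x. g \<otimes> x) (map (\<lambda>x. inv g \<otimes> x) xs) = xs" "map (\<lambda>x. inv g \<otimes> x) (map (\<lambda>x. g \<otimes> x) xs) = xs"
proof -
  interpret G: group G using group_hom by (simp add: group_hom_def)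
  have "x \<in> carrier G" if "x \<in> set xs" for x using that assms by (auto simp: tuples_def)
  then show "map (\<lambda>x. g \<otimes> x) (map (\<lambda>x. inv g \<otimes> x) xs) = xs" "map (\<lambda>x. inv g \<otimes> x) (map (\<lambda>x. g \<otimes> x) xs) = xs"
    using assms(1) by (auto intro!: map_idI simp flip: G.m_assoc)
qed

text \<open>Substituting a translated tuple removes the inverse from \<open>cochain_action\<close>
  and turns fixed cochains into equivariant functions.\<close>

lemma mem_invariant_cochains:
  "f \<in> invariant_cochains G \<rho> k \<longleftrightarrow> f \<in> extensional (tuples G k) \<and> (\<exists>M. \<forall>xs\<in>tuples G k. norm (f xs) \<le> M) \<and>
     (\<forall>g\<in>carrier G. \<forall>xs\<in>tuples G k. f (map (\<lambda>x. g \<otimes> x) xs) = \<rho> g (f xs))"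
proof -
  have "(\<forall>g\<in>carrier G. cochain_action G \<rho> k g f = f) \<longleftrightarrow>
      (\<forall>g\<in>carrier G. \<forall>xs\<in>tuples G k. f (map (\<lambda>x. g \<otimes> x) xs) = \<rho> g (f xs))" (is "?A \<longleftrightarrow> ?B")
    if ext: "f \<in> extensional (tuples G k)"
  proof
    assume A: ?A
    show ?B
    proof (intro ballI)
      fix g xs assume g: "g \<in> carrier G" and xs: "xs \<in> tuples G k"
      then have "f (map (\<lambda>x. g \<otimes> x) xs) = cochain_action G \<rho> k g f (map (\<lambda>x. g \<otimes> x) xs)"
        using A by simp
      also have "\<dots> = \<rho> g (f xs)"
        unfolding cochain_action_def
        using map_translate_tuples [OF g xs] map_translate_inverse(2) [OF g xs] by (simp del: map_map)
      finally show "f (map (\<lambda>x. g \<otimes> x) xs) = \<rho> g (f xs)" .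
    qed
  next
    assume B: ?B
    show ?A
    proof (intro ballI extensionalityI [OF _ ext])
      fix g xs assume g: "g \<in> carrier G" and xs: "xs \<in> tuples G k"
      have inv: "inv g \<in> carrier G" using g group_hom by (simp add: group_hom_def)
      have "f (map (\<lambda>x. g \<otimes> x) (map (\<lambda>x. inv g \<otimes> x) xs)) = \<rho> g (f (map (\<lambda>x. inv g \<otimes> x) xs))"
        using B g map_translate_tuples [OF inv xs] by blast
      then show "cochain_action G \<rho> k g f xs = f xs"
        using xs unfolding map_translate_inverse(1) [OF g xs] by (simp add: cochain_action_def)
    qed (simp add: cochain_action_def)
  qed
  then show ?thesis
    by (auto simp: invariant_cochains_def bounded_cochains_def bounded_iff)
qed

lemma zero_invariant: "(\<lambda>xs\<in>tuples G k. 0) \<in> invariant_cochains G \<rho> k"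
  by (auto simp: mem_invariant_cochains map_translate_tuples linear_0 [OF linear_action] intro: exI [of _ 0])

lemma add_invariant:
  assumes "f \<in> invariant_cochains G \<rho> k" "h \<in> invariant_cochains G \<rho> k"
  shows "(\<lambda>xs\<in>tuples G k. f xs + h xs) \<in> invariant_cochains G \<rho> k"
proof -
  obtain M M' where "\<forall>xs\<in>tuples G k. norm (f xs) \<le> M" "\<forall>xs\<in>tuples G k. norm (h xs) \<le> M'"
    using assms by (auto simp: mem_invariant_cochains)
  then have "\<forall>xs\<in>tuples G k. norm (f xs + h xs) \<le> M + M'"
    by (meson add_mono norm_triangle_le)
  then show ?thesis
    using assms by (auto simp: mem_invariant_cochains map_translate_tuples rho_add)
qed

lemma minus_invariant:
  assumes "f \<in> invariant_cochains G \<rho> k"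
  shows "(\<lambda>xs\<in>tuples G k. - f xs) \<in> invariant_cochains G \<rho> k"
  using assms by (auto simp: mem_invariant_cochains map_translate_tuples linear_neg [OF linear_action])

lemma group_cochain_group: "group (cochain_group G \<rho> k)"
proof (rule groupI)
  fix f assume f: "f \<in> carrier (cochain_group G \<rho> k)"
  then have ext: "f \<in> extensional (tuples G k)"
    by (simp add: cochain_group_def mem_invariant_cochains)
  show "\<one>\<^bsub>cochain_group G \<rho> k\<^esub> \<otimes>\<^bsub>cochain_group G \<rho> k\<^esub> f = f"
    by (rule extensionalityI [OF _ ext]) (auto simp: cochain_group_def)
  show "\<exists>h\<in>carrier (cochain_group G \<rho> k). h \<otimes>\<^bsub>cochain_group G \<rho> k\<^esub> f = \<one>\<^bsub>cochain_group G \<rho> k\<^esub>"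
    using f minus_invariant [of f k]
    by (intro bexI [of _ "\<lambda>xs\<in>tuples G k. - f xs"]) (auto simp: cochain_group_def)
next
  fix f h l
  show "f \<otimes>\<^bsub>cochain_group G \<rho> k\<^esub> h \<otimes>\<^bsub>cochain_group G \<rho> k\<^esub> l
      = f \<otimes>\<^bsub>cochain_group G \<rho> k\<^esub> (h \<otimes>\<^bsub>cochain_group G \<rho> k\<^esub> l)"
    by (auto simp: cochain_group_def add.assoc intro!: restrict_ext)
qed (simp_all add: cochain_group_def zero_invariant add_invariant)

lemma face_tuples: "xs \<in> tuples G (Suc k) \<Longrightarrow> i \<le> Suc k \<Longrightarrow> face i xs \<in> tuples G k"
  using set_face [of i xs] by (auto simp: tuples_def)

lemma coboundary_face:
  "coboundary G k f = (\<lambda>xs\<in>tuples G (Suc k). \<Sum>i\<le>Suc k. (-1) ^ i *\<^sub>R f (face i xs))"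
  by (simp add: coboundary_def face_def)

lemma coboundary_invariant:
  assumes f: "f \<in> invariant_cochains G \<rho> k"
  shows "coboundary G k f \<in> invariant_cochains G \<rho> (Suc k)"
proof -
  obtain M where M: "\<forall>xs\<in>tuples G k. norm (f xs) \<le> M"
    using f by (auto simp: mem_invariant_cochains)
  have "norm (\<Sum>i\<le>Suc k. (-1) ^ i *\<^sub>R f (face i xs)) \<le> real (Suc (Suc k)) * M" if "xs \<in> tuples G (Suc k)" for xs
    unfolding lessThan_Suc_atMost [symmetric]
    by (rule norm_signed_sum_le) (use M face_tuples [OF that] in auto)
  moreover have "(\<Sum>i\<le>Suc k. (-1) ^ i *\<^sub>R f (face i (map (\<lambda>x. g \<otimes> x) xs)))
      = \<rho> g (\<Sum>i\<le>Suc k. (-1) ^ i *\<^sub>R f (face i xs))" if g: "g \<in> carrier G" and xs: "xs \<in> tuples G (Suc k)" for g xs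
    unfolding linear_sum [OF linear_action [OF g]]
    using f g face_tuples [OF xs]
    by (intro sum.cong) (auto simp: mem_invariant_cochains rho_scale simp flip: map_face)
  ultimately show ?thesis
    by (auto simp: mem_invariant_cochains coboundary_face map_translate_tuples simp del: sum.atMost_Suc)
qed

lemma coboundary_hom:
  "group_hom (cochain_group G \<rho> k) (cochain_group G \<rho> (Suc k)) (coboundary G k)"
proof (intro group_hom.intro group_cochain_group group_hom_axioms.intro homI)
  fix f h assume "f \<in> carrier (cochain_group G \<rho> k)" "h \<in> carrier (cochain_group G \<rho> k)"
  show "coboundary G k (f \<otimes>\<^bsub>cochain_group G \<rho> k\<^esub> h)
      = coboundary G k f \<otimes>\<^bsub>cochain_group G \<rho> (Suc k)\<^esub> coboundary G k h"
    unfolding coboundary_face cochain_group_def monoid.simps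
  proof (rule restrict_ext)
    fix xs assume xs: "xs \<in> tuples G (Suc k)"
    have "(\<Sum>i\<le>Suc k. (-1) ^ i *\<^sub>R (\<lambda>xs\<in>tuples G k. f xs + h xs) (face i xs))
        = (\<Sum>i\<le>Suc k. (-1) ^ i *\<^sub>R f (face i xs) + (-1) ^ i *\<^sub>R h (face i xs))"
      using face_tuples [OF xs] by (intro sum.cong) (auto simp: scaleR_add_right)
    then show "(\<Sum>i\<le>Suc k. (-1) ^ i *\<^sub>R (\<lambda>xs\<in>tuples G k. f xs + h xs) (face i xs))
      = (\<lambda>xs\<in>tuples G (Suc k). \<Sum>i\<le>Suc k. (-1) ^ i *\<^sub>R f (face i xs)) xs
        + (\<lambda>xs\<in>tuples G (Suc k). \<Sum>i\<le>Suc k. (-1) ^ i *\<^sub>R h (face i xs)) xs"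
      using xs by (simp add: sum.distrib del: sum.atMost_Suc)
  qed
qed (auto simp: cochain_group_def coboundary_invariant)

lemma coboundary_coboundary: "coboundary G (Suc k) (coboundary G k f) = (\<lambda>xs\<in>tuples G (Suc (Suc k)). 0)"
  unfolding coboundary_face [of "Suc k"]
proof (rule restrict_ext)
  fix xs assume xs: "xs \<in> tuples G (Suc (Suc k))"
  have "(\<Sum>i\<le>Suc (Suc k). (-1) ^ i *\<^sub>R coboundary G k f (face i xs))
      = (\<Sum>i\<le>Suc (Suc k). (-1) ^ i *\<^sub>R (\<Sum>j\<le>Suc k. (-1) ^ j *\<^sub>R f (face j (face i xs))))"
    using face_tuples [OF xs] by (intro sum.cong) (auto simp: coboundary_face simp del: sum.atMost_Suc)
  also have "\<dots> = 0"
  proof (rule sum_alternating_pairs)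
    fix i j assume "j < i" "i \<le> Suc (Suc k)"
    then show "f (face j (face i xs)) = f (face (i - 1) (face j xs))"
      using xs face_face [of j i xs] by (simp add: tuples_def)
  qed
  finally show "(\<Sum>i\<le>Suc (Suc k). (-1) ^ i *\<^sub>R coboundary G k f (face i xs)) = 0" .
qed

lemma cocycles_alt:
  "cocycles G \<rho> k = {f \<in> invariant_cochains G \<rho> k. coboundary G k f = (\<lambda>xs\<in>tuples G (Suc k). 0)}"
  by (simp add: cocycles_def kernel_def cochain_group_def)

lemma trivial_bounded_cohomology:
  assumes "cocycles G \<rho> (Suc k) \<subseteq> coboundary G k ` invariant_cochains G \<rho> k"
  shows "trivial_group (bounded_cohomology G \<rho> (Suc k))"
proof -
  let ?C = "cochain_group G \<rho> (Suc k)" and ?Z = "cocycles G \<rho> (Suc k)"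
  interpret C: group ?C by (rule group_cochain_group)
  have eq: "coboundaries G \<rho> (Suc k) = ?Z"
    using assms coboundary_invariant coboundary_coboundary
    by (auto simp: coboundaries_def cocycles_alt)
  have "subgroup ?Z ?C"
    unfolding cocycles_def by (rule group_hom.subgroup_kernel [OF coboundary_hom])
  then interpret Z: group "?C\<lparr>carrier := ?Z\<rparr>"
    by (rule subgroup.subgroup_is_group) (rule group_cochain_group)
  let ?Q = "?C\<lparr>carrier := ?Z\<rparr> Mod ?Z"
  have norm: "?Z \<lhd> ?C\<lparr>carrier := ?Z\<rparr>"
    using Z.normal_self by simp
  have "carrier ?Q = {?Z}"
  proof -
    have "?Z #>\<^bsub>?C\<lparr>carrier := ?Z\<rparr>\<^esub> x = ?Z" if "x \<in> ?Z" for x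
      using that Z.coset_join2 [of x ?Z] normal_imp_subgroup [OF norm] by simp
    moreover have "\<one>\<^bsub>?C\<^esub> \<in> ?Z" using Z.one_closed by simp
    ultimately show ?thesis
      by (auto simp: FactGroup_def RCOSETS_def)
  qed
  moreover have "group ?Q"
    by (rule normal.factorgroup_is_group [OF norm])
  ultimately show ?thesis
    by (simp add: trivial_group_def bounded_cohomology_def eq FactGroup_def)
qed

end

text \<open>The primitives on finite subsets are equivariant and uniformly bounded, so they have a
  weak-* limit.\<close>

lemma (in bounded_cocycle) primitive:
  assumes sep: "separable_space (euclidean :: 'e topology)"
    and copies: "\<And>F. finite F \<Longrightarrow> F \<subseteq> carrier G \<Longrightarrow> \<one> \<in> F \<Longrightarrow> \<exists>\<sigma>. permutable_copies G F \<sigma>"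
  obtains b :: "'g list \<Rightarrow> 'e" and B where
    "\<And>hs. set hs \<subseteq> carrier G \<Longrightarrow> length hs = k \<Longrightarrow> norm (b hs) \<le> B"
    "\<And>g hs. g \<in> carrier G \<Longrightarrow> set hs \<subseteq> carrier G \<Longrightarrow> length hs = k \<Longrightarrow> b (map (\<lambda>x. g \<otimes> x) hs) = \<rho> g (b hs)"
    "\<And>hs. set hs \<subseteq> carrier G \<Longrightarrow> length hs = Suc k \<Longrightarrow> c hs = (\<Sum>m\<le>k. (-1) ^ m *\<^sub>R b (face m hs))"
proof -
  interpret G: group G using group_hom by (simp add: group_hom_def)
  define Fl where "Fl = finite_subsets_at_top (carrier G)"
  \<comment> \<open>The last clause is guarded so that every \<open>F\<close> has a good pair. The
    choice then yields families indexed by all sets, which are bounded on their whole range, as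
    \<open>W\<close> demands.\<close>
  define good where "good F b v \<longleftrightarrow>
      (\<forall>hs. set hs \<subseteq> carrier G \<longrightarrow> length hs = k \<longrightarrow> norm (b hs) \<le> real k * M) \<and>
      (\<forall>g hs. g \<in> carrier G \<longrightarrow> set hs \<subseteq> carrier G \<longrightarrow> length hs = k \<longrightarrow> b (map (\<lambda>x. g \<otimes> x) hs) = \<rho> g (b hs)) \<and>
      norm v \<le> M \<and> (odd k \<longrightarrow> v = 0) \<and>
      (finite F \<longrightarrow> F \<subseteq> carrier G \<longrightarrow>
        (\<forall>hs. set hs \<subseteq> F \<longrightarrow> length hs = Suc k \<longrightarrow> v - c hs = (\<Sum>m\<le>k. (-1) ^ m *\<^sub>R b (face m hs))))"
    for F :: "'g set" and b :: "'g list \<Rightarrow> 'e" and v :: 'e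
  have "\<exists>b v. good F b v" for F
  proof -
    define F' where "F' = (if finite F \<and> F \<subseteq> carrier G then insert \<one> F else {\<one>})"
    have F': "finite F'" "F' \<subseteq> carrier G" "\<one> \<in> F'" by (auto simp: F'_def)
    obtain \<sigma> where \<sigma>: "permutable_copies G F' \<sigma>" using copies [OF F'] by blast
    interpret cocycle_with_copies G \<rho> \<Phi> \<tau> c k M F' \<sigma>
      by (intro cocycle_with_copies.intro cocycle_with_copies_axioms.intro bounded_cocycle_axioms \<sigma> sep)
    show ?thesis
    proof (rule primitive_on_finite_set)
      fix b :: "'g list \<Rightarrow> 'e" and v
      assume b: "\<And>hs. set hs \<subseteq> carrier G \<Longrightarrow> length hs = k \<Longrightarrow> norm (b hs) \<le> real k * M"
        "\<And>g hs. g \<in> carrier G \<Longrightarrow> set hs \<subseteq> carrier G \<Longrightarrow> length hs = k \<Longrightarrow> b (map (\<lambda>x. g \<otimes> x) hs) = \<rho> g (b hs)"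
        "norm v \<le> M" "odd k \<Longrightarrow> v = 0"
        "\<And>hs. set hs \<subseteq> F' \<Longrightarrow> length hs = Suc k \<Longrightarrow> v - c hs = (\<Sum>m\<le>k. (-1) ^ m *\<^sub>R b (face m hs))"
      have "F \<subseteq> F'" if "finite F" "F \<subseteq> carrier G" using that by (auto simp: F'_def)
      then have "v - c hs = (\<Sum>m\<le>k. (-1) ^ m *\<^sub>R b (face m hs))"
        if "finite F" "F \<subseteq> carrier G" "set hs \<subseteq> F" "length hs = Suc k" for hs
        using that by (intro b(5)) blast+
      then have "good F b v"
        unfolding good_def using b(1,2,3,4) by blast
      then show "\<exists>b v. good F b v" by blast
    qed
  qed
  then obtain b v where good: "\<And>F. good F (b F) (v F)"
    by metis
  have b_le: "norm (b F hs) \<le> real k * M" if "set hs \<subseteq> carrier G" "length hs = k" for F hs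
    using good [of F] that unfolding good_def by blast
  have b_inv: "b F (map (\<lambda>x. g \<otimes> x) hs) = \<rho> g (b F hs)"
    if "g \<in> carrier G" "set hs \<subseteq> carrier G" "length hs = k" for F g hs
    using good [of F] that unfolding good_def by blast
  have v_le: "norm (v F) \<le> M" and v_0: "odd k \<Longrightarrow> v F = 0" for F
    using good [of F] unfolding good_def by blast+
  have eq: "v F - c hs = (\<Sum>m\<le>k. (-1) ^ m *\<^sub>R b F (face m hs))"
    if "finite F" "F \<subseteq> carrier G" "set hs \<subseteq> F" "length hs = Suc k" for F hs
    using good [of F] that unfolding good_def by blast
  obtain W where W: "weak_limit_operator \<Phi> Fl W"
    using weak_limit_operator_exists [OF lin bij iso] by (metis Fl_def finite_subsets_at_top_neq_bot)
  interpret W: weak_limit_operator \<Phi> Fl W by (rule W)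
  have b_bd: "bounded (range (\<lambda>F. b F hs))" if "set hs \<subseteq> carrier G" "length hs = k" for hs
    using b_le [OF that] by (auto simp: bounded_iff)
  have v_bd: "bounded (range v)"
    using v_le by (auto simp: bounded_iff)
  have face: "set (face m hs) \<subseteq> carrier G" "length (face m hs) = k"
    if "m \<le> k" "set hs \<subseteq> carrier G" "length hs = Suc k" for m and hs :: "'g list"
    using that set_face [of m hs] by auto
  define \<beta> where "\<beta> hs = W (\<lambda>F. b F hs)" for hs
  have \<beta>_inv: "\<beta> (map (\<lambda>x. g \<otimes> x) hs) = \<rho> g (\<beta> hs)" if "g \<in> carrier G" "set hs \<subseteq> carrier G" "length hs = k" for g hs
    by (simp add: \<beta>_def b_inv that equivariant_limit [OF W] b_bd)
  have \<beta>_le: "norm (\<beta> hs) \<le> real k * M" if "set hs \<subseteq> carrier G" "length hs = k" for hs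
    unfolding \<beta>_def using b_le [OF that] by (intro W.norm_le b_bd that) auto
  have \<beta>_eq: "W v - c hs = (\<Sum>m\<le>k. (-1) ^ m *\<^sub>R \<beta> (face m hs))" if hs: "set hs \<subseteq> carrier G" "length hs = Suc k" for hs
  proof -
    have vc: "bounded (range (\<lambda>F. v F - c hs))"
      using v_bd by (intro bounded_minus_comp) auto
    have sb: "bounded (range (\<lambda>F. \<Sum>m\<le>k. (-1) ^ m *\<^sub>R b F (face m hs)))"
      unfolding bounded_iff
      using norm_signed_sum_le [of "Suc k" "\<lambda>m. b _ (face m hs)" "real k * M"] b_le face hs
      by (auto simp: lessThan_Suc_atMost)
    have "W v - c hs = W (\<lambda>F. v F - c hs)"
      using W.diff [OF v_bd, of "\<lambda>_. c hs"] by (simp add: W.const)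
    \<comment> \<open>The identity at \<open>hs\<close> holds for every finite \<open>F\<close> in
      the group that contains the entries of \<open>hs\<close>, hence eventually along the
      filter.\<close>
    also have "\<dots> = W (\<lambda>F. \<Sum>m\<le>k. (-1) ^ m *\<^sub>R b F (face m hs))"
      using hs by (intro W.cong vc sb)
        (auto simp: Fl_def eventually_finite_subsets_at_top intro!: exI [of _ "set hs"] eq)
    also have "\<dots> = (\<Sum>m\<le>k. (-1) ^ m *\<^sub>R \<beta> (face m hs))"
      unfolding \<beta>_def using face hs by (intro W.sum b_bd) auto
    finally show ?thesis .
  qed
  \<comment> \<open>\<open>W v\<close> is the value of \<open>c\<close> plus that of a coboundary of
    \<open>\<beta>\<close> at any tuple whatever. Both are equivariant, so comparing a tuple with
    its translate gives invariance; the constant tuple serves as an example.\<close>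
  have v_inv: "\<rho> g (W v) = W v" if g: "g \<in> carrier G" for g
  proof -
    define hs where "hs = replicate (Suc k) \<one>"
    have hs: "set hs \<subseteq> carrier G" "length hs = Suc k" by (auto simp: hs_def)
    have ghs: "set (map (\<lambda>x. g \<otimes> x) hs) \<subseteq> carrier G" "length (map (\<lambda>x. g \<otimes> x) hs) = Suc k"
      using g by (auto simp: hs_def)
    have "W v = c (map (\<lambda>x. g \<otimes> x) hs) + (\<Sum>m\<le>k. (-1) ^ m *\<^sub>R \<beta> (face m (map (\<lambda>x. g \<otimes> x) hs)))"
      using \<beta>_eq [OF ghs] by (simp add: algebra_simps)
    also have "\<dots> = \<rho> g (c hs + (\<Sum>m\<le>k. (-1) ^ m *\<^sub>R \<beta> (face m hs)))"
      using g hs face invariant [OF g hs]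
      by (simp add: linear_add [OF linear_action [OF g]] linear_sum [OF linear_action [OF g]]
          linear_scale [OF linear_action [OF g]] \<beta>_inv flip: map_face)
    also have "c hs + (\<Sum>m\<le>k. (-1) ^ m *\<^sub>R \<beta> (face m hs)) = W v"
      using \<beta>_eq [OF hs] by (simp add: algebra_simps)
    finally show ?thesis by (rule sym)
  qed
  have v_odd: "W v = 0" if "odd k"
  proof -
    have "v = (\<lambda>_. 0)" using v_0 [OF that] by auto
    then show ?thesis by (simp add: W.const)
  qed
  \<comment> \<open>The primitive is the constant \<open>W v\<close> minus \<open>\<beta>\<close>.
    Its coboundary has the coefficient 1 at \<open>W v\<close> if \<open>k\<close> is even and 0 if
    \<open>k\<close> is odd; in the latter case \<open>W v\<close> is zero anyway, so
    \<open>W v\<close> comes out in both cases.\<close>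
  show thesis
  proof
    show "norm (W v - \<beta> hs) \<le> M + real k * M" if "set hs \<subseteq> carrier G" "length hs = k" for hs
      using norm_triangle_ineq4 [of "W v" "\<beta> hs"] \<beta>_le [OF that] W.norm_le [OF v_bd, of M] v_le
      by (smt (verit) always_eventually)
    show "W v - \<beta> (map (\<lambda>x. g \<otimes> x) hs) = \<rho> g (W v - \<beta> hs)"
      if "g \<in> carrier G" "set hs \<subseteq> carrier G" "length hs = k" for g hs
      using that by (simp add: linear_diff [OF linear_action] v_inv \<beta>_inv)
    show "c hs = (\<Sum>m\<le>k. (-1) ^ m *\<^sub>R (W v - \<beta> (face m hs)))" if "set hs \<subseteq> carrier G" "length hs = Suc k" for hs
    proof -
      have "(\<Sum>m\<le>k. (-1) ^ m *\<^sub>R (W v - \<beta> (face m hs)))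
          = (\<Sum>m\<le>k. (-1 :: real) ^ m) *\<^sub>R W v - (\<Sum>m\<le>k. (-1) ^ m *\<^sub>R \<beta> (face m hs))"
        by (simp add: scaleR_diff_right sum_subtractf scaleR_sum_left)
      also have "(\<Sum>m\<le>k. (-1 :: real) ^ m) *\<^sub>R W v = W v"
        using v_odd by (simp add: sum_alternating)
      finally show ?thesis unfolding \<beta>_eq [OF that, symmetric] by simp
    qed
  qed
qed

text \<open>The group axioms for \<open>G\<close> are extracted from the module, which is an action
  of a group; this is why \<open>copies\<close> may presuppose \<open>group G\<close>.\<close>

theorem Xsep_boundedly_acyclic_if_permutable_copies:
  fixes G :: "('g, 'm) monoid_scheme" (structure)
  assumes copies: "\<And>F. group G \<Longrightarrow> finite F \<Longrightarrow> F \<subseteq> carrier G \<Longrightarrow> \<one> \<in> F \<Longrightarrow>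
    \<exists>\<sigma>. permutable_copies G F \<sigma>"
  shows "Xsep_boundedly_acyclic G TYPE('e::banach) TYPE('f::banach)"
  unfolding Xsep_boundedly_acyclic_def
proof (intro allI impI)
  fix n :: nat and \<rho> :: "'g \<Rightarrow> 'e \<Rightarrow> 'e" and \<pi> :: "'g \<Rightarrow> 'f \<Rightarrow> 'f"
  assume "1 \<le> n" and \<rho>: "banach_module G \<rho>" and sep: "separable_space (euclidean :: 'e topology)"
    and \<pi>: "banach_module G \<pi>" and dual: "is_dual_of G \<rho> \<pi>"
  interpret \<rho>: banach_module G \<rho> by (rule \<rho>)
  interpret \<pi>: banach_module G \<pi> by (rule \<pi>)
  interpret G: group G using \<rho>.group_hom by (simp add: group_hom_def)
  obtain k where n: "n = Suc k" using \<open>1 \<le> n\<close> by (cases n) auto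
  obtain \<Phi> :: "'e \<Rightarrow> ('f \<Rightarrow>\<^sub>L real)" where \<Phi>: "linear \<Phi>" "bij \<Phi>" "\<And>v. norm (\<Phi> v) = norm v"
    "\<And>g v. g \<in> carrier G \<Longrightarrow> \<Phi> (\<rho> g v) = contragredient G \<pi> g (\<Phi> v)"
    using dual by (auto simp: is_dual_of_def)
  have D: "dual_module G \<rho> \<Phi> (\<lambda>g. \<pi> (inv g))"
  proof (intro dual_module.intro dual_module_axioms.intro \<rho> \<Phi>(1,2,3))
    fix g v \<xi> assume g: "g \<in> carrier G"
    have "linear (\<pi> (inv g))" "\<And>\<xi>. norm (\<pi> (inv g) \<xi>) = norm \<xi>"
      using g \<pi>.linear_action \<pi>.isometric_action by auto
    then have "bounded_linear (\<pi> (inv g))"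
      by (intro bounded_linear_intro [where K = 1]) (auto simp: linear_add linear_scale)
    then have "bounded_linear (\<lambda>\<xi>. blinfun_apply (\<Phi> v) (\<pi> (inv g) \<xi>))"
      by (rule bounded_linear_compose [OF blinfun.bounded_linear_right])
    then show "blinfun_apply (\<Phi> (\<rho> g v)) \<xi> = blinfun_apply (\<Phi> v) (\<pi> (inv g) \<xi>)"
      by (simp add: \<Phi>(4) [OF g] contragredient_def bounded_linear_Blinfun_apply)
  qed
  have "c \<in> coboundary G k ` invariant_cochains G \<rho> k" if c: "c \<in> cocycles G \<rho> n" for c
  proof -
    have c_inv: "c \<in> invariant_cochains G \<rho> n" and d: "coboundary G n c = (\<lambda>xs\<in>tuples G (Suc n). 0)"
      using c by (auto simp: \<rho>.cocycles_alt)
    obtain M\<^sub>0 where M\<^sub>0: "\<And>xs. xs \<in> tuples G n \<Longrightarrow> norm (c xs) \<le> M\<^sub>0"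
      using c_inv by (auto simp: \<rho>.mem_invariant_cochains)
    have ext: "c \<in> extensional (tuples G n)"
      using c_inv by (simp add: \<rho>.mem_invariant_cochains)
    \<comment> \<open>Outside the tuples the extensional cochain takes the value
      \<open>undefined\<close>. As the locale bounds \<open>c\<close> on all lists, \<open>M\<close>
      must dominate the norm of this value too.\<close>
    define M where "M = max M\<^sub>0 (norm (undefined :: 'e))"
    interpret bounded_cocycle G \<rho> \<Phi> "\<lambda>g. \<pi> (inv g)" c n M
    proof (intro bounded_cocycle.intro D bounded_cocycle_axioms.intro)
      show "norm (c xs) \<le> M" for xs
      proof (cases "xs \<in> tuples G n")
        case True
        then show ?thesis using M\<^sub>0 [of xs] by (simp add: M_def le_max_iff_disj)
      next
        case False
        then show ?thesis using extensional_arb [OF ext] by (simp add: M_def)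
      qed
      show "c (map (\<lambda>x. g \<otimes> x) xs) = \<rho> g (c xs)"
        if "g \<in> carrier G" "set xs \<subseteq> carrier G" "length xs = Suc n" for g xs
        using c_inv that by (simp add: \<rho>.mem_invariant_cochains tuples_def)
      show "(\<Sum>i\<le>Suc n. (-1) ^ i *\<^sub>R c (face i xs)) = 0"
        if "set xs \<subseteq> carrier G" "length xs = n + 2" for xs
      proof -
        have "xs \<in> tuples G (Suc n)" using that by (simp add: tuples_def)
        then show ?thesis
          using fun_cong [OF d, of xs] by (simp add: \<rho>.coboundary_face del: sum.atMost_Suc)
      qed
    qed
    \<comment> \<open>A cochain of degree \<open>k\<close> lives on lists of length
      \<open>Suc k\<close>, so a function on lists of length \<open>n\<close> has degree
      \<open>k = n - 1\<close>, as a primitive of \<open>c\<close> should.\<close>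
    obtain b :: "'g list \<Rightarrow> 'e" and B where
      b: "\<And>hs. set hs \<subseteq> carrier G \<Longrightarrow> length hs = n \<Longrightarrow> norm (b hs) \<le> B"
      "\<And>g hs. g \<in> carrier G \<Longrightarrow> set hs \<subseteq> carrier G \<Longrightarrow> length hs = n \<Longrightarrow> b (map (\<lambda>x. g \<otimes> x) hs) = \<rho> g (b hs)"
      "\<And>hs. set hs \<subseteq> carrier G \<Longrightarrow> length hs = Suc n \<Longrightarrow> c hs = (\<Sum>m\<le>n. (-1) ^ m *\<^sub>R b (face m hs))"
      by (rule primitive [OF sep copies [OF G.group_axioms]]) (assumption | rule that)+
    have "restrict b (tuples G k) \<in> invariant_cochains G \<rho> k"
      using b(1,2) \<rho>.map_translate_tuples [of _ _ k]
      by (auto simp: \<rho>.mem_invariant_cochains) (auto simp: tuples_def n)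
    moreover have "c = coboundary G k (restrict b (tuples G k))"
      unfolding \<rho>.coboundary_face n [symmetric]
    proof (rule extensionalityI [OF ext])
      fix xs assume xs: "xs \<in> tuples G n"
      then have "face i xs \<in> tuples G k" if "i \<le> n" for i
        using \<rho>.face_tuples [of xs k] that n by simp
      then show "c xs = (\<lambda>xs\<in>tuples G n. \<Sum>i\<le>n. (-1) ^ i *\<^sub>R restrict b (tuples G k) (face i xs)) xs"
        using xs b(3) [of xs] by (simp add: tuples_def)
    qed simp
    ultimately show ?thesis by blast
  qed
  then show "trivial_group (bounded_cohomology G \<rho> n)"
    unfolding n by (intro \<rho>.trivial_bounded_cohomology) auto
qed

section \<open>Generation of rational function fields\<close>

lemma poly_mapping_sum_single:
  fixes p :: "'a \<Rightarrow>\<^sub>0 'b::comm_monoid_add"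
  shows "p = (\<Sum>k\<in>Poly_Mapping.keys p. Poly_Mapping.single k (Poly_Mapping.lookup p k))"
  by (rule poly_mapping_eqI)
     (auto simp: lookup_sum lookup_single when_def in_keys_iff sum.delta)

text \<open>The case of a single term assumes that its key occurs in \<open>p\<close>, so that a
  restriction on the variables of \<open>p\<close> remains available in the induction.\<close>

lemma poly_mapping_additive_induct [case_names zero single add]:
  fixes p :: "'a \<Rightarrow>\<^sub>0 'b::comm_monoid_add"
  assumes "P 0" "\<And>k v. k \<in> Poly_Mapping.keys p \<Longrightarrow> P (Poly_Mapping.single k v)"
    "\<And>q r. P q \<Longrightarrow> P r \<Longrightarrow> P (q + r)"
  shows "P p"
proof -
  have "P (\<Sum>k\<in>K. Poly_Mapping.single k (Poly_Mapping.lookup p k))" if "finite K" "K \<subseteq> Poly_Mapping.keys p" for K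
    using that by (induction K rule: finite_induct) (auto intro: assms)
  then show ?thesis
    using poly_mapping_sum_single [of p] by (metis finite_keys order_refl)
qed

lemma Fract_add_1: "Fract (p + q) 1 = Fract p 1 + Fract q (1 :: 'a::idom)"
  by simp

lemma Fract_mult_1: "Fract (p * q) 1 = Fract p 1 * Fract q (1 :: 'a::idom)"
  by simp

lemma Fract_eq_mult_inverse: "Fract p q = Fract p 1 * inverse (Fract q (1 :: 'a::idom))"
  by simp

text \<open>Powers, monomials, polynomials and fractions are built up in turn. Identities between
  endomorphisms can hence be tested on variables alone.\<close>

lemma ratfun_generated:
  fixes S :: "'k::field ratfun set"
  assumes const: "\<And>c. ratfun_const c \<in> S" and var: "\<And>i. i \<in> V \<Longrightarrow> ratfun_var i \<in> S"
    and add: "\<And>x y. x \<in> S \<Longrightarrow> y \<in> S \<Longrightarrow> x + y \<in> S" and mult: "\<And>x y. x \<in> S \<Longrightarrow> y \<in> S \<Longrightarrow> x * y \<in> S"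
    and inverse: "\<And>x. x \<in> S \<Longrightarrow> x \<noteq> 0 \<Longrightarrow> inverse x \<in> S"
    and pq: "poly_vars p \<subseteq> V" "poly_vars q \<subseteq> V" "q \<noteq> 0"
  shows "Fract p q \<in> S"
proof -
  have one: "Fract 1 1 \<in> S"
    using const [of 1] by (simp add: ratfun_const_def)
  have power: "Fract (Poly_Mapping.single (Poly_Mapping.single i n) 1) 1 \<in> S" if "i \<in> V" for i n
  proof (induction n)
    case (Suc n)
    have eq: "Poly_Mapping.single (Poly_Mapping.single i (Suc n)) (1 :: 'k)
        = Poly_Mapping.single (Poly_Mapping.single i 1) 1 * Poly_Mapping.single (Poly_Mapping.single i n) 1"
      by (simp add: mult_single flip: single_add)
    show ?case
      unfolding eq Fract_mult_1 using Suc var [OF that] by (intro mult) (simp_all add: ratfun_var_def)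
  qed (simp add: one)
  have monomial: "Fract (Poly_Mapping.single m 1) 1 \<in> S" if "Poly_Mapping.keys m \<subseteq> V" for m
  proof (induction m rule: poly_mapping_additive_induct)
    case (add q r)
    have "Poly_Mapping.single (q + r) (1 :: 'k) = Poly_Mapping.single q 1 * Poly_Mapping.single r 1"
      by (simp add: mult_single)
    then show ?case
      using add mult by (simp only: Fract_mult_1)
  qed (use that power one in auto)
  have poly: "Fract p 1 \<in> S" if "poly_vars p \<subseteq> V" for p :: "'k mpoly"
  proof (induction p rule: poly_mapping_additive_induct)
    case zero
    then show ?case using const [of 0] by (simp add: ratfun_const_def)
  next
    case (single m c)
    have "Poly_Mapping.single m c = Poly_Mapping.single 0 c * Poly_Mapping.single m 1"
      by (simp add: mult_single)
    moreover have "Poly_Mapping.keys m \<subseteq> V" using single that by (auto simp: poly_vars_def)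
    ultimately show ?case
      using mult [OF const [of c] monomial [of m]] by (simp only: Fract_mult_1 ratfun_const_def)
  next
    case (add q r)
    then show ?case using assms(3) by (simp only: Fract_add_1)
  qed
  have "Fract q 1 \<noteq> 0"
    using pq(3) by (simp add: Zero_fract_def eq_fract)
  then show ?thesis
    unfolding Fract_eq_mult_inverse [of p q] using pq by (intro mult inverse poly)
qed

lemma Fract_in_ratfun_field:
  "poly_vars p \<subseteq> {..<n} \<Longrightarrow> poly_vars q \<subseteq> {..<n} \<Longrightarrow> q \<noteq> 0 \<Longrightarrow> Fract p q \<in> ratfun_field n"
  unfolding ratfun_field_def by blast

lemma ratfun_field_cases:
  assumes "x \<in> ratfun_field n"
  obtains p q where "x = Fract p q" "poly_vars p \<subseteq> {..<n}" "poly_vars q \<subseteq> {..<n}" "q \<noteq> 0"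
  using assms unfolding ratfun_field_def by blast

lemma ratfun_field_induct:
  fixes S :: "'k::field ratfun set"
  assumes "\<And>c. ratfun_const c \<in> S" and "\<And>i. i < n \<Longrightarrow> ratfun_var i \<in> S"
    and "\<And>x y. x \<in> S \<Longrightarrow> y \<in> S \<Longrightarrow> x + y \<in> S" and "\<And>x y. x \<in> S \<Longrightarrow> y \<in> S \<Longrightarrow> x * y \<in> S"
    and "\<And>x. x \<in> S \<Longrightarrow> x \<noteq> 0 \<Longrightarrow> inverse x \<in> S"
  shows "ratfun_field n \<subseteq> S"
proof
  fix x :: "'k ratfun" assume "x \<in> ratfun_field n"
  then obtain p q where "x = Fract p q" "poly_vars p \<subseteq> {..<n}" "poly_vars q \<subseteq> {..<n}" "q \<noteq> 0"
    by (rule ratfun_field_cases)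
  then show "x \<in> S"
    using ratfun_generated [of S "{..<n}" p q] assms by auto
qed

lemma ratfun_induct:
  fixes S :: "'k::field ratfun set"
  assumes "\<And>c. ratfun_const c \<in> S" and "\<And>i. ratfun_var i \<in> S"
    and "\<And>x y. x \<in> S \<Longrightarrow> y \<in> S \<Longrightarrow> x + y \<in> S" and "\<And>x y. x \<in> S \<Longrightarrow> y \<in> S \<Longrightarrow> x * y \<in> S"
    and "\<And>x. x \<in> S \<Longrightarrow> x \<noteq> 0 \<Longrightarrow> inverse x \<in> S"
  shows "x \<in> S"
  using ratfun_generated [of S UNIV] assms by (cases x) auto

lemma poly_vars_add: "poly_vars (p + q) \<subseteq> poly_vars p \<union> poly_vars q"
  using keys_add [of p q] by (auto simp: poly_vars_def)

lemma poly_vars_mult: "poly_vars (p * q) \<subseteq> poly_vars p \<union> poly_vars (q :: 'k::field mpoly)"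
proof
  fix i assume "i \<in> poly_vars (p * q)"
  then obtain m where m: "m \<in> Poly_Mapping.keys (p * q)" "i \<in> Poly_Mapping.keys m"
    by (auto simp: poly_vars_def)
  then obtain a b where "a \<in> Poly_Mapping.keys p" "b \<in> Poly_Mapping.keys q" "m = a + b"
    using keys_mult [of p q] by auto
  then show "i \<in> poly_vars p \<union> poly_vars q"
    using m keys_add [of a b] by (auto simp: poly_vars_def)
qed

lemma poly_vars_1: "poly_vars (1 :: 'k::field mpoly) \<subseteq> V"
  by (auto simp: poly_vars_def simp flip: single_one)

lemma ratfun_const_field: "ratfun_const c \<in> ratfun_field n"
  unfolding ratfun_const_def
  by (intro Fract_in_ratfun_field poly_vars_1) (auto simp: poly_vars_def)

lemma ratfun_var_field: "i < n \<Longrightarrow> ratfun_var i \<in> ratfun_field n"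
  unfolding ratfun_var_def
  by (intro Fract_in_ratfun_field poly_vars_1) (auto simp: poly_vars_def)

lemma ratfun_field_closed:
  fixes x y :: "'k::field ratfun"
  assumes "x \<in> ratfun_field n" "y \<in> ratfun_field n"
  shows "x + y \<in> ratfun_field n" "x * y \<in> ratfun_field n"
proof -
  obtain p q where x: "x = Fract p q" "poly_vars p \<subseteq> {..<n}" "poly_vars q \<subseteq> {..<n}" "q \<noteq> 0"
    using assms(1) by (rule ratfun_field_cases)
  obtain r s where y: "y = Fract r s" "poly_vars r \<subseteq> {..<n}" "poly_vars s \<subseteq> {..<n}" "s \<noteq> 0"
    using assms(2) by (rule ratfun_field_cases)
  have pv: "poly_vars (a * b) \<subseteq> {..<n}" if "poly_vars a \<subseteq> {..<n}" "poly_vars b \<subseteq> {..<n}" for a b :: "'k mpoly"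
    using that poly_vars_mult [of a b] by blast
  have sum: "poly_vars (p * s + r * q) \<subseteq> {..<n}"
    using poly_vars_add [of "p * s" "r * q"] pv [OF x(2) y(3)] pv [OF y(2) x(3)] by blast
  have "Fract (p * s + r * q) (q * s) \<in> ratfun_field n"
    using x y by (intro Fract_in_ratfun_field sum pv) auto
  then show "x + y \<in> ratfun_field n"
    using x y by simp
  have "Fract (p * r) (q * s) \<in> ratfun_field n"
    using x y by (intro Fract_in_ratfun_field pv) auto
  then show "x * y \<in> ratfun_field n"
    using x y by simp
qed

lemma ratfun_field_inverse:
  fixes x :: "'k::field ratfun"
  assumes "x \<in> ratfun_field n" "x \<noteq> 0"
  shows "inverse x \<in> ratfun_field n"
proof -
  obtain p q where x: "x = Fract p q" "poly_vars p \<subseteq> {..<n}" "poly_vars q \<subseteq> {..<n}" "q \<noteq> 0"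
    using assms(1) by (rule ratfun_field_cases)
  then have "p \<noteq> 0" using assms(2) by (auto simp: Zero_fract_def eq_fract)
  then show ?thesis using x by (simp add: Fract_in_ratfun_field)
qed

lemma ratfun_field_mono:
  assumes "n \<le> m"
  shows "ratfun_field n \<subseteq> ratfun_field m"
proof
  fix x assume "x \<in> ratfun_field n"
  then obtain p q where "x = Fract p q" "poly_vars p \<subseteq> {..<n}" "poly_vars q \<subseteq> {..<n}" "q \<noteq> 0"
    by (rule ratfun_field_cases)
  moreover have "{..<n} \<subseteq> {..<m}" using assms by auto
  ultimately show "x \<in> ratfun_field m"
    by (auto intro!: Fract_in_ratfun_field)
qed

section \<open>Endomorphisms of rational function fields\<close>

definition ratfun_hom :: "('k::field ratfun \<Rightarrow> 'k ratfun) \<Rightarrow> bool" where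
  "ratfun_hom \<sigma> \<longleftrightarrow> (\<forall>a b. \<sigma> (a + b) = \<sigma> a + \<sigma> b \<and> \<sigma> (a * b) = \<sigma> a * \<sigma> b) \<and> (\<forall>c. \<sigma> (ratfun_const c) = ratfun_const c)"

lemma ratfun_const_1: "ratfun_const 1 = 1"
  by (simp add: ratfun_const_def One_fract_def)

lemma
  assumes "ratfun_hom \<sigma>"
  shows ratfun_hom_add: "\<sigma> (a + b) = \<sigma> a + \<sigma> b" and ratfun_hom_mult: "\<sigma> (a * b) = \<sigma> a * \<sigma> b"
    and ratfun_hom_const: "\<sigma> (ratfun_const c) = ratfun_const c"
    and ratfun_hom_inverse: "a \<noteq> 0 \<Longrightarrow> \<sigma> (inverse a) = inverse (\<sigma> a)"
proof -
  show add: "\<sigma> (a + b) = \<sigma> a + \<sigma> b" and mult: "\<sigma> (a * b) = \<sigma> a * \<sigma> b"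
    and const: "\<sigma> (ratfun_const c) = ratfun_const c" for a b c
    using assms by (auto simp: ratfun_hom_def)
  assume "a \<noteq> 0"
  then have "\<sigma> a * \<sigma> (inverse a) = 1"
    using const [of 1] by (simp add: ratfun_const_1 flip: mult)
  then show "\<sigma> (inverse a) = inverse (\<sigma> a)"
    by (metis inverse_unique)
qed

lemma ratfun_hom_comp: "ratfun_hom \<sigma> \<Longrightarrow> ratfun_hom \<tau> \<Longrightarrow> ratfun_hom (\<sigma> \<circ> \<tau>)"
  by (simp add: ratfun_hom_def)

lemma ratfun_hom_id: "ratfun_hom id"
  by (simp add: ratfun_hom_def)

lemma ratfun_hom_eq_on_field:
  assumes \<sigma>: "ratfun_hom \<sigma>" and \<tau>: "ratfun_hom \<tau>" and eq: "\<And>i. i < n \<Longrightarrow> \<sigma> (ratfun_var i) = \<tau> (ratfun_var i)"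
    and x: "x \<in> ratfun_field n"
  shows "\<sigma> x = \<tau> x"
proof -
  have "ratfun_field n \<subseteq> {x. \<sigma> x = \<tau> x}"
    by (rule ratfun_field_induct)
       (auto simp: eq ratfun_hom_add \<sigma> \<tau> ratfun_hom_mult ratfun_hom_const ratfun_hom_inverse)
  then show ?thesis using x by auto
qed

lemma ratfun_hom_eqI:
  assumes \<sigma>: "ratfun_hom \<sigma>" and \<tau>: "ratfun_hom \<tau>" and eq: "\<And>i. \<sigma> (ratfun_var i) = \<tau> (ratfun_var i)"
  shows "\<sigma> = \<tau>"
proof
  fix x
  have "x \<in> {x. \<sigma> x = \<tau> x}"
    by (rule ratfun_induct)
       (auto simp: eq ratfun_hom_add \<sigma> \<tau> ratfun_hom_mult ratfun_hom_const ratfun_hom_inverse)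
  then show "\<sigma> x = \<tau> x" by simp
qed

lemma ratfun_hom_into_field:
  assumes \<sigma>: "ratfun_hom \<sigma>" and var: "\<And>i. i < n \<Longrightarrow> \<sigma> (ratfun_var i) \<in> ratfun_field m" and x: "x \<in> ratfun_field n"
  shows "\<sigma> x \<in> ratfun_field m"
proof -
  have "\<sigma> (inverse a) \<in> ratfun_field m" if "\<sigma> a \<in> ratfun_field m" "a \<noteq> 0" for a
    unfolding ratfun_hom_inverse [OF \<sigma> that(2)]
    using that(1) ratfun_field_inverse by (cases "\<sigma> a = 0") auto
  then have "ratfun_field n \<subseteq> {x. \<sigma> x \<in> ratfun_field m}"
    by (intro ratfun_field_induct)
       (auto simp: var ratfun_hom_add [OF \<sigma>] ratfun_hom_mult [OF \<sigma>] ratfun_hom_const [OF \<sigma>]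
         ratfun_const_field ratfun_field_closed)
  then show ?thesis using x by auto
qed

section \<open>Automorphisms of the field in infinitely many variables\<close>

lemma aut_group_UNIV:
  "carrier (aut_group UNIV) = {\<sigma>. bij \<sigma> \<and> ratfun_hom \<sigma>}"
  by (auto simp: aut_group_def Bij_def ratfun_hom_def)

lemma mult_cremona_group_infinity:
  "bij f \<Longrightarrow> bij g \<Longrightarrow> f \<otimes>\<^bsub>cremona_group_infinity\<^esub> g = f \<circ> g"
  by (simp add: cremona_group_infinity_def aut_group_def BijGroup_def Bij_def compose_def fun_eq_iff)

lemma one_cremona_group_infinity: "\<one>\<^bsub>cremona_group_infinity\<^esub> = id"
  by (simp add: cremona_group_infinity_def aut_group_def BijGroup_def fun_eq_iff)

text \<open>Of the condition on \<open>ratfun_field n\<close> in \<open>cremona_stable\<close>, only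
  that it is mapped into itself is kept. The commutation relations rest on this, and it is readily
  seen to persist when \<open>n\<close> grows.\<close>

definition ratfun_stable :: "nat \<Rightarrow> ('k::field ratfun \<Rightarrow> 'k ratfun) \<Rightarrow> bool" where
  "ratfun_stable n \<tau> \<longleftrightarrow> bij \<tau> \<and> ratfun_hom \<tau> \<and> \<tau> ` ratfun_field n \<subseteq> ratfun_field n \<and> (\<forall>i\<ge>n. \<tau> (ratfun_var i) = ratfun_var i)"

lemma cremona_stable_imp_stable: "\<tau> \<in> cremona_stable n \<Longrightarrow> ratfun_stable n \<tau>"
  unfolding cremona_stable_def ratfun_stable_def aut_group_UNIV
  by (auto simp: cremona_group_def aut_group_def Bij_def bij_betw_def)

lemma ratfun_stable_mono:
  assumes "ratfun_stable n \<tau>" "n \<le> m"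
  shows "ratfun_stable m \<tau>"
proof -
  have "\<tau> (ratfun_var i) \<in> ratfun_field m" if "i < m" for i
  proof (cases "i < n")
    case True
    then show ?thesis
      using assms ratfun_var_field [of i n] ratfun_field_mono [OF assms(2)] unfolding ratfun_stable_def by blast
  next
    case False
    then show ?thesis
      using assms(1) ratfun_var_field [OF that] by (simp add: ratfun_stable_def)
  qed
  then show ?thesis
    using assms ratfun_hom_into_field [of \<tau> m m] unfolding ratfun_stable_def by auto
qed

section \<open>Renaming variables\<close>

text \<open>\<open>map_key\<close> precomposes with its argument, so the inverse permutation is
  needed for \<open>x\<^sub>i\<close> to become the variable with index \<open>\<beta> i\<close>.
  The same holds for polynomials, with monomials as keys.\<close>

definition rename_monom :: "(nat \<Rightarrow> nat) \<Rightarrow> (nat \<Rightarrow>\<^sub>0 nat) \<Rightarrow> (nat \<Rightarrow>\<^sub>0 nat)" where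
  "rename_monom \<beta> = Poly_Mapping.map_key (inv_into UNIV \<beta>)"

definition rename_poly :: "(nat \<Rightarrow> nat) \<Rightarrow> 'k::field mpoly \<Rightarrow> 'k mpoly" where
  "rename_poly \<beta> = Poly_Mapping.map_key (rename_monom (inv_into UNIV \<beta>))"

definition rename_ratfun :: "(nat \<Rightarrow> nat) \<Rightarrow> 'k::field ratfun \<Rightarrow> 'k ratfun" where
  "rename_ratfun \<beta> x = (THE y. \<exists>p q. q \<noteq> 0 \<and> x = Fract p q \<and> y = Fract (rename_poly \<beta> p) (rename_poly \<beta> q))"

context
  fixes \<beta> :: "nat \<Rightarrow> nat"
  assumes \<beta>: "bij \<beta>"
begin

lemma inv_\<beta>: "bij (inv_into UNIV \<beta>)" "inv_into UNIV (inv_into UNIV \<beta>) = \<beta>" "inj \<beta>" "inj (inv_into UNIV \<beta>)"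
  using \<beta> by (auto simp: bij_imp_bij_inv inv_inv_eq bij_is_inj)

lemma comp_inv_\<beta>: "inv_into UNIV \<beta> \<circ> \<beta> = (\<lambda>x. x)" "\<beta> \<circ> inv_into UNIV \<beta> = (\<lambda>x. x)"
  using \<beta> by (auto simp: fun_eq_iff bij_is_inj bij_is_surj surj_f_inv_f)

lemma rename_monom_inverse:
  "rename_monom (inv_into UNIV \<beta>) (rename_monom \<beta> m) = m" "rename_monom \<beta> (rename_monom (inv_into UNIV \<beta>) m) = m"
  by (simp_all add: rename_monom_def map_key_compose inv_\<beta> comp_inv_\<beta> map_key_id)

lemma inj_rename_monom: "inj (rename_monom \<beta>)" "inj (rename_monom (inv_into UNIV \<beta>))"
  using rename_monom_inverse by (metis injI)+

lemma rename_monom_simps: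
  "rename_monom \<beta> 0 = 0" "rename_monom \<beta> (m + m') = rename_monom \<beta> m + rename_monom \<beta> m'"
  "rename_monom \<beta> (Poly_Mapping.single i c) = Poly_Mapping.single (\<beta> i) c"
proof -
  show "rename_monom \<beta> 0 = 0" "rename_monom \<beta> (m + m') = rename_monom \<beta> m + rename_monom \<beta> m'"
    by (simp_all add: rename_monom_def inv_\<beta> map_key_plus)
  show "rename_monom \<beta> (Poly_Mapping.single i c) = Poly_Mapping.single (\<beta> i) c"
    using map_key_single [OF inv_\<beta>(4), of "\<beta> i" c] \<beta> by (simp add: rename_monom_def bij_is_inj)
qed

lemma rename_poly_simps:
  fixes p q :: "'k::field mpoly"
  shows "rename_poly \<beta> 0 = (0 :: 'k mpoly)" "rename_poly \<beta> (p + q) = rename_poly \<beta> p + rename_poly \<beta> q"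
    "rename_poly \<beta> (Poly_Mapping.single m (c :: 'k)) = Poly_Mapping.single (rename_monom \<beta> m) c"
    "rename_poly \<beta> (1 :: 'k mpoly) = 1"
proof -
  show "rename_poly \<beta> 0 = (0 :: 'k mpoly)" "rename_poly \<beta> (p + q) = rename_poly \<beta> p + rename_poly \<beta> q"
    by (simp_all add: rename_poly_def inj_rename_monom map_key_plus)
  show single: "rename_poly \<beta> (Poly_Mapping.single m c) = Poly_Mapping.single (rename_monom \<beta> m) c" for m and c :: 'k
    using map_key_single [OF inj_rename_monom(2), of "rename_monom \<beta> m" c]
    by (simp add: rename_poly_def rename_monom_inverse)
  show "rename_poly \<beta> (1 :: 'k mpoly) = 1"
    using single [of 0 1] by (simp add: rename_monom_simps)
qed

lemma rename_poly_mult: "rename_poly \<beta> (p * q) = rename_poly \<beta> p * rename_poly \<beta> (q :: 'k::field mpoly)"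
proof (induction p rule: poly_mapping_additive_induct)
  case (single m c)
  show ?case
    by (induction q rule: poly_mapping_additive_induct)
       (simp_all add: rename_poly_simps rename_monom_simps mult_single distrib_left)
qed (simp_all add: rename_poly_simps distrib_right)

lemma rename_poly_eq_0_iff: "rename_poly \<beta> p = 0 \<longleftrightarrow> (p :: 'k::field mpoly) = 0"
proof
  assume "rename_poly \<beta> p = 0"
  then have "rename_monom (inv_into UNIV \<beta>) -` Poly_Mapping.keys p = {}"
    using keys_map_key [OF inj_rename_monom(2), of p] by (simp add: rename_poly_def)
  then have "Poly_Mapping.keys p = {}"
    using rename_monom_inverse(1) by (metis empty_iff equals0I vimageI)
  then show "p = 0" by simp
qed (simp add: rename_poly_simps)

text \<open>The description does not depend on the fraction chosen, since renaming is multiplicative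
  and injective at 0: it preserves equality of cross products and keeps denominators
  nonzero.\<close>

lemma rename_ratfun_Fract:
  fixes p q :: "'k::field mpoly"
  assumes q: "q \<noteq> 0"
  shows "rename_ratfun \<beta> (Fract p q) = Fract (rename_poly \<beta> p) (rename_poly \<beta> q)"
  unfolding rename_ratfun_def
proof (rule the_equality)
  fix y assume "\<exists>p' q'. q' \<noteq> 0 \<and> Fract p q = Fract p' q' \<and> y = Fract (rename_poly \<beta> p') (rename_poly \<beta> q')"
  then obtain p' q' where p'q': "q' \<noteq> 0" "Fract p q = Fract p' q'" "y = Fract (rename_poly \<beta> p') (rename_poly \<beta> q')"
    by blast
  then have "p * q' = p' * q" using q by (simp add: eq_fract)
  then have "rename_poly \<beta> p * rename_poly \<beta> q' = rename_poly \<beta> p' * rename_poly \<beta> q"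
    by (simp flip: rename_poly_mult)
  then show "y = Fract (rename_poly \<beta> p) (rename_poly \<beta> q)"
    using p'q' q by (simp add: eq_fract rename_poly_eq_0_iff)
qed (use q in blast)

lemma ratfun_hom_rename: "ratfun_hom (rename_ratfun \<beta> :: 'k::field ratfun \<Rightarrow> _)"
  unfolding ratfun_hom_def
proof (intro conjI allI)
  fix a b :: "'k ratfun"
  obtain p q r s where a: "a = Fract p q" "q \<noteq> 0" and b: "b = Fract r s" "s \<noteq> 0"
    by (metis Fract_cases)
  show "rename_ratfun \<beta> (a + b) = rename_ratfun \<beta> a + rename_ratfun \<beta> b"
    "rename_ratfun \<beta> (a * b) = rename_ratfun \<beta> a * rename_ratfun \<beta> b"
    using a b by (simp_all add: rename_ratfun_Fract rename_poly_eq_0_iff rename_poly_simps rename_poly_mult)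
next
  fix c :: 'k
  show "rename_ratfun \<beta> (ratfun_const c) = ratfun_const c"
    by (simp add: ratfun_const_def rename_ratfun_Fract rename_poly_simps rename_monom_simps)
qed

lemma rename_ratfun_var: "rename_ratfun \<beta> (ratfun_var i) = ratfun_var (\<beta> i)"
  by (simp add: ratfun_var_def rename_ratfun_Fract rename_poly_simps rename_monom_simps)

end

lemma rename_ratfun_comp:
  assumes "bij \<beta>" "bij \<gamma>"
  shows "rename_ratfun (\<beta> \<circ> \<gamma>) = rename_ratfun \<beta> \<circ> rename_ratfun \<gamma>"
  using assms by (intro ratfun_hom_eqI)
    (simp_all add: ratfun_hom_comp ratfun_hom_rename bij_comp rename_ratfun_var)

lemma rename_ratfun_id: "rename_ratfun id = id"
  by (rule ratfun_hom_eqI) (simp_all add: ratfun_hom_rename ratfun_hom_id rename_ratfun_var)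

lemma rename_ratfun_inverse:
  assumes "bij \<beta>"
  shows "rename_ratfun \<beta> \<circ> rename_ratfun (inv_into UNIV \<beta>) = id"
    "rename_ratfun (inv_into UNIV \<beta>) \<circ> rename_ratfun \<beta> = id"
  using comp_inv_\<beta> [OF assms]
  by (simp_all add: assms bij_imp_bij_inv rename_ratfun_id flip: rename_ratfun_comp id_def)

lemma bij_rename_ratfun: "bij \<beta> \<Longrightarrow> bij (rename_ratfun \<beta>)"
  using rename_ratfun_inverse by (intro o_bij)

lemma rename_cremona_stable:
  assumes "\<beta> permutes {..<m}"
  shows "rename_ratfun \<beta> \<in> (cremona_stable m :: ('k::field ratfun \<Rightarrow> 'k ratfun) set)"
proof -
  have into: "rename_ratfun \<gamma> x \<in> ratfun_field m" if "\<gamma> permutes {..<m}" "x \<in> ratfun_field m" for \<gamma> and x :: "'k ratfun"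
    using that(2)
    by (rule ratfun_hom_into_field [rotated 2])
       (use that(1) permutes_bij [OF that(1)] permutes_in_image [OF that(1)] in
         \<open>auto simp: ratfun_hom_rename rename_ratfun_var intro!: ratfun_var_field\<close>)
  have \<beta>: "bij \<beta>" using assms by (rule permutes_bij)
  have hom: "ratfun_hom (rename_ratfun \<beta> :: 'k ratfun \<Rightarrow> _)" by (rule ratfun_hom_rename [OF \<beta>])
  have inverse: "rename_ratfun \<beta> (rename_ratfun (inv_into UNIV \<beta>) x) = x" "rename_ratfun (inv_into UNIV \<beta>) (rename_ratfun \<beta> x) = x" for x :: "'k ratfun"
    using rename_ratfun_inverse [OF \<beta>] by (auto simp: fun_eq_iff)
  have "bij_betw (rename_ratfun \<beta>) (ratfun_field m) (ratfun_field m :: 'k ratfun set)"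
    by (rule bij_betw_byWitness [where f' = "rename_ratfun (inv_into UNIV \<beta>)"])
       (auto simp: inverse into assms permutes_inv)
  then have "restrict (rename_ratfun \<beta>) (ratfun_field m) \<in> carrier (cremona_group m :: ('k ratfun \<Rightarrow> _) monoid)"
    using hom
    by (auto simp: cremona_group_def aut_group_def Bij_def bij_betw_restrict_eq ratfun_field_closed
        ratfun_const_field ratfun_hom_add ratfun_hom_mult ratfun_hom_const)
  moreover have "rename_ratfun \<beta> (ratfun_var i) = ratfun_var i" if "m \<le> i" for i
    using permutes_not_in [OF assms, of i] that by (simp add: rename_ratfun_var \<beta>)
  ultimately show ?thesis
    using bij_rename_ratfun [OF \<beta>] hom unfolding cremona_stable_def aut_group_UNIV by blast
qed

section \<open>Permutations of blocks of variables\<close>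

definition block_perm :: "nat \<Rightarrow> (nat \<Rightarrow> nat) \<Rightarrow> nat \<Rightarrow> nat" where
  "block_perm n \<pi> i = \<pi> (i div n) * n + i mod n"

lemma block_perm_comp: "0 < n \<Longrightarrow> block_perm n (\<pi> \<circ> \<pi>') = block_perm n \<pi> \<circ> block_perm n \<pi>'"
  by (simp add: block_perm_def fun_eq_iff)

lemma block_perm_id: "block_perm n id = id"
  by (simp add: block_perm_def fun_eq_iff)

lemma block_perm_permutes:
  assumes "0 < n" "\<pi> permutes {..<N}"
  shows "block_perm n \<pi> permutes {..<N * n}"
  unfolding permutes_def bij_iff [symmetric]
proof (intro conjI allI impI)
  have "block_perm n \<pi> \<circ> block_perm n (inv_into UNIV \<pi>) = id" "block_perm n (inv_into UNIV \<pi>) \<circ> block_perm n \<pi> = id"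
    using assms by (simp_all add: block_perm_id permutes_inv_o flip: block_perm_comp)
  then show "bij (block_perm n \<pi>)" by (intro o_bij)
next
  fix i assume "i \<notin> {..<N * n}"
  then have "\<not> i div n < N" using assms(1) by (simp add: div_less_iff_less_mult)
  then have "\<pi> (i div n) = i div n" using permutes_not_in [OF assms(2)] by simp
  then show "block_perm n \<pi> i = i" by (simp add: block_perm_def)
qed

lemma permutation_permutes_lessThan:
  fixes \<pi> :: "nat \<Rightarrow> nat"
  assumes "permutation \<pi>"
  obtains N where "\<pi> permutes {..<N}"
proof -
  obtain S where S: "finite S" "\<pi> permutes S"
    using assms by (auto simp: permutation_permutes)
  then obtain N where "S \<subseteq> {..<N}"
    by (metis finite_nat_iff_bounded)
  then show thesis using that S permutes_subset by blast
qed

text \<open>Let \<open>n\<close> be large enough for all of \<open>F\<close>, and let block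
  \<open>j\<close> consist of the variables from \<open>j * n\<close> to
  \<open>j * n + n - 1\<close>. Elements of \<open>F\<close> preserve the field of block 0 and fix
  all other variables, and conjugation by a block permutation moves them to another block. Since all
  maps are endomorphisms over the constants, commutation is checked on variables.\<close>

lemma permutable_copies_cremona_group_infinity:
  fixes F :: "('k::field ratfun \<Rightarrow> 'k ratfun) set"
  assumes group: "group (cremona_group_infinity :: ('k ratfun \<Rightarrow> 'k ratfun) monoid)"
    and F: "finite F" "F \<subseteq> carrier cremona_group_infinity" "\<one>\<^bsub>cremona_group_infinity\<^esub> \<in> F"
  obtains \<sigma> where "permutable_copies cremona_group_infinity F \<sigma>"
proof -
  let ?G = "cremona_group_infinity :: ('k ratfun \<Rightarrow> 'k ratfun) monoid"
  interpret G: group ?G by (rule group)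
  have carrier: "carrier ?G = (\<Union>n. cremona_stable n)"
    by (simp add: cremona_group_infinity_def)
  have "\<forall>h\<in>F. \<exists>n. ratfun_stable n h"
    using F(2) carrier cremona_stable_imp_stable by blast
  then obtain d where d: "\<And>h. h \<in> F \<Longrightarrow> ratfun_stable (d h) h" by metis
  \<comment> \<open>The successor makes \<open>n\<close> positive even if \<open>F\<close> moves no
    variable, so that division into blocks makes sense.\<close>
  define n where "n = Suc (Max (d ` F))"
  have n: "0 < n" by (simp add: n_def)
  have stable: "ratfun_stable n h" if "h \<in> F" for h
  proof -
    have "d h \<le> n" using F(1) that by (auto simp: n_def intro!: le_SucI Max_ge)
    then show ?thesis using d [OF that] ratfun_stable_mono by blast
  qed
  have hom: "ratfun_hom h" and bij: "bij h"
    and var_far: "\<And>i. n \<le> i \<Longrightarrow> h (ratfun_var i) = ratfun_var i"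
    and into: "\<And>x. x \<in> ratfun_field n \<Longrightarrow> h x \<in> ratfun_field n" if "h \<in> F" for h
    using stable [OF that] by (auto simp: ratfun_stable_def)
  define \<sigma> where "\<sigma> \<pi> = (rename_ratfun (block_perm n \<pi>) :: 'k ratfun \<Rightarrow> 'k ratfun)" for \<pi>
  have bij_block: "bij (block_perm n \<pi>)" if "permutation \<pi>" for \<pi>
    using that n by (auto elim!: permutation_permutes_lessThan intro: permutes_bij block_perm_permutes)
  have hom_\<sigma>: "ratfun_hom (\<sigma> \<pi>)" and bij_\<sigma>: "bij (\<sigma> \<pi>)"
    and \<sigma>_var: "\<And>i. \<sigma> \<pi> (ratfun_var i) = ratfun_var (\<pi> (i div n) * n + i mod n)" if "permutation \<pi>" for \<pi>
    using bij_block [OF that]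
    by (simp_all add: \<sigma>_def ratfun_hom_rename bij_rename_ratfun rename_ratfun_var block_perm_def)
  have closed: "\<sigma> \<pi> \<in> carrier ?G" if "permutation \<pi>" for \<pi>
    unfolding carrier \<sigma>_def
    using that n by (metis UNIV_I UN_I permutation_permutes_lessThan rename_cremona_stable block_perm_permutes)
  have comp: "\<sigma> (\<pi> \<circ> \<pi>') = \<sigma> \<pi> \<circ> \<sigma> \<pi>'" if "permutation \<pi>" "permutation \<pi>'" for \<pi> \<pi>'
    using that n by (simp add: \<sigma>_def block_perm_comp rename_ratfun_comp bij_block)
  have mult: "f \<otimes>\<^bsub>?G\<^esub> g = f \<circ> g" if "bij f" "bij g" for f g
    using that by (rule mult_cremona_group_infinity)
  have inv: "inv\<^bsub>?G\<^esub> (\<sigma> \<pi>) = \<sigma> (inv_into UNIV \<pi>)" if "permutation \<pi>" for \<pi>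
  proof (rule G.inv_equality)
    have p: "permutation (inv_into UNIV \<pi>)" using that by (rule permutation_inverse)
    have "inv_into UNIV \<pi> \<circ> \<pi> = id" using that by (simp add: permutation_inverse_works)
    then show "\<sigma> (inv_into UNIV \<pi>) \<otimes>\<^bsub>?G\<^esub> \<sigma> \<pi> = \<one>\<^bsub>?G\<^esub>"
      using that p comp [OF p that]
      by (simp add: mult bij_\<sigma> one_cremona_group_infinity)
         (simp add: \<sigma>_def block_perm_id rename_ratfun_id)
    show "\<sigma> \<pi> \<in> carrier ?G" "\<sigma> (inv_into UNIV \<pi>) \<in> carrier ?G"
      using that p closed by auto
  qed
  have "permutable_copies ?G F \<sigma>"
  proof (intro permutable_copies.intro group permutable_copies_axioms.intro F closed)
    fix \<pi> \<pi>' :: "nat \<Rightarrow> nat" assume "permutation \<pi>" "permutation \<pi>'"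
    then show "\<sigma> (\<pi> \<circ> \<pi>') = \<sigma> \<pi> \<otimes>\<^bsub>?G\<^esub> \<sigma> \<pi>'"
      by (simp add: comp mult bij_\<sigma>)
  next
    fix \<pi> :: "nat \<Rightarrow> nat" and h assume \<pi>: "permutation \<pi>" "\<pi> 0 = 0" and h: "h \<in> F"
    have fix_field: "\<sigma> \<pi> x = x" if "x \<in> ratfun_field n" for x
      using ratfun_hom_eq_on_field [OF hom_\<sigma> [OF \<pi>(1)] ratfun_hom_id _ that] \<pi> by (simp add: \<sigma>_var)
    have inj: "inj \<pi>" using \<pi>(1) by (simp add: bij_is_inj permutation_bijective)
    have "\<sigma> \<pi> \<circ> h = h \<circ> \<sigma> \<pi>"
    proof (rule ratfun_hom_eqI)
      fix i show "(\<sigma> \<pi> \<circ> h) (ratfun_var i) = (h \<circ> \<sigma> \<pi>) (ratfun_var i)"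
      proof (cases "i < n")
        case True
        then show ?thesis
          using fix_field [OF into [OF h ratfun_var_field]] fix_field [OF ratfun_var_field [OF True]] by simp
      next
        case False
        then have "i div n \<noteq> 0" using n by (simp add: div_eq_0_iff)
        then have "\<pi> (i div n) \<noteq> 0" using inj \<pi>(2) by (metis injD)
        then have "n \<le> \<pi> (i div n) * n + i mod n" by (simp add: trans_le_add1)
        then show ?thesis
          using False by (simp add: \<sigma>_var \<pi> var_far [OF h])
      qed
    qed (simp_all add: ratfun_hom_comp hom_\<sigma> \<pi> hom h)
    then show "\<sigma> \<pi> \<otimes>\<^bsub>?G\<^esub> h = h \<otimes>\<^bsub>?G\<^esub> \<sigma> \<pi>"
      by (simp add: mult bij_\<sigma> \<pi> bij h)
  next
    fix \<pi> :: "nat \<Rightarrow> nat" and h h' assume \<pi>: "permutation \<pi>" "\<pi> 0 \<noteq> 0" and h: "h \<in> F" "h' \<in> F"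
    define \<pi>' where "\<pi>' = inv_into UNIV \<pi>"
    have \<pi>': "permutation \<pi>'" unfolding \<pi>'_def using \<pi>(1) by (rule permutation_inverse)
    have inverse: "\<pi> (\<pi>' j) = j" for j
      using \<pi>(1) by (simp add: \<pi>'_def permutation_bijective bij_is_surj surj_f_inv_f)
    define c where "c = \<sigma> \<pi> \<circ> h' \<circ> \<sigma> \<pi>'"
    have hom_c: "ratfun_hom c" and bij_c: "bij c"
      unfolding c_def using \<pi> \<pi>' h by (simp_all add: ratfun_hom_comp hom_\<sigma> hom bij_comp bij_\<sigma> bij)
    \<comment> \<open>\<open>\<sigma> \<pi>\<close> carries the field of block 0 into that of block
      \<open>\<pi> 0\<close>, which \<open>h\<close> fixes pointwise.\<close>
    have h_\<sigma>: "h (\<sigma> \<pi> x) = \<sigma> \<pi> x" if "x \<in> ratfun_field n" for x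
    proof -
      have "(h \<circ> \<sigma> \<pi>) x = \<sigma> \<pi> x"
      proof (rule ratfun_hom_eq_on_field [OF _ hom_\<sigma> [OF \<pi>(1)] _ that])
        fix i assume "i < n"
        moreover have "n \<le> \<pi> 0 * n + i" using \<pi>(2) by (simp add: trans_le_add1)
        ultimately show "(h \<circ> \<sigma> \<pi>) (ratfun_var i) = \<sigma> \<pi> (ratfun_var i)"
          by (simp add: \<sigma>_var \<pi> var_far h)
      qed (rule ratfun_hom_comp [OF hom [OF h(1)] hom_\<sigma> [OF \<pi>(1)]])
      then show ?thesis by simp
    qed
    have c_far: "c (ratfun_var i) = ratfun_var i" if "\<pi>' (i div n) \<noteq> 0" for i
    proof -
      have "n \<le> \<pi>' (i div n) * n + i mod n" using that by (simp add: trans_le_add1)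
      then show ?thesis
        using n by (simp add: c_def \<sigma>_var \<pi> \<pi>' var_far h inverse)
    qed
    have c_block: "c x = x" if "x \<in> ratfun_field n" for x
    proof -
      have "\<pi>' 0 \<noteq> 0" using inverse [of 0] \<pi>(2) by metis
      then have "c x = id x"
        by (intro ratfun_hom_eq_on_field [OF hom_c ratfun_hom_id _ that]) (simp add: c_far)
      then show ?thesis by simp
    qed
    \<comment> \<open>There are three kinds of variables: those of block 0, which \<open>h\<close>
      sends into a field fixed by \<open>c\<close>; those of block \<open>\<pi> 0\<close>, which
      \<open>c\<close> sends into a field fixed by \<open>h\<close>; and the others, fixed by
      both.\<close>
    have "c \<circ> h = h \<circ> c"
    proof (rule ratfun_hom_eqI)
      fix i show "(c \<circ> h) (ratfun_var i) = (h \<circ> c) (ratfun_var i)"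
      proof (cases "i < n")
        case True
        then show ?thesis
          using c_block [OF into [OF h(1) ratfun_var_field]] c_block [OF ratfun_var_field [OF True]] by simp
      next
        case i: False
        show ?thesis
        proof (cases "\<pi>' (i div n) = 0")
          case True
          have "c (ratfun_var i) = \<sigma> \<pi> (h' (ratfun_var (i mod n)))"
            by (simp add: c_def \<sigma>_var \<pi>' True)
          moreover have "h' (ratfun_var (i mod n)) \<in> ratfun_field n"
            using n by (intro into [OF h(2) ratfun_var_field]) simp
          ultimately show ?thesis
            using i by (simp add: h_\<sigma> var_far h)
        next
          case False
          then show ?thesis
            using i by (simp add: c_far var_far h)
        qed
      qed
    qed (simp_all add: ratfun_hom_comp hom_c hom h)
    then show "\<sigma> \<pi> \<otimes>\<^bsub>?G\<^esub> h' \<otimes>\<^bsub>?G\<^esub> inv\<^bsub>?G\<^esub> (\<sigma> \<pi>) \<otimes>\<^bsub>?G\<^esub> h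
        = h \<otimes>\<^bsub>?G\<^esub> (\<sigma> \<pi> \<otimes>\<^bsub>?G\<^esub> h' \<otimes>\<^bsub>?G\<^esub> inv\<^bsub>?G\<^esub> (\<sigma> \<pi>))"
      using \<pi> \<pi>' h bij_c by (simp add: inv mult bij_\<sigma> bij bij_comp c_def flip: \<pi>'_def)
  qed
  then show thesis by (rule that)
qed

theorem corollary1p11:
  shows "Xsep_boundedly_acyclic
           (cremona_group_infinity :: ('k::field ratfun \<Rightarrow> 'k ratfun) monoid)
           TYPE('e::banach) TYPE('f::banach)"
  by (rule Xsep_boundedly_acyclic_if_permutable_copies)
     (metis permutable_copies_cremona_group_infinity)

end
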